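(* Let $n\in\mathbb{N}$. If $Ct_{\mathbb{N}}(n)$ is zero-dimensional, then $Ct^S_{\mathbb{R}}(n+1)=Ct^E_{\mathbb{R}}(n+1)$ as topological spaces.
   Context: All domains are bounded-complete $\omega$-algebraic with the Scott topology; $D\to D'$ is the domain of Scott-continuous maps. Kleene–Kreisel: $N(0)=\mathbb{N}_\bot$, $N(k+1)=N(k)\to N(0)$; $n\approx^N_0 m$ iff $n=m\in\mathbb{N}$; $f\approx^N_{k+1}g$ iff $f(a)\approx^N_0 g(b)$ whenever $a\approx^N_k b$; $\bar N(k)=\{x:x\approx^N_k x\}$; $Ct_{\mathbb{N}}(k)=\bar N(k)/\approx^N_k$ with the quotient topology ($Ct_{\mathbb{N}}(0)=\mathbb{N}$, $Ct_{\mathbb{N}}(k+1)$ = continuous maps $Ct_{\mathbb{N}}(k)\to\mathbb{N}$). Extensional hierarchy: $E(0)$ is the ideal completion of $\{\mathbb{R}\}\cup\{[p,q]:p\le q\text{ rational}\}$ under reverse inclusion, $E(k+1)=E(k)\to E(0)$; $\alpha\approx^E_0\beta$ iff $\bigcap\alpha=\bigcap\beta=\{x\}$, $x\in\mathbb{R}$; higher $\approx^E_k$, $\bar E(k)$ analogous; $\rho^E_0(\alpha)=x$ where $\bigcap\alpha=\{x\}$, $\rho^E_{k+1}(f)(\rho^E_k(y))=\rho^E_0(f(y))$; $Ct^E_{\mathbb{R}}(0)=\mathbb{R}$, $Ct^E_{\mathbb{R}}(k+1)=\rho^E_{k+1}[\bar E(k+1)]$ (functions $Ct^E_{\mathbb{R}}(k)\to\mathbb{R}$)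 with the quotient topology. Smoothened intensional hierarchy: $S(0)$ consists of the empty sequence and all finite and infinite sequences $ab_1b_2\dots$ with $a\in\mathbb{Z}$, $b_i\in\{-1,0,1\}$, ordered by extension; for maximal elements $\rho^S_0(ab_1b_2\cdots)=a+\sum_{n\ge1}b_n2^{-n}$; $x_1\sim_0x_2$ iff they have maximal extensions with equal $\rho^S_0$-value; $S(k+1)$ is the set of Scott-continuous $f:S(k)\to S(0)$ with $x_1\sim_kx_2\Rightarrow f(x_1)\sim_0f(x_2)$, ordered pointwise; $f_1\sim_{k+1}f_2$ iff $x_1\sim_kx_2\Rightarrow f_1(x_1)\sim_0f_2(x_2)$. $\bar S(0)$ = maximal elements, $\approx^S_0$ = $\sim_0$ restricted to them; $f\approx^S_{k+1}g$ iff $f(x)\approx^S_0 g(y)$ whenever $x\approx^S_k y$; $\bar S(k)=\{x:x\approx^S_kx\}$; $\rho^S_{k+1}(f)(\rho^S_k(y))=\rho^S_0(f(y))$; $Ct^S_{\mathbb{R}}(0)=\mathbb{R}$, $Ct^S_{\mathbb{R}}(k+1)=\rho^S_{k+1}[\bar S(k+1)]$ with the quotient topology. Both $Ct^S_{\mathbb{R}}(k+1)$ and $Ct^E_{\mathbb{R}}(k+1)$ are sets of real-valued functions, so equality means equality of these sets of functions together with equality of their topologies. A space is zero-dimensional if it has a basis of clopen sets. *)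

theory Defs
  imports "HOL-Analysis.Analysis"
begin

section \<open>Scott topology and quotient topology on carrier sets\<close>

definition directed_in :: "('a \<Rightarrow> 'a \<Rightarrow> bool) \<Rightarrow> 'a set \<Rightarrow> 'a set \<Rightarrow> bool" where
  "directed_in le A D \<longleftrightarrow>
     D \<subseteq> A \<and> D \<noteq> {} \<and> (\<forall>x\<in>D. \<forall>y\<in>D. \<exists>z\<in>D. le x z \<and> le y z)"

definition lub_in :: "('a \<Rightarrow> 'a \<Rightarrow> bool) \<Rightarrow> 'a set \<Rightarrow> 'a set \<Rightarrow> 'a \<Rightarrow> bool" where
  "lub_in le A D s \<longleftrightarrow>
     s \<in> A \<and> (\<forall>x\<in>D. le x s) \<and> (\<forall>u\<in>A. (\<forall>x\<in>D. le x u) \<longrightarrow> le s u)"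

definition scott_open :: "('a \<Rightarrow> 'a \<Rightarrow> bool) \<Rightarrow> 'a set \<Rightarrow> 'a set \<Rightarrow> bool" where
  "scott_open le A U \<longleftrightarrow>
     U \<subseteq> A \<and>
     (\<forall>x\<in>U. \<forall>y\<in>A. le x y \<longrightarrow> y \<in> U) \<and>
     (\<forall>D s. directed_in le A D \<and> lub_in le A D s \<and> s \<in> U \<longrightarrow> D \<inter> U \<noteq> {})"

definition scott :: "('a \<Rightarrow> 'a \<Rightarrow> bool) \<Rightarrow> 'a set \<Rightarrow> 'a topology" where
  "scott le A = topology (scott_open le A)"

lemma istopology_scott_open: "istopology (scott_open le A)"
  unfolding istopology_def
proof (intro conjI allI impI)
  fix U V assume U: "scott_open le A U" and V: "scott_open le A V"
  show "scott_open le A (U \<inter> V)"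
    unfolding scott_open_def
  proof (intro conjI allI impI)
    show "U \<inter> V \<subseteq> A" using U by (auto simp: scott_open_def)
    show "\<forall>x\<in>U \<inter> V. \<forall>y\<in>A. le x y \<longrightarrow> y \<in> U \<inter> V"
      using U V unfolding scott_open_def by blast
    fix D s assume D: "directed_in le A D \<and> lub_in le A D s \<and> s \<in> U \<inter> V"
    then obtain d e where de: "d \<in> D" "d \<in> U" "e \<in> D" "e \<in> V"
      using U V unfolding scott_open_def by blast
    with D obtain z where z: "z \<in> D" "le d z" "le e z"
      unfolding directed_in_def by blast
    moreover have "z \<in> A" using D z unfolding directed_in_def by blast
    ultimately have "z \<in> U \<inter> V"
      using de U V unfolding scott_open_def by blast
    with z show "D \<inter> (U \<inter> V) \<noteq> {}" by blast
  qed
next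
  fix K assume K: "\<forall>U\<in>K. scott_open le A U"
  show "scott_open le A (\<Union>K)"
    unfolding scott_open_def
  proof (intro conjI allI impI)
    show "\<Union>K \<subseteq> A" using K by (auto simp: scott_open_def)
    show "\<forall>x\<in>\<Union>K. \<forall>y\<in>A. le x y \<longrightarrow> y \<in> \<Union>K"
      using K unfolding scott_open_def by blast
    fix D s assume D: "directed_in le A D \<and> lub_in le A D s \<and> s \<in> \<Union>K"
    then obtain U where "U \<in> K" "s \<in> U" by blast
    then have "D \<inter> U \<noteq> {}" using D K unfolding scott_open_def by blast
    then show "D \<inter> \<Union>K \<noteq> {}" using \<open>U \<in> K\<close> by blast
  qed
qed

lemma openin_scott: "openin (scott le A) U \<longleftrightarrow> scott_open le A U"
  by (simp add: scott_def istopology_scott_open topology_inverse')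

lemma topspace_scott [simp]: "topspace (scott le A) = A"
proof -
  have "scott_open le A A"
    unfolding scott_open_def directed_in_def by blast
  then show ?thesis
    by (meson openin_scott openin_subset openin_topspace scott_open_def subset_antisym)
qed

definition quotient_topology :: "'a topology \<Rightarrow> ('a \<Rightarrow> 'b) \<Rightarrow> 'b topology" where
  "quotient_topology X q =
     topology (\<lambda>U. U \<subseteq> q ` topspace X \<and> openin X {x \<in> topspace X. q x \<in> U})"

lemma openin_quotient_topology:
  "openin (quotient_topology X q) U \<longleftrightarrow>
     U \<subseteq> q ` topspace X \<and> openin X {x \<in> topspace X. q x \<in> U}"
proof -
  let ?P = "\<lambda>U. U \<subseteq> q ` topspace X \<and> openin X {x \<in> topspace X. q x \<in> U}"
  have "istopology ?P"
    unfolding istopology_def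
  proof (intro conjI allI impI)
    fix S T assume S: "?P S" and T: "?P T"
    have "{x \<in> topspace X. q x \<in> S \<inter> T} =
        {x \<in> topspace X. q x \<in> S} \<inter> {x \<in> topspace X. q x \<in> T}" by blast
    then show "openin X {x \<in> topspace X. q x \<in> S \<inter> T}"
      using S T by (simp add: openin_Int)
    show "S \<inter> T \<subseteq> q ` topspace X" using S by blast
  next
    fix K assume K: "\<forall>S\<in>K. ?P S"
    have "{x \<in> topspace X. q x \<in> \<Union>K} = (\<Union>S\<in>K. {x \<in> topspace X. q x \<in> S})" by blast
    moreover have "openin X (\<Union>S\<in>K. {x \<in> topspace X. q x \<in> S})"
      using K by (intro openin_Union) blast
    ultimately show "openin X {x \<in> topspace X. q x \<in> \<Union>K}" by simp
    show "\<Union>K \<subseteq> q ` topspace X" using K by blast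
  qed
  then show ?thesis
    by (simp add: quotient_topology_def topology_inverse')
qed

lemma topspace_quotient_topology [simp]:
  "topspace (quotient_topology X q) = q ` topspace X"
proof -
  have "{x \<in> topspace X. q x \<in> q ` topspace X} = topspace X" by blast
  then have "openin (quotient_topology X q) (q ` topspace X)"
    by (simp add: openin_quotient_topology)
  then show ?thesis
    by (meson openin_quotient_topology openin_subset openin_topspace subset_antisym)
qed

lemma quotient_map_quotient_topology: "quotient_map X (quotient_topology X q) q"
  by (auto simp: quotient_map_def openin_quotient_topology)

definition zero_dimensional :: "'a topology \<Rightarrow> bool" where
  "zero_dimensional X \<longleftrightarrow>
     (\<exists>\<B>. (\<forall>U\<in>\<B>. openin X U \<and> closedin X U) \<and>
          openin X = (arbitrary union_of (\<lambda>U. U \<in> \<B>)))"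


section \<open>A universe of hereditary functions\<close>

text \<open>
  All levels \<open>k\<close> of a hierarchy over a ground type \<open>'b\<close> live in the one type \<open>'b fnl\<close>.
  Elements of level \<open>0\<close> are \<open>Base b\<close>; an element of level \<open>k + 1\<close> is a set-theoretic function
  from level \<open>k\<close> to \<open>'b\<close>, identified with its graph.  A graph is stored through a canonical
  enumeration indexed by the reals (\<open>of_graph\<close>), so every nonempty graph of cardinality at most
  the continuum is represented by exactly one element of \<open>'b fnl\<close> (\<open>graph_of_graph\<close>,
  \<open>of_graph_inject\<close>).  This suffices here: an \<open>\<omega>\<close>-algebraic domain has at most continuum many
  elements, because an element is determined by the set of compact elements below it.
\<close>

datatype 'b fnl = Base (base: 'b) | Enum "real \<Rightarrow> 'b fnl \<times> 'b"

fun graph :: "'b fnl \<Rightarrow> ('b fnl \<times> 'b) set" where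
  "graph (Base b) = {}"
| "graph (Enum e) = range e"

definition of_graph :: "('b fnl \<times> 'b) set \<Rightarrow> 'b fnl" where
  "of_graph G = Enum (SOME e. range e = G)"

definition lam :: "'b fnl set \<Rightarrow> ('b fnl \<Rightarrow> 'b) \<Rightarrow> 'b fnl" where
  "lam A f = of_graph {(x, f x) | x. x \<in> A}"

definition app :: "'b fnl \<Rightarrow> 'b fnl \<Rightarrow> 'b" where
  "app f x = (THE b. (x, b) \<in> graph f)"

lemma graph_of_graph:
  assumes "G \<noteq> {}" and "G \<lesssim> (UNIV :: real set)"
  shows "graph (of_graph G) = G"
proof -
  obtain h :: "_ \<Rightarrow> real" where h: "inj_on h G"
    using assms(2) by (auto simp: lepoll_def)
  obtain g where g: "g \<in> G" using assms(1) by blast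
  define e where "e r = (if r \<in> h ` G then inv_into G h r else g)" for r
  have "range e \<subseteq> G"
    using g by (auto simp: e_def inv_into_into)
  moreover have "x \<in> range e" if "x \<in> G" for x
    using that h by (intro range_eqI[of _ _ "h x"]) (simp add: e_def)
  ultimately have "range e = G" by blast
  then have "\<exists>e :: real \<Rightarrow> _. range e = G" by blast
  from someI_ex[OF this] show ?thesis by (simp add: of_graph_def)
qed

lemma of_graph_inject:
  assumes "G \<noteq> {}" "G \<lesssim> (UNIV :: real set)" "H \<noteq> {}" "H \<lesssim> (UNIV :: real set)"
  shows "of_graph G = of_graph H \<longleftrightarrow> G = H"
  using assms graph_of_graph by metis

lemma graph_lam:
  assumes "A \<noteq> {}" and "A \<lesssim> (UNIV :: real set)"
  shows "graph (lam A f) = {(x, f x) | x. x \<in> A}"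
proof -
  have eq: "{(x, f x) | x. x \<in> A} = (\<lambda>x. (x, f x)) ` A" by blast
  have "(\<lambda>x. (x, f x)) ` A \<lesssim> A" by (rule image_lepoll)
  then have "(\<lambda>x. (x, f x)) ` A \<lesssim> (UNIV :: real set)"
    using assms(2) lepoll_trans by blast
  then show ?thesis
    unfolding lam_def eq using assms(1) by (intro graph_of_graph) auto
qed

lemma app_lam:
  assumes "A \<lesssim> (UNIV :: real set)" and "x \<in> A"
  shows "app (lam A f) x = f x"
proof -
  have "graph (lam A f) = {(x, f x) | x. x \<in> A}"
    using assms by (intro graph_lam) auto
  then show ?thesis using assms(2) by (auto simp: app_def)
qed

text \<open>The pointwise order, for functions having the same domain of definition.\<close>

fun pointwise :: "('b \<Rightarrow> 'b \<Rightarrow> bool) \<Rightarrow> 'b fnl \<Rightarrow> 'b fnl \<Rightarrow> bool" where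
  "pointwise le (Base a) (Base b) \<longleftrightarrow> le a b"
| "pointwise le (Enum d) (Enum e) \<longleftrightarrow>
     (\<forall>x \<in> fst ` graph (Enum d). le (app (Enum d) x) (app (Enum e) x))"
| "pointwise le _ _ \<longleftrightarrow> False"


section \<open>Hierarchies of domains and of total objects\<close>

primrec dom_hier :: "'b set \<Rightarrow> ('b \<Rightarrow> 'b \<Rightarrow> bool) \<Rightarrow> nat \<Rightarrow> 'b fnl set" where
  "dom_hier B le 0 = Base ` B"
| "dom_hier B le (Suc k) =
     {lam (dom_hier B le k) f | f.
        continuous_map (scott (pointwise le) (dom_hier B le k)) (scott le B) f}"

text \<open>
  In the following, \<open>X k\<close> is the domain of level \<open>k\<close> and \<open>eq\<close> is the partial equivalence
  relation on the ground domain.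
\<close>

primrec per :: "('b \<Rightarrow> 'b \<Rightarrow> bool) \<Rightarrow> (nat \<Rightarrow> 'b fnl set) \<Rightarrow> nat \<Rightarrow> 'b fnl \<Rightarrow> 'b fnl \<Rightarrow> bool" where
  "per eq X 0 = (\<lambda>x y. x \<in> X 0 \<and> y \<in> X 0 \<and> eq (base x) (base y))"
| "per eq X (Suc k) =
     (\<lambda>f g. f \<in> X (Suc k) \<and> g \<in> X (Suc k) \<and>
        (\<forall>x y. per eq X k x y \<longrightarrow> eq (app f x) (app g y)))"

definition total :: "('b \<Rightarrow> 'b \<Rightarrow> bool) \<Rightarrow> (nat \<Rightarrow> 'b fnl set) \<Rightarrow> nat \<Rightarrow> 'b fnl set" where
  "total eq X k = {x \<in> X k. per eq X k x x}"

definition total_space ::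
  "('b \<Rightarrow> 'b \<Rightarrow> bool) \<Rightarrow> ('b \<Rightarrow> 'b \<Rightarrow> bool) \<Rightarrow> (nat \<Rightarrow> 'b fnl set) \<Rightarrow> nat \<Rightarrow> 'b fnl topology" where
  "total_space le eq X k = subtopology (scott (pointwise le) (X k)) (total eq X k)"

text \<open>
  \<open>rho r eq X k x\<close> is the functional over the reals represented by the total object \<open>x\<close>, where
  \<open>r\<close> maps total ground objects to the real numbers they represent; the functional is given by
  its graph, whose first components range over the functionals of level \<open>k\<close>.
\<close>

primrec rho :: "('b \<Rightarrow> real) \<Rightarrow> ('b \<Rightarrow> 'b \<Rightarrow> bool) \<Rightarrow> (nat \<Rightarrow> 'b fnl set) \<Rightarrow> nat \<Rightarrow> 'b fnl \<Rightarrow> real fnl" where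
  "rho r eq X 0 = (\<lambda>x. Base (r (base x)))"
| "rho r eq X (Suc k) =
     (\<lambda>f. of_graph {(rho r eq X k y, r (app f y)) | y. y \<in> total eq X k})"


section \<open>The Kleene--Kreisel functionals\<close>

text \<open>The ground domain is the flat domain of natural numbers, with \<open>None\<close> as bottom.\<close>

definition N_le :: "nat option \<Rightarrow> nat option \<Rightarrow> bool" where
  "N_le a b \<longleftrightarrow> a = None \<or> a = b"

definition N_eq :: "nat option \<Rightarrow> nat option \<Rightarrow> bool" where
  "N_eq a b \<longleftrightarrow> (\<exists>n. a = Some n \<and> b = Some n)"

definition N_dom :: "nat \<Rightarrow> nat option fnl set" where
  "N_dom = dom_hier UNIV N_le"

definition Ct_N :: "nat \<Rightarrow> nat option fnl set topology" where
  "Ct_N k = quotient_topology (total_space N_le N_eq N_dom k)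
              (\<lambda>x. {y. per N_eq N_dom k x y})"


section \<open>The extensional hierarchy over the reals\<close>

definition E_basis :: "real set set" where
  "E_basis = insert UNIV {{p..q} | p q. p \<in> \<rat> \<and> q \<in> \<rat> \<and> p \<le> q}"

text \<open>The ideals of \<open>E_basis\<close> under reverse inclusion, ordered by inclusion.\<close>

definition E_ideals :: "real set set set" where
  "E_ideals = {\<alpha>. \<alpha> \<subseteq> E_basis \<and> \<alpha> \<noteq> {} \<and>
     (\<forall>I\<in>\<alpha>. \<forall>J\<in>E_basis. I \<subseteq> J \<longrightarrow> J \<in> \<alpha>) \<and>
     (\<forall>I\<in>\<alpha>. \<forall>J\<in>\<alpha>. \<exists>K\<in>\<alpha>. K \<subseteq> I \<and> K \<subseteq> J)}"

definition E_eq :: "real set set \<Rightarrow> real set set \<Rightarrow> bool" where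
  "E_eq \<alpha> \<beta> \<longleftrightarrow> (\<exists>x. \<Inter>\<alpha> = {x} \<and> \<Inter>\<beta> = {x})"

definition E_val :: "real set set \<Rightarrow> real" where
  "E_val \<alpha> = (THE x. \<Inter>\<alpha> = {x})"

definition E_dom :: "nat \<Rightarrow> real set set fnl set" where
  "E_dom = dom_hier E_ideals (\<subseteq>)"

abbreviation E_rho :: "nat \<Rightarrow> real set set fnl \<Rightarrow> real fnl" where
  "E_rho \<equiv> rho E_val E_eq E_dom"

definition Ct_E_set :: "nat \<Rightarrow> real fnl set" where
  "Ct_E_set k = E_rho k ` total E_eq E_dom k"

definition Ct_E :: "nat \<Rightarrow> real fnl topology" where
  "Ct_E k = quotient_topology (total_space (\<subseteq>) E_eq E_dom k) (E_rho k)"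


section \<open>The smoothened intensional hierarchy over the reals\<close>

text \<open>
  A finite or infinite sequence \<open>a b\<^sub>1 b\<^sub>2 \<dots>\<close> is a partial function on the natural numbers whose
  domain is an initial segment, with \<open>a\<close> at position \<open>0\<close>.  Extension of sequences is then
  extension of partial functions.
\<close>

type_synonym digits = "nat \<Rightarrow> int option"

definition S_seqs :: "digits set" where
  "S_seqs = {s. (\<forall>i. s i = None \<longrightarrow> s (Suc i) = None) \<and>
                (\<forall>i b. s (Suc i) = Some b \<longrightarrow> b \<in> {-1, 0, 1})}"

definition S_max :: "digits set" where
  "S_max = {s \<in> S_seqs. \<forall>t\<in>S_seqs. s \<subseteq>\<^sub>m t \<longrightarrow> t = s}"

definition S_val :: "digits \<Rightarrow> real" where
  "S_val s = real_of_int (the (s 0)) + (\<Sum>n. real_of_int (the (s (Suc n))) / 2 ^ Suc n)"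

definition S_sim :: "digits \<Rightarrow> digits \<Rightarrow> bool" where
  "S_sim s t \<longleftrightarrow>
     (\<exists>s'\<in>S_max. \<exists>t'\<in>S_max. s \<subseteq>\<^sub>m s' \<and> t \<subseteq>\<^sub>m t' \<and> S_val s' = S_val t')"

definition S_eq :: "digits \<Rightarrow> digits \<Rightarrow> bool" where
  "S_eq s t \<longleftrightarrow> s \<in> S_max \<and> t \<in> S_max \<and> S_sim s t"

fun S_dom :: "nat \<Rightarrow> digits fnl set"
  and S_sims :: "nat \<Rightarrow> digits fnl \<Rightarrow> digits fnl \<Rightarrow> bool" where
  "S_dom 0 = Base ` S_seqs"
| "S_dom (Suc k) =
     {lam (S_dom k) f | f.
        continuous_map (scott (pointwise (\<subseteq>\<^sub>m)) (S_dom k)) (scott (\<subseteq>\<^sub>m) S_seqs) f \<and>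
        (\<forall>x\<in>S_dom k. \<forall>y\<in>S_dom k. S_sims k x y \<longrightarrow> S_sim (f x) (f y))}"
| "S_sims 0 x y \<longleftrightarrow> S_sim (base x) (base y)"
| "S_sims (Suc k) f g \<longleftrightarrow>
     (\<forall>x\<in>S_dom k. \<forall>y\<in>S_dom k. S_sims k x y \<longrightarrow> S_sim (app f x) (app g y))"

abbreviation S_rho :: "nat \<Rightarrow> digits fnl \<Rightarrow> real fnl" where
  "S_rho \<equiv> rho S_val S_eq S_dom"

definition Ct_S_set :: "nat \<Rightarrow> real fnl set" where
  "Ct_S_set k = S_rho k ` total S_eq S_dom k"

definition Ct_S :: "nat \<Rightarrow> real fnl topology" where
  "Ct_S k = quotient_topology (total_space (\<subseteq>\<^sub>m) S_eq S_dom k) (S_rho k)"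

end

theory Submission
  imports Defs
begin

text \<open>
  For \<open>n \<ge> 2\<close> the hypothesis fails (Schroeder's theorem).  To a finite or infinite sequence \<open>s\<close> of
  numbers assign the characteristic function \<open>F s\<close> of a suitable clopen subset of Baire space such
  that \<open>F (s @ [a])\<close> tends to \<open>F s\<close> as \<open>a\<close> tends to infinity and \<open>F x\<close> is the limit of
  \<open>F (x 0, ..., x (m - 1))\<close>, whereas the functions \<open>F x\<close> with \<open>x\<close> infinite form a closed set.  A
  clopen neighbourhood of \<open>F []\<close> then contains \<open>F s\<close> for all initial segments \<open>s\<close> of some infinite \<open>x\<close>,
  hence \<open>F x\<close>, so it cannot avoid that closed set.

  For \<open>n \<le> 1\<close> both hierarchies are compared with the limit spaces of functionals over the reals with
  continuous convergence.  Finite projections make all domains first countable, so the quotient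
  topologies are determined by convergent sequences, and it suffices to lift a convergent sequence
  of functionals to a convergent sequence of representatives.  In the extensional hierarchy a
  functional is extended by its range over all total objects above a finite approximation.  In
  the smoothened hierarchy digits are chosen greedily along the branch of the argument in a tree of
  finite pieces of information; this uses that intensional type one objects form a
  zero-dimensional space, and smoothness follows by finding, for equivalent approximations, a
  common total object via Helly's theorem and piecewise linear interpolation.
\<close>

text \<open>Lifting a convergent sequence U_m -> U rests on one device, used on both sides. The
  representative of the limit is not built from U alone: at stage n it leaves room for the values of
  U and of every U_j with j >= n. Continuous convergence shrinks these sets of values to the value
  of U, so the representative is still total. The representative of U_m only has to respect U_m
  itself after stage m, and so it ends up above more and more projections of the limit. The obstacle
  on the smoothened side is that values on partial arguments are constrained too: equivalent
  arguments must receive digit sequences with a common completion, although digits are never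
  revised. A digit is therefore written only if all values still possible allow it. A single total
  object compatible with both arguments then supplies the common value; producing it is the purpose
  of Helly's theorem and of the interpolation. On the extensional side the same interpolation gives
  the density of total objects, which keeps the values on partial objects consistent.\<close>

section \<open>Domains presented by finite projections\<close>

text \<open>The maps \<open>pr n\<close> are idempotent deflations with finite image and supremum
  the identity, and \<open>compact_pr\<close> makes their images compact. So the sets of elements
  above \<open>pr n x\<close> form a countable neighbourhood base at x, and topological questions
  reduce to sequences.\<close>

locale pdom =
  fixes A :: "'a set" and le :: "'a \<Rightarrow> 'a \<Rightarrow> bool" and pr :: "nat \<Rightarrow> 'a \<Rightarrow> 'a"
  assumes nonempty: "A \<noteq> {}"
    and refl: "x \<in> A \<Longrightarrow> le x x"
    and antisym: "x \<in> A \<Longrightarrow> y \<in> A \<Longrightarrow> le x y \<Longrightarrow> le y x \<Longrightarrow> x = y"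
    and trans: "x \<in> A \<Longrightarrow> y \<in> A \<Longrightarrow> z \<in> A \<Longrightarrow> le x y \<Longrightarrow> le y z \<Longrightarrow> le x z"
    and pr_in: "x \<in> A \<Longrightarrow> pr n x \<in> A"
    and pr_mono: "x \<in> A \<Longrightarrow> y \<in> A \<Longrightarrow> le x y \<Longrightarrow> le (pr n x) (pr n y)"
    and pr_le: "x \<in> A \<Longrightarrow> le (pr n x) x"
    and pr_idem: "x \<in> A \<Longrightarrow> pr n (pr n x) = pr n x"
    and pr_incr: "x \<in> A \<Longrightarrow> m \<le> n \<Longrightarrow> le (pr m x) (pr n x)"
    and finite_pr: "finite (pr n ` A)"
    and below: "x \<in> A \<Longrightarrow> u \<in> A \<Longrightarrow> (\<And>n. le (pr n x) u) \<Longrightarrow> le x u"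
    and compact_pr: "directed_in le A D \<Longrightarrow> lub_in le A D s \<Longrightarrow> \<exists>d\<in>D. le (pr n s) d"
    and complete: "directed_in le A D \<Longrightarrow> \<exists>s. lub_in le A D s"
begin

lemma directed_pr:
  assumes "x \<in> A" shows "directed_in le A (range (\<lambda>n. pr n x))"
proof -
  have "\<exists>k. le (pr m x) (pr k x) \<and> le (pr n x) (pr k x)" for m n
    using pr_incr[OF assms] by (meson max.cobounded1 max.cobounded2)
  then show ?thesis unfolding directed_in_def using pr_in assms by auto
qed

lemma lub_pr: "x \<in> A \<Longrightarrow> lub_in le A (range (\<lambda>n. pr n x)) x"
  unfolding lub_in_def using pr_le below by auto

lemma scott_open_iff:
  "scott_open le A U \<longleftrightarrow> U \<subseteq> A \<and> (\<forall>x\<in>U. \<exists>n. \<forall>y\<in>A. le (pr n x) y \<longrightarrow> y \<in> U)"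
proof
  assume U: "scott_open le A U"
  then have "U \<subseteq> A" by (auto simp: scott_open_def)
  moreover have "\<exists>n. \<forall>y\<in>A. le (pr n x) y \<longrightarrow> y \<in> U" if x: "x \<in> U" for x
  proof -
    have "x \<in> A" using x \<open>U \<subseteq> A\<close> by auto
    then have "range (\<lambda>n. pr n x) \<inter> U \<noteq> {}"
      using U directed_pr lub_pr x unfolding scott_open_def by metis
    then obtain n where "pr n x \<in> U" by auto
    then show ?thesis using U unfolding scott_open_def by blast
  qed
  ultimately show "U \<subseteq> A \<and> (\<forall>x\<in>U. \<exists>n. \<forall>y\<in>A. le (pr n x) y \<longrightarrow> y \<in> U)" by blast
next
  assume U: "U \<subseteq> A \<and> (\<forall>x\<in>U. \<exists>n. \<forall>y\<in>A. le (pr n x) y \<longrightarrow> y \<in> U)"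
  show "scott_open le A U"
    unfolding scott_open_def
  proof (intro conjI ballI allI impI)
    show "U \<subseteq> A" using U by auto
    show "y \<in> U" if "x \<in> U" "y \<in> A" "le x y" for x y
      using that U by (meson pr_in pr_le subsetD trans)
    show "D \<inter> U \<noteq> {}" if D: "directed_in le A D \<and> lub_in le A D s \<and> s \<in> U" for D s
    proof -
      obtain n where n: "\<forall>y\<in>A. le (pr n s) y \<longrightarrow> y \<in> U" using D U by blast
      obtain d where "d \<in> D" "le (pr n s) d" using D compact_pr by blast
      then show ?thesis using n D unfolding directed_in_def by blast
    qed
  qed
qed

lemma openin_subtopology_scott_iff:
  assumes T: "T \<subseteq> A"
  shows "openin (subtopology (scott le A) T) V \<longleftrightarrow>
    V \<subseteq> T \<and> (\<forall>x\<in>V. \<exists>n. \<forall>y\<in>T. le (pr n x) y \<longrightarrow> y \<in> V)"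
proof
  assume "openin (subtopology (scott le A) T) V"
  then obtain U where "scott_open le A U" "V = U \<inter> T"
    by (auto simp: openin_subtopology openin_scott)
  then show "V \<subseteq> T \<and> (\<forall>x\<in>V. \<exists>n. \<forall>y\<in>T. le (pr n x) y \<longrightarrow> y \<in> V)"
    using T unfolding scott_open_iff by blast
next
  assume V: "V \<subseteq> T \<and> (\<forall>x\<in>V. \<exists>n. \<forall>y\<in>T. le (pr n x) y \<longrightarrow> y \<in> V)"
  \<comment> \<open>A union of upper sets of projections, taking those whose trace on T lies in V.
    Such an upper set is Scott open by idempotence: if \<open>pr n x\<close> is below z, it is
    already below \<open>pr n z\<close>.\<close>
  define U where "U = {z\<in>A. \<exists>x\<in>V. \<exists>n. le (pr n x) z \<and> (\<forall>y\<in>T. le (pr n x) y \<longrightarrow> y \<in> V)}"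
  have "scott_open le A U"
    unfolding scott_open_iff
  proof (intro conjI ballI)
    fix z assume z: "z \<in> U"
    then obtain x n where x: "x \<in> V" "le (pr n x) z" "\<forall>y\<in>T. le (pr n x) y \<longrightarrow> y \<in> V" "z \<in> A"
      by (auto simp: U_def)
    have xA: "x \<in> A" using x V T by auto
    have *: "le (pr n x) (pr n z)"
      using pr_mono[of "pr n x" z n] x xA pr_in pr_idem by metis
    have "le (pr n x) y" if "y \<in> A" "le (pr n z) y" for y
      using * that trans xA x pr_in by blast
    then show "\<exists>n. \<forall>y\<in>A. le (pr n z) y \<longrightarrow> y \<in> U"
      using x unfolding U_def by blast
  qed (auto simp: U_def)
  moreover have "V = U \<inter> T"
    using V T pr_le unfolding U_def by blast
  ultimately show "openin (subtopology (scott le A) T) V"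
    by (auto simp: openin_subtopology openin_scott)
qed

lemma pr_pr: "x \<in> A \<Longrightarrow> m \<le> n \<Longrightarrow> le (pr m x) (pr n (pr m x))"
  using pr_incr[of "pr m x" m n] pr_in pr_idem by metis

text \<open>The coding by \<open>lam\<close> and \<open>app\<close> is faithful only on carriers of
  at most continuum size. An element is coded here by the sequence of positions of its projections
  in the finite images.\<close>

lemma lepoll_reals: "A \<lesssim> (UNIV :: real set)"
proof -
  define h where "h x = (\<lambda>n. to_nat_on (pr n ` A) (pr n x))" for x
  have "inj_on h A"
  proof
    fix x y assume xy: "x \<in> A" "y \<in> A" "h x = h y"
    have "pr n x = pr n y" for n
    proof -
      have "to_nat_on (pr n ` A) (pr n x) = to_nat_on (pr n ` A) (pr n y)"
        using xy(3) by (auto simp: h_def fun_eq_iff)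
      then show ?thesis
        using xy finite_pr by (auto simp: countable_finite)
    qed
    then show "x = y" using xy below antisym pr_le by metis
  qed
  moreover have "inj (\<lambda>f::nat\<Rightarrow>nat. {prod_encode (n, f n) | n. True})"
  proof (rule injI)
    fix f g :: "nat \<Rightarrow> nat"
    assume fg: "{prod_encode (n, f n) | n. True} = {prod_encode (n, g n) | n. True}"
    have "f n = g n" for n
    proof -
      have "prod_encode (n, f n) \<in> {prod_encode (n, g n) | n. True}" using fg by blast
      then show ?thesis by (auto simp: prod_encode_eq)
    qed
    then show "f = g" by auto
  qed
  ultimately have "inj_on ((\<lambda>f::nat\<Rightarrow>nat. {prod_encode (n, f n) | n. True}) \<circ> h) A"
    by (intro comp_inj_on) (auto intro: inj_on_subset)
  then have "A \<lesssim> (UNIV :: nat set set)" by (auto simp: lepoll_def)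
  then show ?thesis using nat_sets_eqpoll_reals eqpoll_imp_lepoll lepoll_trans by blast
qed

end

section \<open>Function spaces of domains with finite projections\<close>

locale two_pdoms = A: pdom A leA prA + B: pdom B leB prB
  for A :: "'a set" and leA prA and B :: "'b set" and leB prB
begin

lemma continuous_map_scott_iff:
  "continuous_map (scott leA A) (scott leB B) f \<longleftrightarrow>
    f \<in> A \<rightarrow> B \<and> (\<forall>x\<in>A. \<forall>y\<in>A. leA x y \<longrightarrow> leB (f x) (f y)) \<and>
    (\<forall>x\<in>A. \<forall>n. \<exists>m. leB (prB n (f x)) (f (prA m x)))"
  (is "?L \<longleftrightarrow> ?R")
proof
  assume f: ?L
  then have fB: "f x \<in> B" if "x \<in> A" for x
    using that by (auto simp: continuous_map_def)
  have pre: "scott_open leA A {x\<in>A. f x \<in> U}" if "scott_open leB B U" for U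
    using f that by (auto simp: continuous_map_def openin_scott)
  \<comment> \<open>Upper sets of projected elements are Scott open, and their preimages turn
    topological continuity into the finitary condition.\<close>
  have up: "scott_open leB B {b\<in>B. leB (prB n c) b}" if "c \<in> B" for c n
    unfolding B.scott_open_iff
  proof (intro conjI ballI)
    fix b assume b: "b \<in> {b\<in>B. leB (prB n c) b}"
    then have "leB (prB n c) (prB n b)"
      using B.pr_mono[of "prB n c" b n] that B.pr_in B.pr_idem[of c n] by (metis mem_Collect_eq)
    then show "\<exists>na. \<forall>y\<in>B. leB (prB na b) y \<longrightarrow> y \<in> {b \<in> B. leB (prB n c) b}"
      using b that B.trans B.pr_in by blast
  qed auto
  have appr: "\<exists>m. leB (prB n (f x)) (f (prA m x))" if x: "x \<in> A" for x n
  proof -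
    have "x \<in> {x\<in>A. f x \<in> {b\<in>B. leB (prB n (f x)) b}}" 
      using fB x B.pr_le by auto
    with pre[OF up[OF fB[OF x]]] obtain m where
      m: "\<forall>y\<in>A. leA (prA m x) y \<longrightarrow> y \<in> {x'\<in>A. f x' \<in> {b\<in>B. leB (prB n (f x)) b}}"
      unfolding A.scott_open_iff using fB x B.pr_le by blast
    then show ?thesis using A.pr_in A.refl x by blast
  qed
  have mono: "leB (f x) (f y)" if "x \<in> A" "y \<in> A" "leA x y" for x y
  proof (rule B.below)
    fix n
    have "y \<in> {x'\<in>A. f x' \<in> {b\<in>B. leB (prB n (f x)) b}}"
      using pre[OF up[OF fB[OF that(1)]]] that fB B.pr_le unfolding scott_open_def by blast
    then show "leB (prB n (f x)) (f y)" by auto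
  qed (use that fB in auto)
  show ?R using fB mono appr by auto
next
  assume f: ?R
  then have fB: "f x \<in> B" if "x \<in> A" for x using that by auto
  have "scott_open leA A {x\<in>A. f x \<in> U}" if U: "scott_open leB B U" for U
    unfolding A.scott_open_iff
  proof (intro conjI ballI)
    fix x assume x: "x \<in> {x\<in>A. f x \<in> U}"
    then obtain n where n: "\<forall>y\<in>B. leB (prB n (f x)) y \<longrightarrow> y \<in> U"
      using U unfolding B.scott_open_iff by blast
    obtain m where m: "leB (prB n (f x)) (f (prA m x))" using f x by blast
    have "f y \<in> U" if y: "y \<in> A" "leA (prA m x) y" for y
    proof -
      have "leB (f (prA m x)) (f y)" using f y x A.pr_in by blast
      with m have "leB (prB n (f x)) (f y)"
        by (rule B.trans[rotated 3]) (use x y A.pr_in B.pr_in fB in auto)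
      then show ?thesis using n y fB by blast
    qed
    then show "\<exists>n. \<forall>y\<in>A. leA (prA n x) y \<longrightarrow> y \<in> {x \<in> A. f x \<in> U}" by blast
  qed auto
  then show ?L using fB by (auto simp: continuous_map_def openin_scott)
qed

end

lemma lam_cong: "(\<And>x. x \<in> A \<Longrightarrow> f x = g x) \<Longrightarrow> lam A f = lam A g"
  unfolding lam_def by (rule arg_cong[of _ _ of_graph]) auto

lemma pointwise_lam:
  assumes "A \<noteq> {}" "A \<lesssim> (UNIV :: real set)"
  shows "pointwise le (lam A f) (lam A g) \<longleftrightarrow> (\<forall>x\<in>A. le (f x) (g x))"
proof -
  obtain d e where de: "lam A f = Enum d" "lam A g = Enum e"
    by (auto simp: lam_def of_graph_def)
  have "fst ` graph (lam A f) = A" using graph_lam[OF assms] by force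
  then have "pointwise le (lam A f) (lam A g) \<longleftrightarrow>
      (\<forall>x\<in>A. le (app (lam A f) x) (app (lam A g) x))"
    using de by simp
  then show ?thesis using app_lam[OF assms(2)] by auto
qed

text \<open>\<open>R\<close> and \<open>sim\<close> carry the smoothness condition. With
  \<open>sim\<close> constantly true this is the full space of continuous functions, so all three
  hierarchies share one theory.\<close>

definition fspace :: "'b fnl set \<Rightarrow> ('b fnl \<Rightarrow> 'b fnl \<Rightarrow> bool) \<Rightarrow> ('b fnl \<Rightarrow> 'b fnl \<Rightarrow> bool)
    \<Rightarrow> 'b set \<Rightarrow> ('b \<Rightarrow> 'b \<Rightarrow> bool) \<Rightarrow> ('b \<Rightarrow> 'b \<Rightarrow> bool) \<Rightarrow> 'b fnl set" where
  "fspace A leA R B leB sim = {lam A f | f. continuous_map (scott leA A) (scott leB B) f \<and>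
      (\<forall>x\<in>A. \<forall>y\<in>A. R x y \<longrightarrow> sim (f x) (f y))}"

definition fproj :: "'b fnl set \<Rightarrow> (nat \<Rightarrow> 'b fnl \<Rightarrow> 'b fnl) \<Rightarrow> (nat \<Rightarrow> 'b \<Rightarrow> 'b) \<Rightarrow> nat \<Rightarrow> 'b fnl \<Rightarrow> 'b fnl" where
  "fproj A prA prB n F = lam A (\<lambda>x. prB n (app F (prA n x)))"

text \<open>\<open>sim_down\<close> and \<open>R_pr\<close> make the projections of a smooth
  function smooth again, \<open>sim_lim\<close> does the same for suprema, and \<open>sim_ex\<close>
  provides a constant member.\<close>

locale function_space = two_pdoms A leA prA B leB prB
  for A :: "'b fnl set" and leA prA and B :: "'b set" and leB prB +
  fixes R :: "'b fnl \<Rightarrow> 'b fnl \<Rightarrow> bool" and sim :: "'b \<Rightarrow> 'b \<Rightarrow> bool"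
  assumes sim_down: "sim x y \<Longrightarrow> x \<in> B \<Longrightarrow> y \<in> B \<Longrightarrow> x' \<in> B \<Longrightarrow> y' \<in> B
      \<Longrightarrow> leB x' x \<Longrightarrow> leB y' y \<Longrightarrow> sim x' y'"
    and sim_lim: "x \<in> B \<Longrightarrow> y \<in> B \<Longrightarrow> (\<And>n. sim (prB n x) (prB n y)) \<Longrightarrow> sim x y"
    and sim_ex: "\<exists>b\<in>B. sim b b"
    and R_pr: "a \<in> A \<Longrightarrow> a' \<in> A \<Longrightarrow> R a a' \<Longrightarrow> R (prA n a) (prA n a')"
begin

definition good :: "('b fnl \<Rightarrow> 'b) \<Rightarrow> bool" where
  "good f \<longleftrightarrow> (\<forall>x\<in>A. f x \<in> B) \<and> (\<forall>x\<in>A. \<forall>y\<in>A. leA x y \<longrightarrow> leB (f x) (f y)) \<and>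
    (\<forall>x\<in>A. \<forall>n. \<exists>m. leB (prB n (f x)) (f (prA m x))) \<and>
    (\<forall>x\<in>A. \<forall>y\<in>A. R x y \<longrightarrow> sim (f x) (f y))"

abbreviation "FS \<equiv> fspace A leA R B leB sim"
abbreviation "P \<equiv> fproj A prA prB"
abbreviation "leF \<equiv> pointwise leB"

lemma FS_eq: "FS = {lam A f | f. good f}"
  unfolding fspace_def good_def continuous_map_scott_iff by (auto simp: Pi_iff)

lemma app_lam_A [simp]: "x \<in> A \<Longrightarrow> app (lam A f) x = f x"
  by (rule app_lam[OF A.lepoll_reals])

lemma leF_lam: "leF (lam A f) (lam A g) \<longleftrightarrow> (\<forall>x\<in>A. leB (f x) (g x))"
  by (rule pointwise_lam[OF A.nonempty A.lepoll_reals])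

lemma good_cong: "good f \<Longrightarrow> (\<And>x. x \<in> A \<Longrightarrow> g x = f x) \<Longrightarrow> good g"
  unfolding good_def by (simp add: A.pr_in)

lemma FS_lam: "F \<in> FS \<Longrightarrow> lam A (app F) = F"
  unfolding FS_eq by (auto intro!: lam_cong)

lemma FS_good: "F \<in> FS \<Longrightarrow> good (app F)"
  unfolding FS_eq by (auto elim!: good_cong)

lemma lam_FS: "good f \<Longrightarrow> lam A f \<in> FS"
  unfolding FS_eq by auto

lemma leF_iff: "F \<in> FS \<Longrightarrow> G \<in> FS \<Longrightarrow> leF F G \<longleftrightarrow> (\<forall>x\<in>A. leB (app F x) (app G x))"
  using leF_lam[of "app F" "app G"] FS_lam by auto

lemma FS_eqI: "F \<in> FS \<Longrightarrow> G \<in> FS \<Longrightarrow> (\<And>x. x \<in> A \<Longrightarrow> app F x = app G x) \<Longrightarrow> F = G"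
  using FS_lam lam_cong by metis

lemma app_in: "F \<in> FS \<Longrightarrow> x \<in> A \<Longrightarrow> app F x \<in> B"
  using FS_good good_def by auto

lemma app_mono: "F \<in> FS \<Longrightarrow> x \<in> A \<Longrightarrow> y \<in> A \<Longrightarrow> leA x y \<Longrightarrow> leB (app F x) (app F y)"
  using FS_good good_def by auto

lemma app_approx: "F \<in> FS \<Longrightarrow> x \<in> A \<Longrightarrow> \<exists>m. leB (prB n (app F x)) (app F (prA m x))"
  using FS_good good_def by auto

lemma app_approx_le:
  assumes "F \<in> FS" "x \<in> A"
  shows "\<exists>m\<ge>n. leB (prB n (app F x)) (app F (prA m x))"
proof -
  obtain m where m: "leB (prB n (app F x)) (app F (prA m x))" using app_approx assms by blast
  have "leB (app F (prA m x)) (app F (prA (max m n) x))"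
    using app_mono assms A.pr_in A.pr_incr by simp
  then show ?thesis using m assms A.pr_in B.pr_in app_in B.trans
    by (metis max.cobounded2)
qed

lemma good_proj:
  assumes "F \<in> FS" shows "good (\<lambda>x. prB n (app F (prA n x)))"
  unfolding good_def
proof (intro conjI ballI allI impI)
  show "prB n (app F (prA n x)) \<in> B" if "x \<in> A" for x
    using assms app_in A.pr_in B.pr_in that by auto
  show "leB (prB n (app F (prA n x))) (prB n (app F (prA n y)))"
    if "x \<in> A" "y \<in> A" "leA x y" for x y
    using assms app_in A.pr_in B.pr_in that app_mono A.pr_mono B.pr_mono by auto
  show "\<exists>m. leB (prB na (prB n (app F (prA n x)))) (prB n (app F (prA n (prA m x))))"
    if "x \<in> A" for x na
    using that assms app_in A.pr_in B.pr_in A.pr_idem B.pr_le by metis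
  show "sim (prB n (app F (prA n x))) (prB n (app F (prA n y)))"
    if "x \<in> A" "y \<in> A" "R x y" for x y
  proof -
    have "R (prA n x) (prA n y)" using that R_pr by auto
    then have "sim (app F (prA n x)) (app F (prA n y))"
      using FS_good[OF assms] that A.pr_in unfolding good_def by blast
    then show ?thesis
      by (rule sim_down) (use assms app_in A.pr_in B.pr_in B.pr_le that in auto)
  qed
qed

lemma app_P: "x \<in> A \<Longrightarrow> app (P n F) x = prB n (app F (prA n x))"
  by (simp add: fproj_def)

lemma P_in: "F \<in> FS \<Longrightarrow> P n F \<in> FS"
  using lam_FS[OF good_proj] by (auto simp: fproj_def)

lemma directed_app:
  assumes D: "directed_in leF FS D" and x: "x \<in> A"
  shows "directed_in leB B ((\<lambda>F. app F x) ` D)"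
  unfolding directed_in_def
proof (intro conjI ballI)
  show "(\<lambda>F. app F x) ` D \<subseteq> B" "(\<lambda>F. app F x) ` D \<noteq> {}"
    using D x app_in by (auto simp: directed_in_def)
  fix a b assume "a \<in> (\<lambda>F. app F x) ` D" "b \<in> (\<lambda>F. app F x) ` D"
  then obtain F G where "F \<in> D" "G \<in> D" "a = app F x" "b = app G x" by auto
  moreover then obtain K where "K \<in> D" "leF F K" "leF G K"
    using D unfolding directed_in_def by blast
  moreover have "D \<subseteq> FS" using D by (auto simp: directed_in_def)
  ultimately show "\<exists>z\<in>(\<lambda>F. app F x) ` D. leB a z \<and> leB b z"
    using leF_iff x by blast
qed

text \<open>Suprema of directed sets are computed pointwise; this needs that \<open>sim\<close> is closed under
  limits of projections, since a supremum of smooth functions must be smooth.\<close>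

lemma pointwise_lub:
  assumes D: "directed_in leF FS D"
  obtains u where "lam A u \<in> FS" "lub_in leF FS D (lam A u)"
    "\<And>x. x \<in> A \<Longrightarrow> lub_in leB B ((\<lambda>F. app F x) ` D) (u x)"
proof -
  define u where "u x = (SOME s. lub_in leB B ((\<lambda>F. app F x) ` D) s)" for x
  have lub: "lub_in leB B ((\<lambda>F. app F x) ` D) (u x)" if "x \<in> A" for x
    unfolding u_def using B.complete[OF directed_app[OF D that]] by (rule someI_ex)
  have DFS: "D \<subseteq> FS" using D by (auto simp: directed_in_def)
  have uB: "u x \<in> B" if "x \<in> A" for x using lub[OF that] by (auto simp: lub_in_def)
  have ub: "leB (app F x) (u x)" if "x \<in> A" "F \<in> D" for x F
    using lub[OF that(1)] that by (auto simp: lub_in_def)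
  have least: "leB (u x) b" if "x \<in> A" "b \<in> B" "\<And>F. F \<in> D \<Longrightarrow> leB (app F x) b" for x b
    using lub[OF that(1)] that by (auto simp: lub_in_def)
  have attain: "\<exists>F\<in>D. leB (prB n (u x)) (app F x)" if "x \<in> A" for x n
    using B.compact_pr[OF directed_app[OF D that] lub[OF that]] by auto
  have umono: "leB (u x) (u y)" if "x \<in> A" "y \<in> A" "leA x y" for x y
  proof (rule least)
    fix F assume F: "F \<in> D"
    then have "leB (app F x) (app F y)" using app_mono that DFS by blast
    then show "leB (app F x) (u y)"
      by (rule B.trans[rotated 3]) (use ub F that app_in DFS uB in auto)
  qed (use that uB in auto)
  have "good u"
    unfolding good_def
  proof (intro conjI ballI allI impI)
    show "u x \<in> B" if "x \<in> A" for x using uB that .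
    show "leB (u x) (u y)" if "x \<in> A" "y \<in> A" "leA x y" for x y using umono that .
    show "\<exists>m. leB (prB n (u x)) (u (prA m x))" if x: "x \<in> A" for x n
    proof -
      obtain F where F: "F \<in> D" "leB (prB n (u x)) (app F x)" using attain x by blast
      then have FF: "F \<in> FS" using DFS by auto
      have "leB (prB n (u x)) (prB n (app F x))"
        using B.pr_mono[of "prB n (u x)" "app F x" n] F FF x uB B.pr_in app_in B.pr_idem by metis
      moreover obtain m where "leB (prB n (app F x)) (app F (prA m x))"
        using app_approx FF x by blast
      moreover have "leB (app F (prA m x)) (u (prA m x))" using ub A.pr_in x F by auto
      ultimately have "leB (prB n (u x)) (u (prA m x))"
        using B.trans uB app_in FF x A.pr_in B.pr_in by meson
      then show ?thesis ..
    qed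
    show "sim (u x) (u y)" if xy: "x \<in> A" "y \<in> A" "R x y" for x y
    proof (rule sim_lim)
      fix n
      obtain F where F: "F \<in> D" "leB (prB n (u x)) (app F x)" using attain xy by blast
      obtain G where G: "G \<in> D" "leB (prB n (u y)) (app G y)" using attain xy by blast
      obtain K where K: "K \<in> D" "leF F K" "leF G K"
        using D F G unfolding directed_in_def by blast
      have FGK: "F \<in> FS" "G \<in> FS" "K \<in> FS" using F G K DFS by auto
      have "leB (prB n (u x)) (app K x)" "leB (prB n (u y)) (app K y)"
        using F G K FGK leF_iff xy app_in uB B.pr_in B.trans by meson+
      moreover have "sim (app K x) (app K y)"
        using FS_good[OF FGK(3)] xy unfolding good_def by blast
      ultimately show "sim (prB n (u x)) (prB n (u y))"
        using sim_down[of "app K x" "app K y"] FGK xy app_in uB B.pr_in by blast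
    qed (use xy uB in auto)
  qed
  then have uFS: "lam A u \<in> FS" by (rule lam_FS)
  have "lub_in leF FS D (lam A u)"
    unfolding lub_in_def
  proof (intro conjI ballI impI)
    show "lam A u \<in> FS" by fact
    show "leF F (lam A u)" if "F \<in> D" for F
      using leF_iff[of F "lam A u"] that DFS uFS ub by auto
    show "leF (lam A u) G" if "G \<in> FS" "\<forall>F\<in>D. leF F G" for G
      using leF_iff[of "lam A u" G] leF_iff[of _ G] that DFS uFS least app_in
      by (metis app_lam_A subsetD)
  qed
  then show thesis using that uFS lub by blast
qed

lemma pdom_FS: "pdom FS leF P"
proof
  obtain b where b: "b \<in> B" "sim b b" using sim_ex by auto
  then have "good (\<lambda>_. b)" unfolding good_def using B.refl B.pr_le by auto
  then show "FS \<noteq> {}" using lam_FS by blast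
  show "leF F F" if "F \<in> FS" for F using that leF_iff B.refl app_in by auto
  show "F = G" if "F \<in> FS" "G \<in> FS" "leF F G" "leF G F" for F G
    using that leF_iff B.antisym app_in by (metis FS_eqI)
  show "leF F K" if "F \<in> FS" "G \<in> FS" "K \<in> FS" "leF F G" "leF G K" for F G K
    using that leF_iff B.trans app_in by meson
  show Pin: "P n F \<in> FS" if "F \<in> FS" for F n using P_in that .
  show "leF (P n F) (P n G)" if "F \<in> FS" "G \<in> FS" "leF F G" for F G n
    using that Pin by (auto simp: leF_iff app_P A.pr_in app_in intro!: B.pr_mono)
  show "leF (P n F) F" if "F \<in> FS" for F n
    unfolding leF_iff[OF Pin[OF that] that]
  proof
    fix x assume x: "x \<in> A"
    have "leB (prB n (app F (prA n x))) (app F (prA n x))" "leB (app F (prA n x)) (app F x)"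
      using that x A.pr_in app_in B.pr_le app_mono A.pr_le by auto
    then show "leB (app (P n F) x) (app F x)"
      using that x A.pr_in app_in B.pr_in B.trans app_P by metis
  qed
  show "P n (P n F) = P n F" if "F \<in> FS" for F n
    by (rule FS_eqI) (use that Pin in \<open>auto simp: app_P A.pr_in A.pr_idem B.pr_idem app_in\<close>)
  show "leF (P m F) (P n F)" if "F \<in> FS" "m \<le> n" for F m n
    unfolding leF_iff[OF Pin[OF that(1)] Pin[OF that(1)]]
  proof
    fix x assume x: "x \<in> A"
    have "leB (prB m (app F (prA m x))) (prB n (app F (prA m x)))"
      "leB (prB n (app F (prA m x))) (prB n (app F (prA n x)))"
      using that x A.pr_in A.pr_incr app_mono app_in B.pr_incr B.pr_mono by auto
    then show "leB (app (P m F) x) (app (P n F) x)"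
      using that x A.pr_in app_in B.pr_in B.trans app_P by metis
  qed
  show "finite (P n ` FS)" for n
  proof -
    \<comment> \<open>A projection is determined by a finite table: its values lie in a finite set
      and depend only on the finitely many arguments \<open>prA n x\<close>.\<close>
    let ?r = "\<lambda>F. restrict (\<lambda>x. prB n (app F x)) (prA n ` A)"
    have "?r ` FS \<subseteq> PiE (prA n ` A) (\<lambda>_. prB n ` B)"
      using app_in A.pr_in by (auto simp: PiE_iff)
    moreover have "finite (PiE (prA n ` A) (\<lambda>_. prB n ` B))"
      using A.finite_pr B.finite_pr by (intro finite_PiE) auto
    ultimately have "finite (?r ` FS)" by (rule finite_subset)
    moreover have "P n ` FS \<subseteq> (\<lambda>r. lam A (\<lambda>x. r (prA n x))) ` (?r ` FS)"
    proof
      fix G assume "G \<in> P n ` FS"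
      then obtain F where F: "F \<in> FS" "G = P n F" by auto
      have "G = lam A (\<lambda>x. ?r F (prA n x))"
        unfolding F fproj_def by (rule lam_cong) auto
      then show "G \<in> (\<lambda>r. lam A (\<lambda>x. r (prA n x))) ` (?r ` FS)" using F by blast
    qed
    ultimately show ?thesis using finite_surj by blast
  qed
  show "leF F G" if F: "F \<in> FS" "G \<in> FS" "\<And>n. leF (P n F) G" for F G
    unfolding leF_iff[OF F(1,2)]
  proof
    fix x assume x: "x \<in> A"
    show "leB (app F x) (app G x)"
    proof (rule B.below)
      fix n
      obtain m where m: "m \<ge> n" "leB (prB n (app F x)) (app F (prA m x))"
        using app_approx_le F x by blast
      have "leB (prB n (app F x)) (prB m (prB n (app F x)))"
        using B.pr_pr m app_in F x by auto
      moreover have "leB (prB m (prB n (app F x))) (prB m (app F (prA m x)))"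
        using m app_in F x A.pr_in B.pr_in B.pr_mono by auto
      moreover have "leB (prB m (app F (prA m x))) (app G x)"
        using F(3)[of m] leF_iff[OF Pin[OF F(1)] F(2)] x app_P by metis
      ultimately show "leB (prB n (app F x)) (app G x)"
        using app_in F x A.pr_in B.pr_in B.trans by meson
    qed (use x F app_in in auto)
  qed
  show "\<exists>s. lub_in leF FS D s" if "directed_in leF FS D" for D
    using pointwise_lub[OF that] by metis
  show "\<exists>d\<in>D. leF (P n s) d" if D: "directed_in leF FS D" and s: "lub_in leF FS D s" for D s n
  proof -
    obtain u where u: "lam A u \<in> FS" "lub_in leF FS D (lam A u)"
      "\<And>x. x \<in> A \<Longrightarrow> lub_in leB B ((\<lambda>F. app F x) ` D) (u x)"
      using pointwise_lub[OF D] by blast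
    have DFS: "D \<subseteq> FS" "D \<noteq> {}" using D by (auto simp: directed_in_def)
    have sFS: "s \<in> FS" using s by (auto simp: lub_in_def)
    have "leF s (lam A u)" "leF (lam A u) s" using s u unfolding lub_in_def by auto
    then have su: "s = lam A u"
      using leF_iff sFS u(1) B.antisym app_in by (metis FS_eqI)
    have att: "\<exists>F\<in>D. leB (prB n (app s c)) (app F c)" if "c \<in> A" for c
      using B.compact_pr[OF directed_app[OF D that] u(3)[OF that]] su that by auto
    \<comment> \<open>At a single argument some member of D reaches the required value by
      compactness in B. Directedness merges finitely many such members, and \<open>P n s\<close>
      depends on finitely many arguments only.\<close>
    have "\<exists>F\<in>D. \<forall>c\<in>C. leB (prB n (app s c)) (app F c)" if "finite C" "C \<subseteq> A" for C
      using that
    proof (induction C rule: finite_induct)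
      case empty then show ?case using DFS by auto
    next
      case (insert c C)
      then obtain F where F: "F \<in> D" "\<forall>c\<in>C. leB (prB n (app s c)) (app F c)" by auto
      obtain G where G: "G \<in> D" "leB (prB n (app s c)) (app G c)" using att insert by blast
      obtain K where K: "K \<in> D" "leF F K" "leF G K"
        using D F G unfolding directed_in_def by blast
      have FGK: "F \<in> FS" "G \<in> FS" "K \<in> FS" using F G K DFS by auto
      have "leB (prB n (app s x)) (app K x)" if "x \<in> insert c C" for x
      proof -
        have x: "x \<in> A" using that insert by auto
        have "leB (prB n (app s x)) (app F x) \<or> leB (prB n (app s x)) (app G x)"
          using that F G by auto
        moreover have "leB (app F x) (app K x)" "leB (app G x) (app K x)"
          using K FGK leF_iff x by auto
        ultimately show ?thesis
          using B.trans app_in FGK x sFS B.pr_in by meson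
      qed
      then show ?case using K by blast
    qed
    then obtain F where F: "F \<in> D" "\<forall>c\<in>prA n ` A. leB (prB n (app s c)) (app F c)"
      using A.finite_pr[of n] A.pr_in by (metis image_subsetI)
    have FF: "F \<in> FS" using F DFS by auto
    have "leF (P n s) F"
      unfolding leF_iff[OF Pin[OF sFS] FF]
    proof
      fix x assume x: "x \<in> A"
      have "leB (prB n (app s (prA n x))) (app F (prA n x))" "leB (app F (prA n x)) (app F x)"
        using F x FF app_mono A.pr_in A.pr_le by auto
      then show "leB (app (P n s) x) (app F x)"
        using x FF sFS A.pr_in app_in B.pr_in B.trans app_P by metis
    qed
    then show ?thesis using F by blast
  qed
qed

end

section \<open>Hierarchies of domains\<close>

primrec proj :: "(nat \<Rightarrow> 'b \<Rightarrow> 'b) \<Rightarrow> (nat \<Rightarrow> 'b fnl set) \<Rightarrow> nat \<Rightarrow> nat \<Rightarrow> 'b fnl \<Rightarrow> 'b fnl" where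
  "proj pr X 0 = (\<lambda>n x. Base (pr n (base x)))"
| "proj pr X (Suc k) = fproj (X k) (proj pr X k) pr"

text \<open>A form of \<open>S_sims\<close> outside the mutual recursion with the domains, so that
  it can be used in the generic locale; see \<open>S_sims_eq\<close>.\<close>

primrec simh :: "('b \<Rightarrow> 'b \<Rightarrow> bool) \<Rightarrow> (nat \<Rightarrow> 'b fnl set) \<Rightarrow> nat \<Rightarrow> 'b fnl \<Rightarrow> 'b fnl \<Rightarrow> bool" where
  "simh sim X 0 = (\<lambda>x y. sim (base x) (base y))"
| "simh sim X (Suc k) =
    (\<lambda>f g. \<forall>x\<in>X k. \<forall>y\<in>X k. simh sim X k x y \<longrightarrow> sim (app f x) (app g y))"

lemma per_sym: "symp eq \<Longrightarrow> per eq X k x y \<Longrightarrow> per eq X k y x"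
proof (induction k arbitrary: x y)
  case 0 then show ?case by (auto dest: sympD)
next
  case (Suc k)
  have "eq (app y a) (app x b)" if "per eq X k a b" for a b
    using Suc.IH[OF Suc.prems(1) that] Suc.prems by (auto dest: sympD)
  then show ?case using Suc.prems by auto
qed

lemma per_trans:
  assumes "symp eq" "transp eq"
  shows "per eq X k x y \<Longrightarrow> per eq X k y z \<Longrightarrow> per eq X k x z"
proof (induction k arbitrary: x y z)
  case 0 then show ?case using assms by (auto dest: transpD)
next
  case (Suc k)
  have "eq (app x a) (app z b)" if "per eq X k a b" for a b
  proof -
    have "per eq X k a a" using Suc.IH that per_sym[OF assms(1)] by blast
    then have "eq (app x a) (app y a)" "eq (app y a) (app z b)" using Suc.prems that by auto
    then show ?thesis using assms(2) by (auto dest: transpD)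
  qed
  then show ?case using Suc.prems by auto
qed

lemma per_in: "per eq X k x y \<Longrightarrow> x \<in> X k \<and> y \<in> X k"
  by (cases k) auto

lemma per_total:
  assumes "symp eq" "transp eq" "per eq X k x y"
  shows "x \<in> total eq X k" "y \<in> total eq X k"
  using per_trans[OF assms(1,2)] per_sym[OF assms(1)] per_in assms(3)
  unfolding total_def by blast+

lemma total_app: "F \<in> total eq X (Suc k) \<Longrightarrow> y \<in> total eq X k \<Longrightarrow> eq (app F y) (app F y)"
  by (auto simp: total_def)

lemma dom_hier_Suc:
  "dom_hier B le (Suc k) = fspace (dom_hier B le k) (pointwise le) R B le (\<lambda>_ _. True)"
  by (simp add: fspace_def)

locale hier = B: pdom B le pr
  for B :: "'b set" and le and pr +
  fixes sim :: "'b \<Rightarrow> 'b \<Rightarrow> bool" and X :: "nat \<Rightarrow> 'b fnl set"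
  assumes sim_down: "sim x y \<Longrightarrow> x \<in> B \<Longrightarrow> y \<in> B \<Longrightarrow> x' \<in> B \<Longrightarrow> y' \<in> B
      \<Longrightarrow> le x' x \<Longrightarrow> le y' y \<Longrightarrow> sim x' y'"
    and sim_lim: "x \<in> B \<Longrightarrow> y \<in> B \<Longrightarrow> (\<And>n. sim (pr n x) (pr n y)) \<Longrightarrow> sim x y"
    and sim_ex: "\<exists>b\<in>B. sim b b"
    and X_0: "X 0 = Base ` B"
    and X_Suc: "X (Suc k) = fspace (X k) (pointwise le) (simh sim X k) B le sim"
begin

abbreviation leX :: "'b fnl \<Rightarrow> 'b fnl \<Rightarrow> bool" where "leX \<equiv> pointwise le"
abbreviation \<pi> where "\<pi> \<equiv> proj pr X"

lemma pdom_X0: "pdom (X 0) leX (\<pi> 0)"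
proof -
  have dir: "directed_in leX (X 0) (Base ` E) \<longleftrightarrow> directed_in le B E" for E
    by (auto simp: directed_in_def X_0)
  have lub: "lub_in leX (X 0) (Base ` E) (Base s) \<longleftrightarrow> lub_in le B E s" for E s
    by (auto simp: lub_in_def X_0)
  have D: "\<exists>E. D = Base ` E" if "directed_in leX (X 0) D" for D
    using that unfolding directed_in_def X_0 by (meson subset_imageE)
  show ?thesis
  proof
    show "X 0 \<noteq> {}" using B.nonempty by (auto simp: X_0)
    show "finite (\<pi> 0 n ` X 0)" for n
      using finite_imageI[OF B.finite_pr[of n], of Base] by (simp add: X_0 image_image)
    show "\<exists>d\<in>D. leX (\<pi> 0 n s) d"
      if ds: "directed_in leX (X 0) D" "lub_in leX (X 0) D s" for D s n
    proof -
      obtain E where E: "D = Base ` E" using D ds(1) by blast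
      obtain b where b: "s = Base b" using ds by (auto simp: lub_in_def X_0)
      show ?thesis
        using B.compact_pr[of E b n] ds dir lub unfolding E b by auto
    qed
    show "\<exists>s. lub_in leX (X 0) D s" if ds: "directed_in leX (X 0) D" for D
    proof -
      obtain E where E: "D = Base ` E" using D ds by blast
      then obtain s where "lub_in le B E s" using B.complete dir ds by blast
      then show ?thesis using lub E by blast
    qed
    show "leX x u" if x: "x \<in> X 0" "u \<in> X 0" "\<And>n. leX (\<pi> 0 n x) u" for x u
    proof -
      obtain b c where bc: "x = Base b" "u = Base c" "b \<in> B" "c \<in> B" using x by (auto simp: X_0)
      have "le (pr n b) c" for n using x(3)[of n] bc by simp
      then show ?thesis using B.below bc by simp
    qed
  qed (auto simp: X_0 B.refl B.pr_in B.pr_le B.pr_incr B.pr_idem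
      intro: B.antisym B.trans B.pr_mono)
qed

text \<open>The two claims go through the induction together: the function space at the next level
  has finite projections only if those of the present level preserve similarity.\<close>

lemma levels: "pdom (X k) leX (\<pi> k) \<and>
  (\<forall>x\<in>X k. \<forall>y\<in>X k. simh sim X k x y \<longrightarrow> (\<forall>n. simh sim X k (\<pi> k n x) (\<pi> k n y)))"
proof (induction k)
  case 0
  have "simh sim X 0 (\<pi> 0 n x) (\<pi> 0 n y)" if "x \<in> X 0" "y \<in> X 0" "simh sim X 0 x y" for x y n
    using that by (auto simp: X_0 B.pr_in B.pr_le elim!: sim_down)
  then show ?case using pdom_X0 by blast
next
  case (Suc k)
  then interpret P: pdom "X k" leX "\<pi> k" by blast
  interpret F: function_space "X k" leX "\<pi> k" B le pr "simh sim X k" sim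
    by unfold_locales (use Suc sim_down sim_lim sim_ex in blast)+
  have "simh sim X (Suc k) (\<pi> (Suc k) n f) (\<pi> (Suc k) n g)"
    if fg: "f \<in> X (Suc k)" "g \<in> X (Suc k)" "simh sim X (Suc k) f g" for f g n
  proof -
    have "sim (app (F.P n f) x) (app (F.P n g) y)"
      if xy: "x \<in> X k" "y \<in> X k" "simh sim X k x y" for x y
    proof -
      have "sim (app f (\<pi> k n x)) (app g (\<pi> k n y))"
        using Suc xy fg P.pr_in by auto
      then show ?thesis
        unfolding F.app_P[OF xy(1)] F.app_P[OF xy(2)]
        by (rule sim_down) (use xy fg P.pr_in in \<open>auto simp: X_Suc F.app_in B.pr_in B.pr_le\<close>)
    qed
    then show ?thesis by simp
  qed
  then show ?case using F.pdom_FS by (simp add: X_Suc)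
qed

sublocale L: pdom "X k" leX "\<pi> k" for k
  using levels by blast

sublocale F: function_space "X k" leX "\<pi> k" B le pr "simh sim X k" sim for k
  by unfold_locales (use levels sim_down sim_lim sim_ex in blast)+

lemma proj_app: "x \<in> X k \<Longrightarrow> app (\<pi> (Suc k) n f) x = pr n (app f (\<pi> k n x))"
  by (simp add: F.app_P)

lemma app_in: "f \<in> X (Suc k) \<Longrightarrow> x \<in> X k \<Longrightarrow> app f x \<in> B"
  by (simp add: X_Suc F.app_in)

lemma app_mono: "f \<in> X (Suc k) \<Longrightarrow> x \<in> X k \<Longrightarrow> y \<in> X k \<Longrightarrow> leX x y \<Longrightarrow> le (app f x) (app f y)"
  unfolding X_Suc by (rule F.app_mono)

lemma app_approx: "f \<in> X (Suc k) \<Longrightarrow> x \<in> X k \<Longrightarrow> \<exists>m\<ge>n. le (pr n (app f x)) (app f (\<pi> k m x))"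
  unfolding X_Suc by (rule F.app_approx_le)

lemma app_sim: "f \<in> X (Suc k) \<Longrightarrow> x \<in> X k \<Longrightarrow> y \<in> X k \<Longrightarrow> simh sim X k x y \<Longrightarrow> sim (app f x) (app f y)"
  using F.FS_good unfolding X_Suc F.good_def by blast

lemma leX_iff: "f \<in> X (Suc k) \<Longrightarrow> g \<in> X (Suc k) \<Longrightarrow> leX f g \<longleftrightarrow> (\<forall>x\<in>X k. le (app f x) (app g x))"
  unfolding X_Suc by (rule F.leF_iff)

lemma lam_in_X:
  assumes "\<And>x. x \<in> X k \<Longrightarrow> f x \<in> B"
    and "\<And>x y. x \<in> X k \<Longrightarrow> y \<in> X k \<Longrightarrow> leX x y \<Longrightarrow> le (f x) (f y)"
    and "\<And>x n. x \<in> X k \<Longrightarrow> \<exists>m. le (pr n (f x)) (f (\<pi> k m x))"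
    and "\<And>x y. x \<in> X k \<Longrightarrow> y \<in> X k \<Longrightarrow> simh sim X k x y \<Longrightarrow> sim (f x) (f y)"
  shows "lam (X k) f \<in> X (Suc k)"
  unfolding X_Suc by (rule F.lam_FS) (use assms in \<open>auto simp: F.good_def\<close>)

lemma openin_total_space_iff:
  "openin (total_space le eq X k) V \<longleftrightarrow> V \<subseteq> total eq X k \<and>
     (\<forall>x\<in>V. \<exists>n. \<forall>y\<in>total eq X k. leX (\<pi> k n x) y \<longrightarrow> y \<in> V)"
  unfolding total_space_def by (rule L.openin_subtopology_scott_iff) (auto simp: total_def)

lemma topspace_total_space [simp]: "topspace (total_space le eq X k) = total eq X k"
  unfolding total_space_def by (auto simp: total_def)

definition conv :: "nat \<Rightarrow> (nat \<Rightarrow> 'b fnl) \<Rightarrow> 'b fnl \<Rightarrow> bool" where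
  "conv k xs x \<longleftrightarrow> (\<forall>n. \<forall>\<^sub>F i in sequentially. leX (\<pi> k n x) (xs i))"

text \<open>Joint continuity of application along sequences. One finite approximation of y suffices
  for the value up to \<open>pr n\<close>, and choosing m at least n ensures that the m-th
  projection of G still shows this much of the value.\<close>

lemma conv_app:
  assumes F: "\<And>i. F i \<in> X (Suc k)" "G \<in> X (Suc k)" "conv (Suc k) F G"
    and x: "\<And>i. x i \<in> X k" "y \<in> X k" "conv k x y"
  shows "\<forall>\<^sub>F i in sequentially. le (pr n (app G y)) (app (F i) (x i))"
proof -
  obtain m where m: "m \<ge> n" "le (pr n (app G y)) (app G (\<pi> k m y))"
    using app_approx F x by blast
  have "\<forall>\<^sub>F i in sequentially. leX (\<pi> (Suc k) m G) (F i)" "\<forall>\<^sub>F i in sequentially. leX (\<pi> k m y) (x i)"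
    using F x by (auto simp: conv_def)
  then show ?thesis
  proof eventually_elim
    case (elim i)
    let ?p = "\<pi> k m y"
    have p: "?p \<in> X k" using x L.pr_in by auto
    have "le (pr n (app G y)) (pr m (pr n (app G y)))"
      using B.pr_pr m app_in F x by auto
    moreover have "le (pr m (pr n (app G y))) (pr m (app G ?p))"
      using m app_in F x p B.pr_in B.pr_mono by auto
    moreover have "le (pr m (app G ?p)) (app (F i) ?p)"
    proof -
      have "le (app (\<pi> (Suc k) m G) ?p) (app (F i) ?p)"
        using elim leX_iff[OF L.pr_in[OF F(2)] F(1)] p by auto
      then show ?thesis using proj_app p L.pr_idem x by metis
    qed
    moreover have "le (app (F i) ?p) (app (F i) (x i))"
      by (rule app_mono) (use F x p elim in auto)
    ultimately show ?case
      using app_in F x p B.pr_in B.trans by meson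
  qed
qed

text \<open>This turns the failure of a neighbourhood property at x into a convergent sequence: pick
  one counterexample above each projection of x.\<close>

lemma conv_above:
  assumes "x \<in> X k" "\<And>n. ys n \<in> X k" "\<And>n. leX (\<pi> k n x) (ys n)"
  shows "conv k ys x"
proof -
  have "leX (\<pi> k n x) (ys m)" if "n \<le> m" for n m
    using L.trans[OF _ _ _ L.pr_incr[OF assms(1) that] assms(3)[of m]] L.pr_in assms by blast
  then show ?thesis unfolding conv_def eventually_sequentially by blast
qed

lemma conv_const: "x \<in> X k \<Longrightarrow> conv k (\<lambda>_. x) x"
  by (auto simp: conv_def L.pr_le)

end

section \<open>Limit spaces of functionals over the reals\<close>

text \<open>Continuous convergence, stated with a reindexing g that need not be monotone: the
  functional applied at stage i may be any member of a tail that moves to infinity. The lifting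
  arguments use this by choosing the worst member at each stage.\<close>

fun L :: "nat \<Rightarrow> real fnl set"
  and Lconv :: "nat \<Rightarrow> (nat \<Rightarrow> real fnl) \<Rightarrow> real fnl \<Rightarrow> bool" where
  "L 0 = range Base"
| "L (Suc k) = {lam (L k) f | f. \<forall>us u. Lconv k us u \<longrightarrow> (\<lambda>i. f (us i)) \<longlonglongrightarrow> f u}"
| "Lconv 0 us u \<longleftrightarrow> range us \<subseteq> range Base \<and> u \<in> range Base \<and> (\<lambda>i. base (us i)) \<longlonglongrightarrow> base u"
| "Lconv (Suc k) F G \<longleftrightarrow> range F \<subseteq> L (Suc k) \<and> G \<in> L (Suc k) \<and>
     (\<forall>us u g. Lconv k us u \<longrightarrow> filterlim g at_top sequentially \<longrightarrow>
        (\<lambda>i. app (F (g i)) (us i)) \<longlonglongrightarrow> app G u)"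

lemma Lconv_in: "Lconv k us u \<Longrightarrow> us i \<in> L k" "Lconv k us u \<Longrightarrow> u \<in> L k"
  by (cases k; auto simp del: L.simps(2))+ 

lemma filterlim_comp_conv:
  assumes "filterlim g at_top sequentially" "eventually P sequentially"
  shows "\<forall>\<^sub>F i in sequentially. P (g (i::nat))"
  using assms by (auto simp: filterlim_iff)

section \<open>Total objects and admissible representations\<close>

locale thier = hier B le pr sim X
  for B :: "'b set" and le pr sim X +
  fixes eq :: "'b \<Rightarrow> 'b \<Rightarrow> bool" and r :: "'b \<Rightarrow> real"
  assumes eq_iff: "eq a a' \<longleftrightarrow> eq a a \<and> eq a' a' \<and> r a = r a'"
    and r_cont: "a \<in> B \<Longrightarrow> eq a a \<Longrightarrow> (\<And>i. b i \<in> B) \<Longrightarrow> (\<And>i. eq (b i) (b i)) \<Longrightarrow>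
      (\<And>n. \<forall>\<^sub>F i in sequentially. le (pr n a) (b i)) \<Longrightarrow> (\<lambda>i::nat. r (b i)) \<longlonglongrightarrow> r a"
begin

abbreviation T where "T \<equiv> total eq X"
abbreviation \<rho> where "\<rho> \<equiv> rho r eq X"

lemma symp_eq: "symp eq" and transp_eq: "transp eq"
  using eq_iff by (metis sympI) (metis eq_iff transpI)

lemma T_in: "x \<in> T k \<Longrightarrow> x \<in> X k"
  by (auto simp: total_def)

lemma per_rho: "per eq X k x y \<Longrightarrow> \<rho> k x = \<rho> k y"
proof (cases k)
  case 0
  assume "per eq X k x y"
  then show ?thesis using 0 eq_iff[of "base x" "base y"] by auto
next
  case (Suc j)
  assume "per eq X k x y"
  then have "r (app x z) = r (app y z)" if "z \<in> T j" for z
    using Suc that eq_iff[of "app x z" "app y z"] by (auto simp: total_def)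
  then show ?thesis using Suc by (auto intro!: arg_cong[of _ _ of_graph])
qed

text \<open>Sequential admissibility of the representation \<open>\<rho> k\<close> of the limit space \<open>L k\<close>.\<close>

definition adm :: "nat \<Rightarrow> bool" where
  "adm k \<longleftrightarrow>
    (\<forall>xs x. (\<forall>i. xs i \<in> T k) \<longrightarrow> x \<in> T k \<longrightarrow> conv k xs x \<longrightarrow> Lconv k (\<lambda>i. \<rho> k (xs i)) (\<rho> k x)) \<and>
    (\<forall>us u. Lconv k us u \<longrightarrow> (\<exists>xs x. (\<forall>i. xs i \<in> T k \<and> \<rho> k (xs i) = us i) \<and>
        x \<in> T k \<and> \<rho> k x = u \<and> conv k xs x)) \<and>
    (\<forall>x\<in>T k. \<forall>y\<in>T k. \<rho> k x = \<rho> k y \<longrightarrow> per eq X k x y) \<and>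
    (\<forall>u\<in>L k. Lconv k (\<lambda>_. u) u)"

lemma admD:
  assumes "adm k"
  shows "(\<And>i. xs i \<in> T k) \<Longrightarrow> x \<in> T k \<Longrightarrow> conv k xs x \<Longrightarrow> Lconv k (\<lambda>i. \<rho> k (xs i)) (\<rho> k x)"
    and "Lconv k us u \<Longrightarrow> \<exists>xs x. (\<forall>i. xs i \<in> T k \<and> \<rho> k (xs i) = us i) \<and>
        x \<in> T k \<and> \<rho> k x = u \<and> conv k xs x"
    and "x \<in> T k \<Longrightarrow> y \<in> T k \<Longrightarrow> \<rho> k x = \<rho> k y \<Longrightarrow> per eq X k x y"
    and "u \<in> L k \<Longrightarrow> Lconv k (\<lambda>_. u) u"
  using assms unfolding adm_def by blast+

lemma adm_L: assumes "adm k" shows "L k = \<rho> k ` T k"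
proof
  show "L k \<subseteq> \<rho> k ` T k"
    using admD(2)[OF assms admD(4)[OF assms]] by blast
  show "\<rho> k ` T k \<subseteq> L k"
    using admD(1)[OF assms, of "\<lambda>_. x" x for x] conv_const T_in Lconv_in(2) by blast
qed

lemma adm_L_lepoll: assumes "adm k" shows "L k \<lesssim> (UNIV :: real set)"
proof -
  have "\<rho> k ` T k \<lesssim> T k" by (rule image_lepoll)
  moreover have "T k \<lesssim> X k" by (rule subset_imp_lepoll) (auto simp: total_def)
  ultimately show ?thesis using adm_L[OF assms] L.lepoll_reals lepoll_trans by metis
qed

text \<open>The graph in \<open>rho\<close> is indexed by representatives. As
  \<open>\<rho> k\<close> is injective up to equivalence, the graph is single valued and equals a
  \<open>lam\<close> over \<open>L k\<close>, for any choice of representatives.\<close>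

lemma rho_Suc:
  assumes "adm k" "F \<in> T (Suc k)"
  obtains f where "\<rho> (Suc k) F = lam (L k) f" "\<And>y. y \<in> T k \<Longrightarrow> f (\<rho> k y) = r (app F y)"
proof -
  define f where "f u = r (app F (SOME y. y \<in> T k \<and> \<rho> k y = u))" for u
  have f: "f (\<rho> k y) = r (app F y)" if "y \<in> T k" for y
  proof -
    define y' where "y' = (SOME y'. y' \<in> T k \<and> \<rho> k y' = \<rho> k y)"
    have "y' \<in> T k \<and> \<rho> k y' = \<rho> k y" unfolding y'_def by (rule someI[of _ y]) (use that in auto)
    then have "per eq X k y' y" using admD(3) assms that by blast
    then have "eq (app F y') (app F y)" using assms by (auto simp: total_def)
    then show ?thesis using eq_iff unfolding f_def y'_def by blast
  qed
  have "{(\<rho> k y, r (app F y)) | y. y \<in> T k} = {(u, f u) | u. u \<in> L k}"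
    unfolding adm_L[OF assms(1)] using f by auto
  then have "\<rho> (Suc k) F = lam (L k) f" by (simp add: lam_def)
  then show thesis using that f by blast
qed

lemma app_rho:
  assumes "adm k" "F \<in> T (Suc k)" "y \<in> T k"
  shows "app (\<rho> (Suc k) F) (\<rho> k y) = r (app F y)"
proof -
  obtain f where f: "\<rho> (Suc k) F = lam (L k) f" "\<And>y. y \<in> T k \<Longrightarrow> f (\<rho> k y) = r (app F y)"
    using rho_Suc assms by blast
  have "\<rho> k y \<in> L k" using adm_L assms by auto
  then show ?thesis using f assms app_lam[OF adm_L_lepoll[OF assms(1)]] by simp
qed

lemma conv_r:
  assumes "\<And>i. F i \<in> T (Suc k)" "G \<in> T (Suc k)" "conv (Suc k) F G"
    and "\<And>i. x i \<in> T k" "y \<in> T k" "conv k x y"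
  shows "(\<lambda>i. r (app (F i) (x i))) \<longlonglongrightarrow> r (app G y)"
proof (rule r_cont)
  show "\<forall>\<^sub>F i in sequentially. le (pr n (app G y)) (app (F i) (x i))" for n
    by (rule conv_app) (use assms T_in in auto)
  show "app G y \<in> B" "\<And>i. app (F i) (x i) \<in> B" using assms app_in T_in by blast+
  show "eq (app G y) (app G y)" "\<And>i. eq (app (F i) (x i)) (app (F i) (x i))"
    using assms total_app by blast+
qed

lemma rho_Suc_in_L:
  assumes "adm k" "F \<in> T (Suc k)"
  shows "\<rho> (Suc k) F \<in> L (Suc k)"
proof -
  obtain f where f: "\<rho> (Suc k) F = lam (L k) f" "\<And>y. y \<in> T k \<Longrightarrow> f (\<rho> k y) = r (app F y)"
    using rho_Suc assms by blast
  have "(\<lambda>i. f (us i)) \<longlonglongrightarrow> f u" if us: "Lconv k us u" for us u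
  proof -
    obtain xs x where x: "\<And>i. xs i \<in> T k \<and> \<rho> k (xs i) = us i" "x \<in> T k" "\<rho> k x = u" "conv k xs x"
      using admD(2)[OF assms(1) us] by blast
    have "(\<lambda>i. r (app F (xs i))) \<longlonglongrightarrow> r (app F x)"
      by (rule conv_r) (use assms x conv_const T_in in auto)
    moreover have "f (us i) = r (app F (xs i))" for i using f(2) x(1) by metis
    moreover have "f u = r (app F x)" using f(2) x by metis
    ultimately show ?thesis by simp
  qed
  then show ?thesis using f by auto
qed

lemma LSuc_eqI:
  assumes "adm k" "F \<in> L (Suc k)" "G \<in> L (Suc k)" "\<And>u. u \<in> L k \<Longrightarrow> app F u = app G u"
  shows "F = G"
proof -
  obtain f g where fg: "F = lam (L k) f" "G = lam (L k) g" using assms(2,3) by auto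
  show ?thesis unfolding fg
    by (rule lam_cong) (use assms(4) fg app_lam[OF adm_L_lepoll[OF assms(1)]] in auto)
qed

lemma LSuc_cont:
  assumes "adm k" "F \<in> L (Suc k)" "Lconv k us u"
  shows "(\<lambda>i. app F (us i)) \<longlonglongrightarrow> app F u"
proof -
  obtain f where f: "F = lam (L k) f" "(\<lambda>i. f (us i)) \<longlonglongrightarrow> f u" using assms(2,3) by auto
  then show ?thesis using Lconv_in[OF assms(3)] app_lam[OF adm_L_lepoll[OF assms(1)]] by simp
qed

text \<open>Only the lifting of convergent sequences depends on the hierarchy. Continuity of
  \<open>\<rho>\<close> follows from joint continuity of application after lifting the arguments,
  and injectivity from evaluation at total arguments.\<close>

lemma adm_Suc:
  assumes adm: "adm k"
    and lift: "\<And>Us U. Lconv (Suc k) Us U \<Longrightarrow> \<exists>xs x. (\<forall>i. xs i \<in> T (Suc k) \<and>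
        (\<forall>y\<in>T k. r (app (xs i) y) = app (Us i) (\<rho> k y))) \<and>
        x \<in> T (Suc k) \<and> (\<forall>y\<in>T k. r (app x y) = app U (\<rho> k y)) \<and> conv (Suc k) xs x"
  shows "adm (Suc k)"
  unfolding adm_def
proof (intro conjI allI impI ballI)
  fix xs x assume x: "\<forall>i. xs i \<in> T (Suc k)" "x \<in> T (Suc k)" "conv (Suc k) xs x"
  have "(\<lambda>i. app (\<rho> (Suc k) (xs (g i))) (us i)) \<longlonglongrightarrow> app (\<rho> (Suc k) x) u"
    if us: "Lconv k us u" and g: "filterlim g at_top sequentially" for us u g
  proof -
    obtain ys y where y: "\<And>i. ys i \<in> T k \<and> \<rho> k (ys i) = us i" "y \<in> T k" "\<rho> k y = u" "conv k ys y"
      using admD(2)[OF adm us] by blast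
    have "conv (Suc k) (\<lambda>i. xs (g i)) x"
      using x(3) filterlim_comp_conv[OF g] unfolding conv_def by blast
    then have "(\<lambda>i. r (app (xs (g i)) (ys i))) \<longlonglongrightarrow> r (app x y)"
      by (intro conv_r) (use x y in auto)
    moreover have "app (\<rho> (Suc k) (xs (g i))) (us i) = r (app (xs (g i)) (ys i))" for i
      using app_rho[OF adm] x y by metis
    moreover have "app (\<rho> (Suc k) x) u = r (app x y)" using app_rho[OF adm] x y by metis
    ultimately show ?thesis by simp
  qed
  then show "Lconv (Suc k) (\<lambda>i. \<rho> (Suc k) (xs i)) (\<rho> (Suc k) x)"
    using rho_Suc_in_L[OF adm] x by (auto simp del: rho.simps L.simps)
next
  fix Us U assume U: "Lconv (Suc k) Us U"
  obtain xs x where x: "\<And>i. xs i \<in> T (Suc k)" "\<And>i y. y \<in> T k \<Longrightarrow> r (app (xs i) y) = app (Us i) (\<rho> k y)"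
        "x \<in> T (Suc k)" "\<And>y. y \<in> T k \<Longrightarrow> r (app x y) = app U (\<rho> k y)" "conv (Suc k) xs x"
    using lift[OF U] by blast
  have "\<rho> (Suc k) (xs i) = Us i" for i
    by (rule LSuc_eqI[OF adm rho_Suc_in_L[OF adm]])
      (use x Lconv_in[OF U] adm_L[OF adm] app_rho[OF adm] in \<open>auto simp del: rho.simps L.simps\<close>)
  moreover have "\<rho> (Suc k) x = U"
    by (rule LSuc_eqI[OF adm rho_Suc_in_L[OF adm]])
      (use x Lconv_in[OF U] adm_L[OF adm] app_rho[OF adm] in \<open>auto simp del: rho.simps L.simps\<close>)
  ultimately show "\<exists>xs x. (\<forall>i. xs i \<in> T (Suc k) \<and> \<rho> (Suc k) (xs i) = Us i) \<and>
        x \<in> T (Suc k) \<and> \<rho> (Suc k) x = U \<and> conv (Suc k) xs x"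
    using x by blast
next
  fix F G assume FG: "F \<in> T (Suc k)" "G \<in> T (Suc k)" "\<rho> (Suc k) F = \<rho> (Suc k) G"
  have "eq (app F x) (app G y)" if xy: "per eq X k x y" for x y
  proof -
    have t: "x \<in> T k" "y \<in> T k" using per_total[OF symp_eq transp_eq xy] .
    have "r (app F x) = r (app G y)"
      using app_rho[OF adm] FG t per_rho[OF xy] by metis
    then show ?thesis using eq_iff total_app FG t by blast
  qed
  then show "per eq X (Suc k) F G" using FG by (auto simp: total_def)
next
  fix U assume U: "U \<in> L (Suc k)"
  then obtain f where f: "U = lam (L k) f" "\<And>us u. Lconv k us u \<Longrightarrow> (\<lambda>i. f (us i)) \<longlonglongrightarrow> f u"
    by auto
  have "app U u = f u" if "u \<in> L k" for u
    using f that app_lam[OF adm_L_lepoll[OF adm]] by auto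
  then have "(\<lambda>i. app U (us i)) \<longlonglongrightarrow> app U u" if "Lconv k us u" for us u
    using f(2)[OF that] Lconv_in[OF that] by simp
  then show "Lconv (Suc k) (\<lambda>_. U) U" using U by (auto simp del: L.simps)
qed

text \<open>The right-hand side mentions only \<open>L\<close> and \<open>Lconv\<close>, so
  admissible hierarchies have the same topology at this level. Lifted sequences give one direction;
  for the other, failures above every projection of x form a convergent sequence by
  \<open>conv_above\<close>.\<close>

lemma openin_quotient_iff:
  assumes "adm k"
  shows "openin (quotient_topology (total_space le eq X k) (\<rho> k)) U \<longleftrightarrow>
    U \<subseteq> L k \<and> (\<forall>us u. Lconv k us u \<longrightarrow> u \<in> U \<longrightarrow> (\<forall>\<^sub>F i in sequentially. us i \<in> U))"
  (is "?L \<longleftrightarrow> ?R")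
proof
  assume O: ?L
  then have U: "U \<subseteq> L k" by (simp add: openin_quotient_topology adm_L[OF assms])
  have V: "\<exists>n. \<forall>y\<in>T k. leX (\<pi> k n x) y \<longrightarrow> \<rho> k y \<in> U" if "x \<in> T k" "\<rho> k x \<in> U" for x
    using O that unfolding openin_quotient_topology openin_total_space_iff by auto
  have "\<forall>\<^sub>F i in sequentially. us i \<in> U" if us: "Lconv k us u" "u \<in> U" for us u
  proof -
    obtain xs x where x: "\<And>i. xs i \<in> T k \<and> \<rho> k (xs i) = us i" "x \<in> T k" "\<rho> k x = u" "conv k xs x"
      using admD(2)[OF assms us(1)] by blast
    then obtain n where n: "\<forall>y\<in>T k. leX (\<pi> k n x) y \<longrightarrow> \<rho> k y \<in> U" using V us by blast
    have "\<forall>\<^sub>F i in sequentially. leX (\<pi> k n x) (xs i)" using x by (auto simp: conv_def)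
    then show ?thesis by eventually_elim (use n x in metis)
  qed
  then show ?R using U by blast
next
  assume R: ?R
  have "\<exists>n. \<forall>y\<in>T k. leX (\<pi> k n x) y \<longrightarrow> \<rho> k y \<in> U" if x: "x \<in> T k" "\<rho> k x \<in> U" for x
  proof (rule ccontr)
    assume "\<not> ?thesis"
    then obtain ys where ys: "\<And>n. ys n \<in> T k" "\<And>n. leX (\<pi> k n x) (ys n)" "\<And>n. \<rho> k (ys n) \<notin> U"
      by metis
    have "conv k ys x" by (rule conv_above) (use ys x T_in in auto)
    then have "Lconv k (\<lambda>i. \<rho> k (ys i)) (\<rho> k x)" using admD(1)[OF assms] ys x by blast
    then have "\<forall>\<^sub>F i in sequentially. \<rho> k (ys i) \<in> U" using R x by blast
    then show False using ys(3) by (auto simp: eventually_sequentially)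
  qed
  then show ?L
    unfolding openin_quotient_topology openin_total_space_iff using R
    by (auto simp: adm_L[OF assms])
qed

end

lemma (in thier) r_cont0:
  assumes "\<And>i. xs i \<in> T 0" "x \<in> T 0" "conv 0 xs x"
  shows "Lconv 0 (\<lambda>i. \<rho> 0 (xs i)) (\<rho> 0 x)"
proof -
  have "(\<lambda>i. r (base (xs i))) \<longlonglongrightarrow> r (base x)"
  proof (rule r_cont)
    show "\<forall>\<^sub>F i in sequentially. le (pr n (base x)) (base (xs i))" for n
      using assms(3)[unfolded conv_def, rule_format, of n]
    proof eventually_elim
      case (elim i) then show ?case using assms(1)[of i] by (auto simp: total_def X_0)
    qed
    show "base (xs i) \<in> B" "eq (base (xs i)) (base (xs i))" for i
      using assms(1)[of i] by (auto simp: total_def X_0)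
  qed (use assms(2) in \<open>auto simp: total_def X_0\<close>)
  then show ?thesis by auto
qed

lemma (in thier) adm_0:
  assumes "\<And>t t0. t \<longlonglongrightarrow> t0 \<Longrightarrow> \<exists>b a. (\<forall>i. b i \<in> B \<and> eq (b i) (b i) \<and> r (b i) = t i) \<and>
     a \<in> B \<and> eq a a \<and> r a = t0 \<and> (\<forall>n. \<forall>\<^sub>F i in sequentially. le (pr n a) (b i))"
  shows "adm 0"
  unfolding adm_def
proof (intro conjI allI impI ballI)
  show "Lconv 0 (\<lambda>i. \<rho> 0 (xs i)) (\<rho> 0 x)" if "\<forall>i. xs i \<in> T 0" "x \<in> T 0" "conv 0 xs x" for xs x
    using r_cont0 that by blast
  show "\<exists>xs x. (\<forall>i. xs i \<in> T 0 \<and> \<rho> 0 (xs i) = us i) \<and> x \<in> T 0 \<and> \<rho> 0 x = u \<and> conv 0 xs x"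
    if us: "Lconv 0 us u" for us u
  proof -
    have t: "(\<lambda>i. base (us i)) \<longlonglongrightarrow> base u" "u \<in> range Base" "range us \<subseteq> range Base" using us by auto
    have B: "Base (base u) = u" "\<And>i. Base (base (us i)) = us i"
      using t(2,3) by (auto simp: image_iff subset_iff) (metis fnl.sel)
    obtain b a where "\<And>i. b i \<in> B \<and> eq (b i) (b i) \<and> r (b i) = base (us i)"
     "a \<in> B" "eq a a" "r a = base u" "\<And>n. \<forall>\<^sub>F i in sequentially. le (pr n a) (b i)"
      using assms[OF t(1)] by blast
    then show ?thesis
      by (intro exI[of _ "\<lambda>i. Base (b i)"] exI[of _ "Base a"])
        (auto simp: total_def X_0 conv_def B)
  qed
  show "per eq X 0 x y" if "x \<in> T 0" "y \<in> T 0" "\<rho> 0 x = \<rho> 0 y" for x y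
    using that eq_iff[of "base x" "base y"] by (auto simp: total_def)
qed auto

lemma adm_topology_eq:
  assumes "thier B1 le1 pr1 sim1 X1 eq1 r1" "thier B2 le2 pr2 sim2 X2 eq2 r2"
    and "thier.adm le1 pr1 X1 eq1 r1 k" "thier.adm le2 pr2 X2 eq2 r2 k"
  shows "rho r1 eq1 X1 k ` total eq1 X1 k = rho r2 eq2 X2 k ` total eq2 X2 k"
    and "quotient_topology (total_space le1 eq1 X1 k) (rho r1 eq1 X1 k)
       = quotient_topology (total_space le2 eq2 X2 k) (rho r2 eq2 X2 k)"
  using thier.adm_L[OF assms(1,3)] thier.adm_L[OF assms(2,4)] apply simp
  by (rule topology_eq[THEN iffD2]) (simp add: thier.openin_quotient_iff[OF assms(1,3)]
    thier.openin_quotient_iff[OF assms(2,4)])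

section \<open>The Kleene--Kreisel functionals of type at least two\<close>

definition N_pr :: "nat \<Rightarrow> nat option \<Rightarrow> nat option" where
  "N_pr n a = (case a of None \<Rightarrow> None | Some j \<Rightarrow> if j \<le> n then Some j else None)"

lemma N_pr_simps [simp]: "N_pr n None = None" "N_pr n (Some j) = (if j \<le> n then Some j else None)"
  by (auto simp: N_pr_def)

lemma N_le_simps [simp]: "N_le None a" "N_le a a" "N_le (Some j) a \<longleftrightarrow> a = Some j"
  "N_le a None \<longleftrightarrow> a = None"
  by (auto simp: N_le_def)

lemma pdom_N: "pdom UNIV N_le N_pr"
proof
  show "finite (range (N_pr n))" for n
    by (rule finite_subset[of _ "insert None (Some ` {..n})"]) (auto simp: N_pr_def split: option.splits if_splits)
  show "N_le x u" if "\<And>n. N_le (N_pr n x) u" for x u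
    using that[of "the x"] by (cases x) auto
  show "\<exists>d\<in>D. N_le (N_pr n s) d" if D: "directed_in N_le UNIV D" and s: "lub_in N_le UNIV D s" for D s n
  proof (cases "s \<in> D")
    case True then show ?thesis by (auto simp: N_pr_def split: option.splits)
  next
    case False
    then have "\<forall>x\<in>D. N_le x None" using s unfolding lub_in_def N_le_def by blast
    then have "N_le s None" using s unfolding lub_in_def by blast
    then have "s = None" by simp
    then show ?thesis using D by (auto simp: directed_in_def)
  qed
  show "\<exists>s. lub_in N_le UNIV D s" if D: "directed_in N_le UNIV D" for D
  proof (cases "D \<subseteq> {None}")
    case True
    then have "lub_in N_le UNIV D None" by (auto simp: lub_in_def)
    then show ?thesis ..
  next
    case False
    then obtain j where j: "Some j \<in> D" by (metis not_None_eq singletonI subsetI)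
    have "N_le x (Some j)" if x: "x \<in> D" for x
    proof -
      obtain z where "N_le x z" "N_le (Some j) z" using D x j unfolding directed_in_def by blast
      then show ?thesis by simp
    qed
    then have "lub_in N_le UNIV D (Some j)" using j by (auto simp: lub_in_def)
    then show ?thesis ..
  qed
qed (auto simp: N_pr_def N_le_def split: option.splits)

interpretation N: hier UNIV N_le N_pr "\<lambda>_ _. True" N_dom
  by (intro hier.intro hier_axioms.intro pdom_N)
    (auto simp: N_dom_def dom_hier_Suc simp del: dom_hier.simps(2))

lemma symp_N_eq: "symp N_eq" and transp_N_eq: "transp N_eq"
  by (auto simp: N_eq_def intro!: sympI transpI)

lemmas N_per_sym = per_sym[OF symp_N_eq]
lemmas N_per_trans = per_trans[OF symp_N_eq transp_N_eq]
lemmas N_per_total = per_total[OF symp_N_eq transp_N_eq]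

abbreviation "N_per k \<equiv> per N_eq N_dom k"
abbreviation "N_tot k \<equiv> total N_eq N_dom k"

lemma lam_in_N:
  assumes "\<And>x y. x \<in> N_dom k \<Longrightarrow> y \<in> N_dom k \<Longrightarrow> N.leX x y \<Longrightarrow> N_le (f x) (f y)"
    and "\<And>x n. x \<in> N_dom k \<Longrightarrow> \<exists>m. N_le (N_pr n (f x)) (f (N.\<pi> k m x))"
  shows "lam (N_dom k) f \<in> N_dom (Suc k)"
  by (rule N.lam_in_X) (use assms in auto)

section \<open>Baire space inside every level above the ground\<close>

primrec cst :: "nat \<Rightarrow> nat \<Rightarrow> nat option fnl" where
  "cst j 0 = Base (Some j)"
| "cst j (Suc k) = lam (N_dom k) (\<lambda>_. Some j)"

primrec vl :: "nat \<Rightarrow> nat option fnl \<Rightarrow> nat option" where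
  "vl 0 x = base x"
| "vl (Suc k) x = app x (cst 0 k)"

lemma cst_in: "cst j k \<in> N_dom k"
proof (cases k)
  case 0 then show ?thesis by (auto simp: N.X_0)
next
  case (Suc i) then show ?thesis by (auto intro: lam_in_N)
qed

lemma cst_per: "N_per k (cst j k) (cst j k)"
proof (cases k)
  case 0 then show ?thesis by (auto simp: N.X_0 N_eq_def)
next
  case (Suc i)
  then show ?thesis using cst_in[of j k] per_in by (fastforce simp: N_eq_def)
qed

lemma vl_cst [simp]: "vl k (cst j k) = Some j"
  using cst_in by (cases k) auto

lemma vl_mono: "x \<in> N_dom k \<Longrightarrow> y \<in> N_dom k \<Longrightarrow> N.leX x y \<Longrightarrow> N_le (vl k x) (vl k y)"
proof (cases k)
  case 0 
  assume "x \<in> N_dom k" "y \<in> N_dom k" "N.leX x y"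
  then show ?thesis using 0 by (auto simp: N.X_0)
next
  case (Suc i)
  assume "x \<in> N_dom k" "y \<in> N_dom k" "N.leX x y"
  then show ?thesis using Suc N.leX_iff cst_in by auto
qed

lemma vl_approx: "x \<in> N_dom k \<Longrightarrow> \<exists>m. N_le (vl k x) (vl k (N.\<pi> k m x))"
proof (cases k)
  case 0
  assume "x \<in> N_dom k"
  then show ?thesis using 0 by (cases "base x") (auto simp: N.X_0 intro!: exI[of _ "the (base x)"])
next
  case (Suc i)
  assume x: "x \<in> N_dom k"
  show ?thesis
  proof (cases "vl k x")
    case (Some z)
    have xS: "x \<in> N_dom (Suc i)" using x Suc by simp
    obtain m where m: "m \<ge> z" "N_le (N_pr z (app x (cst 0 i))) (app x (N.\<pi> i m (cst 0 i)))"
      using N.app_approx[OF xS cst_in] by blast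
    then have "app (N.\<pi> (Suc i) m x) (cst 0 i) = Some z"
      unfolding N.proj_app[OF cst_in] using Some Suc by auto
    then show ?thesis using Some Suc by (auto simp del: proj.simps)
  qed auto
qed

lemma vl_proj_le: "x \<in> N_dom k \<Longrightarrow> vl k (N.\<pi> k n x) = Some j \<Longrightarrow> j \<le> n \<and> vl k x = Some j"
proof
  assume x: "x \<in> N_dom k" "vl k (N.\<pi> k n x) = Some j"
  show "j \<le> n"
  proof (cases k)
    case 0
    then show ?thesis using x by (auto simp: N_pr_def split: option.splits if_splits)
  next
    case (Suc i)
    then have "N_pr n (app x (N.\<pi> i n (cst 0 i))) = Some j"
      using x N.proj_app[OF cst_in, where f=x and n=n] by simp
    then show ?thesis by (auto simp: N_pr_def split: option.splits if_splits)
  qed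
  show "vl k x = Some j"
    using vl_mono[of "N.\<pi> k n x" k x] x N.L.pr_in N.L.pr_le by auto
qed

lemma vl_per: "N_per k x y \<Longrightarrow> N_eq (vl k x) (vl k y)"
  using cst_per by (cases k) auto

text \<open>\<open>cst\<close> and \<open>vl\<close> embed the naturals in level k and read them
  back; \<open>emb\<close> and \<open>rd\<close> therefore embed sequences of naturals in level k +
  1 and read them back. This carries the type-two construction to all higher types.\<close>

definition emb :: "nat \<Rightarrow> (nat \<Rightarrow> nat) \<Rightarrow> nat option fnl" where
  "emb k \<beta> = lam (N_dom k) (\<lambda>g. map_option \<beta> (vl k g))"

definition rd :: "nat \<Rightarrow> nat option fnl \<Rightarrow> nat \<Rightarrow> nat option" where
  "rd k f j = app f (cst j k)"

lemma app_emb: "g \<in> N_dom k \<Longrightarrow> app (emb k \<beta>) g = map_option \<beta> (vl k g)"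
  by (simp add: emb_def)

lemma emb_in: "emb k \<beta> \<in> N_dom (Suc k)"
  unfolding emb_def
proof (rule lam_in_N)
  fix x y assume "x \<in> N_dom k" "y \<in> N_dom k" "N.leX x y"
  then show "N_le (map_option \<beta> (vl k x)) (map_option \<beta> (vl k y))"
    using vl_mono by (fastforce simp: N_le_def)
next
  fix x n assume "x \<in> N_dom k"
  then obtain m where "N_le (vl k x) (vl k (N.\<pi> k m x))" using vl_approx by blast
  then show "\<exists>m. N_le (N_pr n (map_option \<beta> (vl k x))) (map_option \<beta> (vl k (N.\<pi> k m x)))"
    by (intro exI[of _ m]) (auto simp: N_le_def N_pr_def split: option.splits)
qed

lemma emb_per: "N_per (Suc k) (emb k \<beta>) (emb k \<beta>)"
proof -
  have "N_eq (app (emb k \<beta>) x) (app (emb k \<beta>) y)" if "N_per k x y" for x y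
    using vl_per[OF that] per_in[OF that] by (auto simp: app_emb N_eq_def)
  then show ?thesis using emb_in by simp
qed

lemma rd_emb: "rd k (emb k \<beta>) = Some \<circ> \<beta>"
  by (auto simp: rd_def app_emb cst_in)

lemma rd_per: "N_per (Suc k) f g \<Longrightarrow> \<exists>\<beta>. rd k f = Some \<circ> \<beta> \<and> rd k g = Some \<circ> \<beta>"
proof -
  assume "N_per (Suc k) f g"
  then have "N_eq (rd k f j) (rd k g j)" for j using cst_per by (auto simp: rd_def)
  then have "\<forall>j. \<exists>n. rd k f j = Some n \<and> rd k g j = Some n" by (auto simp: N_eq_def)
  then show ?thesis by (metis comp_apply ext)
qed

lemma rd_mono: "f \<in> N_dom (Suc k) \<Longrightarrow> g \<in> N_dom (Suc k) \<Longrightarrow> N.leX f g \<Longrightarrow> N_le (rd k f j) (rd k g j)"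
  using N.leX_iff cst_in by (auto simp: rd_def)

lemma rd_proj_bound: "f \<in> N_dom (Suc k) \<Longrightarrow> rd k (N.\<pi> (Suc k) n f) j = Some z \<Longrightarrow> z \<le> n"
  unfolding rd_def N.proj_app[OF cst_in] by (auto simp: N_pr_def split: option.splits if_splits)

lemma rd_proj_le: "f \<in> N_dom (Suc k) \<Longrightarrow> N_le (rd k (N.\<pi> (Suc k) n f) j) (rd k f j)"
  by (intro rd_mono N.L.pr_in N.L.pr_le)

lemma rd_approx:
  assumes f: "f \<in> N_dom (Suc k)"
  shows "\<exists>m. \<forall>j\<le>J. rd k (N.\<pi> (Suc k) m f) j = rd k f j"
proof -
  have 1: "\<forall>\<^sub>F m in sequentially. rd k (N.\<pi> (Suc k) m f) j = rd k f j" for j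
  proof (cases "rd k f j")
    case None
    then have "rd k (N.\<pi> (Suc k) m f) j = rd k f j" for m using rd_proj_le[OF f, of m j] by simp
    then show ?thesis by simp
  next
    case (Some z)
    obtain m where m: "m \<ge> z" "N_le (N_pr z (app f (cst j k))) (app f (N.\<pi> k m (cst j k)))"
      using N.app_approx[OF f cst_in] by blast
    then have *: "rd k (N.\<pi> (Suc k) m f) j = Some z"
      unfolding rd_def N.proj_app[OF cst_in] using Some by (auto simp: rd_def)
    have "rd k (N.\<pi> (Suc k) m' f) j = Some z" if "m' \<ge> m" for m'
      using rd_mono[OF N.L.pr_in[OF f] N.L.pr_in[OF f] N.L.pr_incr[OF f that], of j] * by simp
    then show ?thesis unfolding Some eventually_sequentially by blast
  qed
  have "\<forall>\<^sub>F m in sequentially. \<forall>j\<in>{..J}. rd k (N.\<pi> (Suc k) m f) j = rd k f j"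
    using 1 by (intro eventually_ball_finite) auto
  then show ?thesis by (auto simp: eventually_sequentially)
qed

section \<open>Functionals coding finite and infinite sequences\<close>

text \<open>A finite or infinite sequence is given by the function \<open>S\<close> listing its initial segments.
  The functional \<open>Fel k l S\<close> is the characteristic function of the union of the clopen sets
  \<open>{\<alpha>. \<alpha> 0 = u \<and> (\<exists>i\<le>a. \<alpha> (i + 1) = (a, b))}\<close>, where \<open>u @ [a, b]\<close> runs over the initial segments.
  On partial arguments, the parameter \<open>l\<close> controls how much of \<open>\<alpha>\<close> has to be defined.\<close>

definition hit :: "nat \<Rightarrow> (nat \<Rightarrow> nat list) \<Rightarrow> (nat \<Rightarrow> nat option) \<Rightarrow> nat option" where
  "hit l S \<alpha> = (case \<alpha> 0 of None \<Rightarrow> None | Some c \<Rightarrow>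
     (let u = list_decode c; t = S (length u + 2); a = t ! length u in
      if take (length u) t = u \<and> length u + l \<le> length t then
        (if \<exists>i\<le>a. \<alpha> (Suc i) = None then None
         else if length t = length u + 2 \<and>
             (\<exists>i\<le>a. \<alpha> (Suc i) = Some (prod_encode (a, t ! Suc (length u)))) then Some 1
         else Some 0)
      else Some 0))"

definition Fel :: "nat \<Rightarrow> nat \<Rightarrow> (nat \<Rightarrow> nat list) \<Rightarrow> nat option fnl" where
  "Fel k l S = lam (N_dom (Suc k)) (\<lambda>f. hit l S (rd k f))"

lemma hit_agree:
  assumes "\<alpha> 0 = Some c" "\<beta> 0 = Some c"
    and "\<forall>i\<le>S (length (list_decode c) + 2) ! length (list_decode c). \<beta> (Suc i) = \<alpha> (Suc i)"
  shows "hit l S \<beta> = hit l S \<alpha>"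
proof -
  define u where "u = list_decode c"
  define t where "t = S (length u + 2)"
  have eq: "(\<exists>i\<le>t ! length u. \<beta> (Suc i) = z) \<longleftrightarrow> (\<exists>i\<le>t ! length u. \<alpha> (Suc i) = z)" for z
    using assms(3) unfolding t_def u_def by metis
  show ?thesis
    unfolding hit_def assms(1,2) option.case Let_def u_def[symmetric] t_def[symmetric] eq ..
qed

lemma hit_mono:
  assumes "\<And>j. N_le (\<alpha> j) (\<beta> j)" shows "N_le (hit l S \<alpha>) (hit l S \<beta>)"
proof (cases "hit l S \<alpha>")
  case (Some z)
  then obtain c where c: "\<alpha> 0 = Some c" by (auto simp: hit_def split: option.splits)
  have b: "\<alpha> j = Some y \<Longrightarrow> \<beta> j = Some y" for j y using assms[of j] by simp
  define u where "u = list_decode c"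
  define t where "t = S (length u + 2)"
  show ?thesis
  proof (cases "take (length u) t = u \<and> length u + l \<le> length t")
    case True
    then have *: "\<forall>i\<le>t ! length u. \<alpha> (Suc i) \<noteq> None"
      using Some c by (auto simp: hit_def Let_def u_def t_def split: if_splits)
    then have "\<forall>i\<le>t ! length u. \<beta> (Suc i) = \<alpha> (Suc i)" using b by fastforce
    then have "hit l S \<beta> = hit l S \<alpha>"
      by (intro hit_agree[where \<alpha>=\<alpha> and \<beta>=\<beta> and S=S and c=c]) (use c b[OF c] in \<open>simp_all add: u_def t_def\<close>)
    then show ?thesis by simp
  next
    case False
    then show ?thesis using c b[OF c] by (auto simp: hit_def Let_def u_def t_def)
  qed
qed simp

lemma hit_cong:
  shows "\<exists>J. \<forall>\<beta>. (\<forall>j\<le>J. \<beta> j = \<alpha> j) \<longrightarrow> hit l S \<beta> = hit l S \<alpha>"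
proof (cases "\<alpha> 0")
  case None
  then show ?thesis by (intro exI[of _ 0]) (auto simp: hit_def)
next
  case (Some c)
  define u where "u = list_decode c"
  define t where "t = S (length u + 2)"
  have "hit l S \<beta> = hit l S \<alpha>" if "\<forall>j\<le>Suc (t ! length u). \<beta> j = \<alpha> j" for \<beta>
  proof -
    show ?thesis
      by (rule hit_agree[where \<alpha>=\<alpha> and \<beta>=\<beta> and S=S and c=c]) (use that Some in \<open>auto simp: u_def t_def\<close>)
  qed
  then show ?thesis by blast
qed

lemma hit_same_segment:
  assumes "\<And>c. \<alpha> 0 = Some c \<Longrightarrow> S (length (list_decode c) + 2) = S' (length (list_decode c) + 2)"
  shows "hit l S \<alpha> = hit l S' \<alpha>"
proof (cases "\<alpha> 0")
  case None then show ?thesis by (simp add: hit_def)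
next
  case (Some c)
  show ?thesis unfolding hit_def Some option.case Let_def assms[OF Some] ..
qed

lemma hit_flag:
  assumes "\<And>c. \<alpha> 0 = Some c \<Longrightarrow> length (S (length (list_decode c) + 2)) = length (list_decode c) + 2"
  shows "hit 1 S \<alpha> = hit 2 S \<alpha>"
proof (cases "\<alpha> 0")
  case None then show ?thesis by (simp add: hit_def)
next
  case (Some c)
  define u where "u = list_decode c"
  define t where "t = S (length u + 2)"
  have eq: "length u + 1 \<le> length t \<longleftrightarrow> length u + 2 \<le> length t"
    using assms[OF Some] by (simp add: u_def t_def)
  show ?thesis unfolding hit_def Some option.case Let_def u_def[symmetric] t_def[symmetric] eq ..
qed

lemma hit_total: "\<exists>z. hit l S (Some \<circ> \<beta>) = Some z"
  by (auto simp: hit_def Let_def)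

text \<open>The flags differ on a segment that ends right after the entry a: with flag 1 the answer
  0 waits until all \<open>\<alpha> (Suc i)\<close> with \<open>i \<le> a\<close> are known, with
  flag 2 it comes at once. In \<open>Fel_append\<close> the left side must be cautious, because one
  more entry may turn the answer into 1, and the right side must be eager at its own last entry.
  Agreement on total arguments allows a switch of flags between two such steps.\<close>

lemma hit_total_flag:
  "hit 1 (\<lambda>m. take m s) (Some \<circ> \<beta>) = hit 2 (\<lambda>m. take m s) (Some \<circ> \<beta>)"
  by (auto simp: hit_def Let_def)

lemma app_Fel: "f \<in> N_dom (Suc k) \<Longrightarrow> app (Fel k l S) f = hit l S (rd k f)"
  by (simp add: Fel_def)

lemma Fel_in: "Fel k l S \<in> N_dom (Suc (Suc k))"
  unfolding Fel_def
proof (rule lam_in_N)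
  fix f g assume "f \<in> N_dom (Suc k)" "g \<in> N_dom (Suc k)" "N.leX f g"
  then show "N_le (hit l S (rd k f)) (hit l S (rd k g))" by (intro hit_mono rd_mono)
next
  fix f n assume f: "f \<in> N_dom (Suc k)"
  obtain J where J: "\<And>\<beta>. (\<forall>j\<le>J. \<beta> j = rd k f j) \<Longrightarrow> hit l S \<beta> = hit l S (rd k f)"
    using hit_cong[of "rd k f"] by blast
  obtain m where "\<forall>j\<le>J. rd k (N.\<pi> (Suc k) m f) j = rd k f j" using rd_approx[OF f] by blast
  then have "hit l S (rd k (N.\<pi> (Suc k) m f)) = hit l S (rd k f)" by (rule J)
  then show "\<exists>m. N_le (N_pr n (hit l S (rd k f))) (hit l S (rd k (N.\<pi> (Suc k) m f)))"
    by (intro exI[of _ m]) (auto simp: N_pr_def split: option.splits)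
qed

lemma Fel_per:
  assumes "\<And>\<beta>. hit l S (Some \<circ> \<beta>) = hit l' S' (Some \<circ> \<beta>)"
  shows "N_per (Suc (Suc k)) (Fel k l S) (Fel k l' S')"
proof -
  have "N_eq (app (Fel k l S) f) (app (Fel k l' S') g)" if fg: "N_per (Suc k) f g" for f g
  proof -
    obtain \<beta> where "rd k f = Some \<circ> \<beta>" "rd k g = Some \<circ> \<beta>" using rd_per[OF fg] by blast
    then show ?thesis using per_in[OF fg] assms[of \<beta>] hit_total[of l S \<beta>] by (auto simp: app_Fel N_eq_def)
  qed
  then show ?thesis by (subst per.simps) (use Fel_in in blast)
qed

lemma Fel_total: "Fel k l S \<in> N_tot (Suc (Suc k))"
  using Fel_per Fel_in by (auto simp: total_def simp del: per.simps)

text \<open>The n-th projection consults its argument only through \<open>\<pi> (Suc k) n f\<close>,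
  whose readings are numbers at most n. So two functionals need to be compared on such readings
  only.\<close>

lemma proj_Fel_le:
  assumes "\<And>\<alpha>. (\<And>j z. \<alpha> j = Some z \<Longrightarrow> z \<le> n) \<Longrightarrow> N_le (hit l S \<alpha>) (hit l' S' \<alpha>)"
  shows "N.leX (N.\<pi> (Suc (Suc k)) n (Fel k l S)) (Fel k l' S')"
  unfolding N.leX_iff[OF N.L.pr_in[OF Fel_in] Fel_in]
proof
  fix f assume f: "f \<in> N_dom (Suc k)"
  let ?\<alpha> = "rd k (N.\<pi> (Suc k) n f)"
  have "N_le (hit l S ?\<alpha>) (hit l' S' ?\<alpha>)" using assms rd_proj_bound[OF f] by blast
  moreover have "N_le (hit l' S' ?\<alpha>) (hit l' S' (rd k f))"
    using rd_proj_le[OF f] by (intro hit_mono)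
  ultimately show "N_le (app (N.\<pi> (Suc (Suc k)) n (Fel k l S)) f) (app (Fel k l' S') f)"
    unfolding N.proj_app[OF f] app_Fel[OF f] app_Fel[OF N.L.pr_in[OF f]]
    by (auto simp: N_le_def N_pr_def split: option.splits)
qed

lemma Fel_append:
  assumes "n < a"
  shows "N.leX (N.\<pi> (Suc (Suc k)) n (Fel k 1 (\<lambda>m. take m s))) (Fel k 2 (\<lambda>m. take m (s @ [a])))"
proof (rule proj_Fel_le)
  fix \<alpha> :: "nat \<Rightarrow> nat option" assume bd: "\<And>j z. \<alpha> j = Some z \<Longrightarrow> z \<le> n"
  show "N_le (hit 1 (\<lambda>m. take m s) \<alpha>) (hit 2 (\<lambda>m. take m (s @ [a])) \<alpha>)"
  proof (cases "\<alpha> 0")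
    case None then show ?thesis by (simp add: hit_def)
  next
    case (Some c)
    define u where "u = list_decode c"
    consider "length s \<ge> length u + 2" | "length s = length u + 1" | "length s \<le> length u" by linarith
    then show ?thesis
    proof cases
      case 1
      then have "hit 1 (\<lambda>m. take m s) \<alpha> = hit 2 (\<lambda>m. take m s) \<alpha>"
        by (intro hit_flag) (use Some in \<open>simp add: u_def\<close>)
      moreover have "\<dots> = hit 2 (\<lambda>m. take m (s @ [a])) \<alpha>"
        by (rule hit_same_segment) (use 1 Some in \<open>simp add: u_def\<close>)
      ultimately show ?thesis by simp
    next
      case 2
      \<comment> \<open>A code of a pair is at least its second component, here the new entry a > n,
        so it cannot occur among readings bounded by n.\<close>
      have no: "\<alpha> i \<noteq> Some (prod_encode (b, a))" for i b
        using bd[of i "prod_encode (b, a)"] le_prod_encode_2[of a b] assms by auto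
      show ?thesis using 2 no
        by (auto simp: hit_def Some Let_def u_def[symmetric] nth_append)
    next
      case 3
      then show ?thesis by (simp add: hit_def Some Let_def u_def[symmetric])
    qed
  qed
qed

lemma Fel_limit:
  "\<exists>K0. \<forall>K\<ge>K0. N.leX (N.\<pi> (Suc (Suc k)) n (Fel k 2 (\<lambda>m. map x [0..<m])))
      (Fel k 2 (\<lambda>m. take m (map x [0..<K])))"
proof (intro exI allI impI proj_Fel_le)
  \<comment> \<open>Only the lists u coded by some c at most n can be asked for; the sum dominates
    every length of such a u plus 2.\<close>
  let ?K0 = "(\<Sum>c\<le>n. length (list_decode c) + 2)"
  fix K :: nat and \<alpha> :: "nat \<Rightarrow> nat option"
  assume K: "?K0 \<le> K" and bd: "\<And>j z. \<alpha> j = Some z \<Longrightarrow> z \<le> n"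
  have "hit 2 (\<lambda>m. map x [0..<m]) \<alpha> = hit 2 (\<lambda>m. take m (map x [0..<K])) \<alpha>"
  proof (rule hit_same_segment)
    fix c assume c: "\<alpha> 0 = Some c"
    have "length (list_decode c) + 2 \<le> ?K0"
      by (rule member_le_sum) (use bd[OF c] in auto)
    then show "map x [0..<length (list_decode c) + 2] = take (length (list_decode c) + 2) (map x [0..<K])"
      using K by (simp add: take_map del: upt_Suc)
  qed
  then show "N_le (hit 2 (\<lambda>m. map x [0..<m]) \<alpha>) (hit 2 (\<lambda>m. take m (map x [0..<K])) \<alpha>)"
    by simp
qed

lemma N_conv_app:
  assumes y: "\<And>j. y j \<in> N_dom (Suc k)" "G \<in> N_tot (Suc k)" "N.conv (Suc k) y G"
    and f: "\<And>j. f j \<in> N_dom k" "g \<in> N_tot k" "N.conv k f g"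
  shows "\<forall>\<^sub>F j in sequentially. app (y j) (f j) = app G g"
proof -
  obtain z where z: "app G g = Some z" using total_app[OF y(2) f(2)] by (auto simp: N_eq_def)
  have "\<forall>\<^sub>F j in sequentially. N_le (N_pr z (app G g)) (app (y j) (f j))"
    by (rule N.conv_app) (use y f in \<open>auto simp: total_def\<close>)
  then show ?thesis unfolding z by simp
qed

lemma emb_conv:
  assumes "\<And>m. \<forall>\<^sub>F j in sequentially. \<forall>i\<le>m. \<beta>' j i = \<beta> i"
  shows "N.conv (Suc k) (\<lambda>j. emb k (\<beta>' j)) (emb k \<beta>)"
  unfolding N.conv_def
proof
  fix n
  show "\<forall>\<^sub>F j in sequentially. N.leX (N.\<pi> (Suc k) n (emb k \<beta>)) (emb k (\<beta>' j))"
    using assms[of n]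
  proof eventually_elim
    case (elim j)
    show ?case
      unfolding N.leX_iff[OF N.L.pr_in[OF emb_in] emb_in]
    proof
      fix g assume g: "g \<in> N_dom k"
      show "N_le (app (N.\<pi> (Suc k) n (emb k \<beta>)) g) (app (emb k (\<beta>' j)) g)"
      proof (cases "vl k (N.\<pi> k n g)")
        case None
        then show ?thesis unfolding N.proj_app[OF g] app_emb[OF N.L.pr_in[OF g]] by simp
      next
        case (Some i)
        then have "i \<le> n" "vl k g = Some i" using vl_proj_le g by auto
        then show ?thesis
          unfolding N.proj_app[OF g] app_emb[OF N.L.pr_in[OF g]] app_emb[OF g] using Some elim by simp
      qed
    qed
  qed
qed

text \<open>The functionals given by infinite sequences form a closed set: if a sequence \<open>x n\<close> has no
  convergent subsequence, then infinitely many \<open>x n\<close> share an initial segment \<open>s\<close> and have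
  unbounded next entries \<open>a\<close>; the sequence \<open>\<beta>\<close> consisting of \<open>s\<close> and of these entries \<open>(a, b)\<close>
  is then a point at which the functionals have no common modulus of continuity.\<close>

lemma Fel_closed:
  assumes y: "\<And>n. y n \<in> N_tot (Suc (Suc k))" "G \<in> N_tot (Suc (Suc k))" "N.conv (Suc (Suc k)) y G"
    and yx: "\<And>n. N_per (Suc (Suc k)) (y n) (Fel k 2 (\<lambda>m. map (x n) [0..<m]))"
  shows "\<exists>x. N_per (Suc (Suc k)) G (Fel k 2 (\<lambda>m. map x [0..<m]))"
proof -
  define freq where "freq s \<longleftrightarrow> infinite {n. map (x n) [0..<length s] = s}" for s
  have y_in: "y n \<in> N_dom (Suc (Suc k))" for n using y by (auto simp: total_def)
  have yFel: "app (y n) f = hit 2 (\<lambda>m. map (x n) [0..<m]) (rd k f')" if "N_per (Suc k) f f'" for n f f'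
  proof -
    have "N_eq (app (y n) f) (app (Fel k 2 (\<lambda>m. map (x n) [0..<m])) f')"
      using yx[of n] that by (subst (asm) per.simps) blast
    then show ?thesis using per_in[OF that] by (auto simp: N_eq_def app_Fel)
  qed
  show ?thesis
  proof (cases "\<forall>s. freq s \<longrightarrow> (\<exists>a. freq (s @ [a]))")
    case True
    \<comment> \<open>A path X of segments, each shared by infinitely many \<open>x n\<close>. At a
      total argument the answer for X depends on one finite segment, which some late
      \<open>x j\<close> shares, so G agrees with the functional of X.\<close>
    have "\<exists>f. \<forall>n. (freq (f n) \<and> length (f n) = n) \<and> (\<exists>a. f (Suc n) = f n @ [a])"
    proof (rule dependent_nat_choice)
      show "\<exists>s. freq s \<and> length s = 0" by (simp add: freq_def)
      show "\<exists>t. (freq t \<and> length t = Suc n) \<and> (\<exists>a. t = s @ [a])" if fs: "freq s \<and> length s = n" for s n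
      proof -
        obtain a where "freq (s @ [a])" using True fs by blast
        then show ?thesis using fs by (intro exI[of _ "s @ [a]"]) simp
      qed
    qed
    then obtain f where f: "\<And>n. freq (f n)" "\<And>n. length (f n) = n" "\<And>n. \<exists>a. f (Suc n) = f n @ [a]"
      by blast
    define X where "X m = f (Suc m) ! m" for m
    have fX: "f m = map X [0..<m]" for m
    proof (induction m)
      case 0 then show ?case using f(2)[of 0] by simp
    next
      case (Suc m)
      obtain a where a: "f (Suc m) = f m @ [a]" using f(3) by blast
      then have "X m = a" unfolding X_def by (metis f(2) nth_append_length)
      then show ?case using a Suc by simp
    qed
    have "N_eq (app G h) (app (Fel k 2 (\<lambda>m. map X [0..<m])) h')" if hh: "N_per (Suc k) h h'" for h h'
    proof -
      obtain \<beta> where \<beta>: "rd k h = Some \<circ> \<beta>" "rd k h' = Some \<circ> \<beta>" using rd_per[OF hh] by blast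
      define M where "M = length (list_decode (\<beta> 0)) + 2"
      have tot: "h \<in> N_tot (Suc k)" "h \<in> N_dom (Suc k)" "h' \<in> N_dom (Suc k)"
        using N_per_total[OF hh] per_in[OF hh] by auto
      have "\<forall>\<^sub>F j in sequentially. app (y j) h = app G h"
        by (rule N_conv_app) (use y y_in tot N.conv_const in auto)
      then obtain N where N: "\<And>j. j \<ge> N \<Longrightarrow> app (y j) h = app G h"
        by (auto simp: eventually_sequentially)
      have "infinite {n. map (x n) [0..<M] = f M}" using f(1)[of M] f(2)[of M] by (simp add: freq_def)
      then obtain j where j: "j \<ge> N" "map (x j) [0..<M] = map X [0..<M]"
        unfolding fX by (metis (mono_tags, lifting) finite_nat_set_iff_bounded_le linorder_le_cases mem_Collect_eq)
      have "hit 2 (\<lambda>m. map (x j) [0..<m]) (Some \<circ> \<beta>) = hit 2 (\<lambda>m. map X [0..<m]) (Some \<circ> \<beta>)"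
        by (rule hit_same_segment) (use j(2) in \<open>simp add: M_def del: upt_Suc\<close>)
      then have "app G h = app (Fel k 2 (\<lambda>m. map X [0..<m])) h'"
        using N[OF j(1)] yFel[OF hh, of j] \<beta> tot by (simp add: app_Fel)
      moreover have "\<exists>z. app (Fel k 2 (\<lambda>m. map X [0..<m])) h' = Some z"
        using hit_total \<beta> tot by (simp add: app_Fel)
      ultimately show ?thesis by (auto simp: N_eq_def)
    qed
    then have "N_per (Suc (Suc k)) G (Fel k 2 (\<lambda>m. map X [0..<m]))"
      by (subst per.simps) (use Fel_in y(2) in \<open>auto simp: total_def\<close>)
    then show ?thesis by (rule exI[of _ X])
  next
    case False
    then obtain s where s: "freq s" "\<And>a. \<not> freq (s @ [a])" by blast
    \<comment> \<open>Beyond this last frequent segment every next entry occurs finitely often only,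
      so next entries can be made strictly increasing along a subsequence.\<close>
    define I where "I = {n. map (x n) [0..<length s] = s}"
    have "infinite I" using s by (simp add: freq_def I_def)
    have fin: "finite {n\<in>I. x n (length s) = a}" for a
    proof -
      have "{n\<in>I. x n (length s) = a} = {n. map (x n) [0..<length (s @ [a])] = s @ [a]}"
        by (auto simp: I_def)
      then show ?thesis using s(2)[of a] by (simp add: freq_def)
    qed
    have ex: "\<exists>n\<in>I. n > N \<and> x n (length s) > b" for N b
    proof -
      have "finite ({..N} \<union> (\<Union>a\<le>b. {n\<in>I. x n (length s) = a}))" using fin by auto
      then obtain n where "n \<in> I" "n \<notin> {..N} \<union> (\<Union>a\<le>b. {n\<in>I. x n (length s) = a})"
        using \<open>infinite I\<close> by (meson finite_subset subsetI)
      then show ?thesis by (intro bexI[of _ n]) auto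
    qed
    have "\<exists>h. \<forall>j. h j \<in> I \<and> (h j < h (Suc j) \<and> x (h j) (length s) < x (h (Suc j)) (length s))"
      by (rule dependent_nat_choice) (use ex in blast)+
    then obtain h where h: "\<And>j. h j \<in> I" "\<And>j. h j < h (Suc j)"
      "\<And>j. x (h j) (length s) < x (h (Suc j)) (length s)" by blast
    define a where "a j = x (h j) (length s)" for j
    define b where "b j = x (h j) (Suc (length s))" for j
    have mono: "strict_mono h" "strict_mono a" using h(2,3) by (auto simp: strict_mono_Suc_iff a_def)
    have seg: "map (x (h j)) [0..<Suc (Suc (length s))] = s @ [a j, b j]" for j
      using h(1)[of j] by (simp add: I_def a_def b_def)
    define \<beta> where "\<beta> i = (case i of 0 \<Rightarrow> list_encode s | Suc i \<Rightarrow> prod_encode (a i, b i))" for i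
    \<comment> \<open>The pair belonging to j sits at position j + 1 of \<open>\<beta>\<close>, the
      first position replaced. The filler has a first component different from \<open>a j\<close>,
      so the pair occurs nowhere in \<open>\<beta>' j\<close>.\<close>
    define \<beta>' where "\<beta>' j i = (if i \<le> j then \<beta> i else prod_encode (Suc (a j), 0))" for i j
    have hit1: "hit 2 (\<lambda>m. map (x (h j)) [0..<m]) (Some \<circ> \<beta>) = Some 1" for j
    proof -
      \<comment> \<open>As \<open>a\<close> is strictly increasing, \<open>j \<le> a j\<close>, so
        pair number j lies within the searched range.\<close>
      have "\<exists>i\<le>a j. \<beta> (Suc i) = prod_encode (a j, b j)"
        using strict_mono_imp_increasing[OF mono(2)] by (intro exI[of _ j]) (auto simp: \<beta>_def)
      moreover have "\<beta> 0 = list_encode s" by (simp add: \<beta>_def)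
      ultimately show ?thesis using seg[of j]
        by (auto simp: hit_def nth_append Let_def a_def[symmetric] b_def[symmetric] simp del: upt_Suc)
    qed
    have hit0: "hit 2 (\<lambda>m. map (x (h j)) [0..<m]) (Some \<circ> \<beta>' j) = Some 0" for j
    proof -
      have "\<beta>' j (Suc i) \<noteq> prod_encode (a j, b j)" for i
        using strict_mono_eq[OF mono(2), of i j] by (auto simp: \<beta>'_def \<beta>_def prod_encode_eq)
      moreover have "\<beta>' j 0 = list_encode s" by (simp add: \<beta>_def \<beta>'_def)
      ultimately show ?thesis using seg[of j]
        by (auto simp: hit_def nth_append Let_def a_def[symmetric] b_def[symmetric] simp del: upt_Suc)
    qed
    have yh: "N.conv (Suc (Suc k)) (\<lambda>j. y (h j)) G"
      using y(3) filterlim_comp_conv[OF filterlim_subseq[OF mono(1)]] unfolding N.conv_def by blast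
    have tot: "emb k \<beta> \<in> N_tot (Suc k)" by (rule N_per_total(1)[OF emb_per])
    have "\<forall>\<^sub>F j in sequentially. app (y (h j)) (emb k \<beta>) = app G (emb k \<beta>)"
      by (rule N_conv_app[OF y_in y(2) yh emb_in tot]) (use N.conv_const emb_in in blast)
    moreover have "app (y (h j)) (emb k \<beta>) = Some 1" for j
      using yFel[OF emb_per] hit1 by (simp add: rd_emb)
    ultimately have "app G (emb k \<beta>) = Some 1" by (auto simp: eventually_sequentially)
    moreover have "\<forall>\<^sub>F j in sequentially. app (y (h j)) (emb k (\<beta>' j)) = app G (emb k \<beta>)"
    proof (rule N_conv_app[OF y_in y(2) yh emb_in tot emb_conv])
      show "\<forall>\<^sub>F j in sequentially. \<forall>i\<le>m. \<beta>' j i = \<beta> i" for m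
        unfolding eventually_sequentially by (intro exI[of _ m]) (auto simp: \<beta>'_def)
    qed
    moreover have "app (y (h j)) (emb k (\<beta>' j)) = Some 0" for j
      using yFel[OF emb_per] hit0 by (simp add: rd_emb)
    ultimately show ?thesis by (auto simp: eventually_sequentially)
  qed
qed

lemma Fel_neq: "\<not> N_per (Suc (Suc k)) (Fel k 1 (\<lambda>m. take m [])) (Fel k 2 (\<lambda>m. map x [0..<m]))"
proof
  assume per: "N_per (Suc (Suc k)) (Fel k 1 (\<lambda>m. take m [])) (Fel k 2 (\<lambda>m. map x [0..<m]))"
  \<comment> \<open>The empty list with the first two entries of x as the pair sought: it is found
    at once for x, whereas the empty sequence has no pair to offer.\<close>
  define \<beta> where "\<beta> i = (case i of 0 \<Rightarrow> list_encode [] | Suc i \<Rightarrow> prod_encode (x 0, x 1))" for i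
  have "N_eq (hit 1 (\<lambda>m. take m []) (Some \<circ> \<beta>)) (hit 2 (\<lambda>m. map x [0..<m]) (Some \<circ> \<beta>))"
  proof -
    have "N_eq (app (Fel k 1 (\<lambda>m. take m [])) (emb k \<beta>)) (app (Fel k 2 (\<lambda>m. map x [0..<m])) (emb k \<beta>))"
      using per emb_per[of k \<beta>] by (subst (asm) per.simps) blast
    then show ?thesis by (simp add: app_Fel emb_in rd_emb)
  qed
  moreover have "hit 2 (\<lambda>m. map x [0..<m]) (Some \<circ> \<beta>) = Some 1"
    by (auto simp: hit_def \<beta>_def numeral_2_eq_2)
  moreover have "hit 1 (\<lambda>m. take m []) (Some \<circ> \<beta>) = Some 0"
    by (auto simp: hit_def \<beta>_def)
  ultimately show False by (auto simp: N_eq_def)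
qed

theorem not_zero_dimensional_Ct_N: "\<not> zero_dimensional (Ct_N (Suc (Suc k)))"
proof
  let ?K = "Suc (Suc k)"
  let ?S = "\<lambda>s::nat list. \<lambda>m. take m s" and ?X = "\<lambda>x::nat\<Rightarrow>nat. \<lambda>m. map x [0..<m]"
  define q where "q = (\<lambda>x. {y. N_per ?K x y})"
  let ?TS = "total_space N_le N_eq N_dom ?K"
  assume zd: "zero_dimensional (Ct_N ?K)"
  have Ct: "Ct_N ?K = quotient_topology ?TS q" by (simp add: Ct_N_def q_def)
  have qeq: "q x = q y" if "N_per ?K x y" for x y
    unfolding q_def using N_per_trans N_per_sym that by blast
  have pre: "openin ?TS {x\<in>N_tot ?K. q x \<in> U}" if "openin (Ct_N ?K) U" for U
    using that unfolding Ct openin_quotient_topology N.topspace_total_space by blast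
  define A where "A = {G\<in>N_tot ?K. \<exists>x. N_per ?K G (Fel k 2 (?X x))}"
  have "openin ?TS (N_tot ?K - A)"
    unfolding N.openin_total_space_iff
  proof (intro conjI ballI)
    fix G assume G: "G \<in> N_tot ?K - A"
    show "\<exists>n. \<forall>y\<in>N_tot ?K. N.leX (N.\<pi> ?K n G) y \<longrightarrow> y \<in> N_tot ?K - A"
    proof (rule ccontr)
      assume "\<not> ?thesis"
      then have "\<forall>n. \<exists>y. y \<in> A \<and> N.leX (N.\<pi> ?K n G) y" by blast
      then obtain y where y: "\<And>n. y n \<in> A" "\<And>n. N.leX (N.\<pi> ?K n G) (y n)" by metis
      then have "\<forall>n. \<exists>x. N_per ?K (y n) (Fel k 2 (?X x))" by (auto simp: A_def)
      then obtain x where x: "\<And>n. N_per ?K (y n) (Fel k 2 (?X (x n)))" by metis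
      have in': "G \<in> N_dom ?K" "y n \<in> N_dom ?K" for n using G y(1)[of n] by (auto simp: A_def total_def)
      have "N.conv ?K y G" by (rule N.conv_above[OF in' y(2)])
      then have "\<exists>x. N_per ?K G (Fel k 2 (?X x))"
        using Fel_closed[of y k G x] y G x by (auto simp: A_def simp del: per.simps)
      then show False using G by (auto simp: A_def)
    qed
  qed auto
  define U where "U = q ` (N_tot ?K - A)"
  \<comment> \<open>\<open>A\<close> is saturated under equivalence, so its open complement is the
    preimage of an open set of the quotient.\<close>
  have "x \<in> A" if "x \<in> N_tot ?K" "y \<in> A" "q x = q y" for x y
  proof -
    have "N_per ?K x y" using that unfolding q_def A_def total_def by (auto simp del: per.simps)
    then show ?thesis using that N_per_trans unfolding A_def by blast
  qed
  then have U': "{x\<in>N_tot ?K. q x \<in> U} = N_tot ?K - A" unfolding U_def by blast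
  have "openin (Ct_N ?K) U"
    unfolding Ct openin_quotient_topology using U' \<open>openin ?TS (N_tot ?K - A)\<close> by (auto simp: U_def)
  moreover have "q (Fel k 1 (?S [])) \<in> U"
    unfolding U_def A_def using Fel_total Fel_neq by blast
  moreover obtain \<B> where \<B>: "\<And>C. C \<in> \<B> \<Longrightarrow> openin (Ct_N ?K) C \<and> closedin (Ct_N ?K) C"
    "openin (Ct_N ?K) = (arbitrary union_of (\<lambda>U. U \<in> \<B>))"
    using zd unfolding zero_dimensional_def by blast
  ultimately obtain C where C: "q (Fel k 1 (?S [])) \<in> C" "C \<subseteq> U" "C \<in> \<B>"
    unfolding \<B>(2) arbitrary_union_of_alt by blast
  define V where "V = {x\<in>N_tot ?K. q x \<in> C}"
  have Vo: "openin ?TS V" using pre \<B>(1)[OF C(3)] by (simp add: V_def)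
  have Vc: "openin ?TS (N_tot ?K - V)"
  proof -
    have "N_tot ?K - V = {x\<in>N_tot ?K. q x \<in> topspace (Ct_N ?K) - C}" by (auto simp: V_def Ct)
    moreover have "openin (Ct_N ?K) (topspace (Ct_N ?K) - C)"
      using \<B>(1)[OF C(3)] by (simp add: closedin_def)
    ultimately show ?thesis using pre by metis
  qed
  have flag: "Fel k 1 (?S s) \<in> V \<longleftrightarrow> Fel k 2 (?S s) \<in> V" for s
    using qeq[OF Fel_per[OF hit_total_flag]] Fel_total by (auto simp: V_def)
  have step: "\<exists>a. Fel k 1 (?S (s @ [a])) \<in> V" if s: "Fel k 1 (?S s) \<in> V" for s
  proof -
    obtain n where n: "\<And>y. y \<in> N_tot ?K \<Longrightarrow> N.leX (N.\<pi> ?K n (Fel k 1 (?S s))) y \<Longrightarrow> y \<in> V"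
      using Vo s unfolding N.openin_total_space_iff by blast
    \<comment> \<open>The new entry has to exceed the index n of a projection that already forces
      membership in V; \<open>Suc n\<close> does.\<close>
    have "Fel k 2 (?S (s @ [Suc n])) \<in> V"
      by (rule n[OF Fel_total Fel_append]) simp
    then show ?thesis using flag by blast
  qed
  have "Fel k 1 (?S []) \<in> V" using C(1) Fel_total by (auto simp: V_def)
  then have "\<exists>f. \<forall>n. (Fel k 1 (?S (f n)) \<in> V \<and> length (f n) = n) \<and> (\<exists>a. f (Suc n) = f n @ [a])"
    by (intro dependent_nat_choice) (use step in fastforce)+
  then obtain f where f: "\<And>n. Fel k 1 (?S (f n)) \<in> V" "\<And>n. length (f n) = n" "\<And>n. \<exists>a. f (Suc n) = f n @ [a]"
    by blast
  define x where "x m = f (Suc m) ! m" for m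
  have fx: "f m = map x [0..<m]" for m
  proof (induction m)
    case 0 then show ?case using f(2)[of 0] by simp
  next
    case (Suc m)
    obtain a where a: "f (Suc m) = f m @ [a]" using f(3) by blast
    then have "x m = a" unfolding x_def by (metis f(2) nth_append_length)
    then show ?case using a Suc by simp
  qed
  have "Fel k 2 (?X x) \<in> V"
  proof (rule ccontr)
    assume "\<not> ?thesis"
    then have "Fel k 2 (?X x) \<in> N_tot ?K - V" using Fel_total by auto
    then obtain n where n: "\<And>y. y \<in> N_tot ?K \<Longrightarrow> N.leX (N.\<pi> ?K n (Fel k 2 (?X x))) y \<Longrightarrow> y \<in> N_tot ?K - V"
      using Vc unfolding N.openin_total_space_iff by blast
    obtain K where "N.leX (N.\<pi> ?K n (Fel k 2 (?X x))) (Fel k 2 (?S (map x [0..<K])))"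
      using Fel_limit by blast
    then have "Fel k 2 (?S (f K)) \<notin> V" using n[OF Fel_total] unfolding fx by blast
    then show False using f(1) flag by blast
  qed
  then have "q (Fel k 2 (?X x)) \<in> U" using C(2) by (auto simp: V_def)
  then have "Fel k 2 (?X x) \<in> N_tot ?K - A" using U' Fel_total by blast
  moreover have "N_per ?K (Fel k 2 (?X x)) (Fel k 2 (?X x))" by (rule Fel_per) simp
  ultimately show False using Fel_total unfolding A_def by blast
qed

section \<open>Continuous selections\<close>

text \<open>Values are chosen at the grid points. Inside a cell the set J t contains the sets at
  both endpoints, so by convexity linear interpolation never leaves it.\<close>

lemma interpolate:
  fixes J :: "real \<Rightarrow> real set" and N :: real
  assumes N: "N > 0" and conv: "\<And>t. convex (J t)"
    and ne: "\<And>i::int. J (of_int i / N) \<noteq> {}"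
    and sub: "\<And>(i::int) t. of_int i / N < t \<Longrightarrow> t < (of_int i + 1) / N \<Longrightarrow>
       J (of_int i / N) \<subseteq> J t \<and> J ((of_int i + 1) / N) \<subseteq> J t"
  obtains f :: "real \<Rightarrow> real" where "continuous_on UNIV f" "\<And>t. f t \<in> J t"
proof -
  define g where "g i = (SOME x. x \<in> J (of_int i / N))" for i :: int
  have g: "g i \<in> J (of_int i / N)" for i unfolding g_def using ne by (simp add: some_in_eq)
  define h where "h s = (1 - (s - of_int \<lfloor>s\<rfloor>)) * g \<lfloor>s\<rfloor> + (s - of_int \<lfloor>s\<rfloor>) * g (\<lfloor>s\<rfloor> + 1)" for s :: real
  have "isCont h s0" for s0
  proof -
    define k where "k = \<lfloor>s0\<rfloor>"
    \<comment> \<open>A single formula for h on both cells adjacent to k, visibly continuous because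
      each piece is switched off by a maximum with 0.\<close>
    define h' where "h' s = g k + max 0 (s - of_int k) * (g (k + 1) - g k)
      + max 0 (of_int k - s) * (g (k - 1) - g k)" for s :: real
    have "h s = h' s" if "s \<in> {of_int k - 1 <..< of_int k + 1}" for s
    proof (cases "s \<ge> of_int k")
      case True
      then have "\<lfloor>s\<rfloor> = k" using that by (intro floor_unique) auto
      then show ?thesis using True by (simp add: h_def h'_def algebra_simps)
    next
      case False
      then have fl: "\<lfloor>s\<rfloor> = k - 1" using that by (intro floor_unique) auto
      show ?thesis using False unfolding h_def h'_def fl by (simp add: algebra_simps)
    qed
    then have "\<forall>\<^sub>F s in nhds s0. h s = h' s"
      by (intro eventually_nhds_in_open[THEN eventually_mono, of "{of_int k - 1 <..< of_int k + 1}"])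
        (auto simp: k_def, linarith)
    moreover have "isCont h' s0" unfolding h'_def by (intro continuous_intros)
    ultimately show ?thesis using isCont_cong by metis
  qed
  then have "continuous_on UNIV h" by (simp add: continuous_on_eq_continuous_at)
  then have "continuous_on UNIV (\<lambda>t. h (N * t))"
    by (rule continuous_on_compose2) (auto intro: continuous_intros)
  moreover have "h (N * t) \<in> J t" for t
  proof -
    define i where "i = \<lfloor>N * t\<rfloor>"
    define w where "w = N * t - of_int i"
    have w: "0 \<le> w" "w < 1" unfolding w_def i_def by linarith+
    show ?thesis
    proof (cases "w = 0")
      case True
      then have "t = of_int i / N" using N by (simp add: w_def field_simps)
      then show ?thesis using True g[of i] by (simp add: h_def i_def[symmetric] w_def)
    next
      case False
      then have "of_int i / N < t" "t < (of_int i + 1) / N"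
        using N w by (auto simp: w_def field_simps)
      then have "g i \<in> J t" "g (i + 1) \<in> J t" using sub g[of i] g[of "i + 1"] by auto
      then have "(1 - w) *\<^sub>R g i + w *\<^sub>R g (i + 1) \<in> J t"
        using conv[of t] w by (intro convexD_alt) auto
      then show ?thesis by (simp add: h_def i_def w_def)
    qed
  qed
  ultimately show thesis using that by blast
qed

section \<open>The extensional hierarchy\<close>

lemma E_basis_UNIV [simp]: "UNIV \<in> E_basis"
  by (simp add: E_basis_def)

lemma E_basis_Icc: "p \<in> \<rat> \<Longrightarrow> q \<in> \<rat> \<Longrightarrow> p \<le> q \<Longrightarrow> {p..q} \<in> E_basis"
  by (auto simp: E_basis_def)

lemma E_basis_Int:
  assumes "I \<in> E_basis" "J \<in> E_basis" "I \<inter> J \<noteq> {}" shows "I \<inter> J \<in> E_basis"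
proof (cases "I = UNIV \<or> J = UNIV")
  case True then show ?thesis using assms by auto
next
  case False
  then obtain p q p' q' where "I = {p..q}" "J = {p'..q'}" "p \<in> \<rat>" "q \<in> \<rat>" "p' \<in> \<rat>" "q' \<in> \<rat>"
    using assms by (auto simp: E_basis_def)
  moreover from this have "max p p' \<in> \<rat>" "min q q' \<in> \<rat>" by (auto simp: max_def min_def)
  ultimately show ?thesis using assms(3) E_basis_Icc[of "max p p'" "min q q'"]
    by (auto simp: Int_atLeastAtMost)
qed

lemma E_basis_nonempty: "I \<in> E_basis \<Longrightarrow> I \<noteq> {}"
  by (auto simp: E_basis_def)

lemma E_basis_convex: "I \<in> E_basis \<Longrightarrow> convex I"
  by (auto simp: E_basis_def)

lemma E_basis_nbhd:
  fixes x e :: real assumes "e > 0"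
  obtains J where "J \<in> E_basis" "x \<in> interior J" "J \<subseteq> {x - e <..< x + e}"
proof -
  obtain p q where "p \<in> \<rat>" "q \<in> \<rat>" "x - e < p" "p < x" "x < q" "q < x + e"
    using Rats_dense_in_real[of "x - e" x] Rats_dense_in_real[of x "x + e"] assms by auto
  moreover from this have "{p..q} \<in> E_basis" by (intro E_basis_Icc) auto
  ultimately show thesis by (intro that[of "{p..q}"]) auto
qed

text \<open>Factorial denominators make the grids increase with n and exhaust the rationals; the
  bound n on the endpoints keeps each grid finite.\<close>

definition E_grid :: "nat \<Rightarrow> real set set" where
  "E_grid n = insert UNIV {{of_int i / fact n .. of_int j / fact n} | i j :: int.
     i \<le> j \<and> \<bar>i\<bar> \<le> int n * fact n \<and> \<bar>j\<bar> \<le> int n * fact n}"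

lemma E_grid_UNIV [simp]: "UNIV \<in> E_grid n"
  by (simp add: E_grid_def)

lemma finite_E_grid: "finite (E_grid n)"
proof -
  let ?K = "int n * fact n"
  have "E_grid n \<subseteq> insert UNIV ((\<lambda>(i, j). {of_int i / fact n .. of_int j / fact n}) ` ({-?K..?K} \<times> {-?K..?K}))"
    by (force simp: E_grid_def)
  then show ?thesis by (rule finite_subset) auto
qed

lemma E_grid_basis: "E_grid n \<subseteq> E_basis"
proof -
  have "real_of_int i / fact n \<in> \<rat>" for i
    by (metis Rats_divide Rats_of_int Rats_of_nat of_nat_fact)
  then show ?thesis unfolding E_grid_def by (auto intro!: E_basis_Icc divide_right_mono)
qed

lemma E_grid_Int: "I \<in> E_grid n \<Longrightarrow> J \<in> E_grid n \<Longrightarrow> I \<inter> J \<noteq> {} \<Longrightarrow> I \<inter> J \<in> E_grid n"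
proof -
  assume I: "I \<in> E_grid n" and J: "J \<in> E_grid n" and ne: "I \<inter> J \<noteq> {}"
  show ?thesis
  proof (cases "I = UNIV \<or> J = UNIV")
    case True then show ?thesis using I J by auto
  next
    case False
    obtain i j where ij: "I = {of_int i / fact n .. of_int j / fact n}"
      "\<bar>i\<bar> \<le> int n * fact n" "\<bar>j\<bar> \<le> int n * fact n"
      using I False unfolding E_grid_def by auto
    obtain k l where kl: "J = {of_int k / fact n .. of_int l / fact n}"
      "\<bar>k\<bar> \<le> int n * fact n" "\<bar>l\<bar> \<le> int n * fact n"
      using J False unfolding E_grid_def by auto
    have IJ: "I \<inter> J = {of_int (max i k) / fact n .. of_int (min j l) / fact n}"
      unfolding ij kl Int_atLeastAtMost
      by (auto simp: max_def min_def divide_le_cancel)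
    then have "real_of_int (max i k) / fact n \<le> of_int (min j l) / fact n" using ne by auto
    then have "max i k \<le> min j l" by (simp add: divide_le_cancel)
    then show ?thesis unfolding IJ E_grid_def
      by (intro insertI2 CollectI exI[of _ "max i k"] exI[of _ "min j l"]) (use ij kl in auto)
  qed
qed

lemma E_grid_mono: assumes "m \<le> n" shows "E_grid m \<subseteq> E_grid n"
proof
  fix I assume I: "I \<in> E_grid m"
  show "I \<in> E_grid n"
  proof (cases "I = UNIV")
    case False
    then obtain i j where ij: "I = {of_int i / fact m .. of_int j / fact m}" "i \<le> j"
      "\<bar>i\<bar> \<le> int m * fact m" "\<bar>j\<bar> \<le> int m * fact m"
      using I unfolding E_grid_def by auto
    obtain c :: nat where c: "fact n = fact m * c" using fact_dvd[OF assms] by (auto simp: dvd_def)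
    have cr: "(fact n :: real) = fact m * real c" "(fact n :: int) = fact m * int c"
      using c by (metis of_nat_fact of_nat_mult)+
    have c0: "c > 0" using c by (metis fact_nonzero gr0I mult_0_right)
    have "\<bar>i * int c\<bar> \<le> int n * fact n" if "\<bar>i\<bar> \<le> int m * fact m" for i
    proof -
      have "\<bar>i * int c\<bar> \<le> int m * fact m * int c"
        using that by (simp add: abs_mult mult_right_mono)
      also have "\<dots> = int m * fact n" by (simp add: cr)
      also have "\<dots> \<le> int n * fact n" using assms by (simp add: mult_right_mono)
      finally show ?thesis .
    qed
    moreover have "I = {of_int (i * int c) / fact n .. of_int (j * int c) / fact n}"
      unfolding ij cr using c0 by simp
    moreover have "i * int c \<le> j * int c" using ij by (simp add: mult_right_mono)
    ultimately show ?thesis unfolding E_grid_def using ij by blast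
  qed auto
qed

lemma rat_grid:
  fixes x :: real
  assumes "x \<in> \<rat>"
  obtains m where "\<And>n. n \<ge> m \<Longrightarrow> \<exists>i::int. x = of_int i / fact n \<and> \<bar>i\<bar> \<le> int n * fact n"
proof -
  obtain a :: int and b :: nat where ab: "b > 0" "x = of_int a / of_nat b"
    using assms by (metis Rats_cases' of_nat_0_less_iff of_int_of_nat_eq zero_less_imp_eq_int)
  obtain m :: nat where m: "\<bar>x\<bar> \<le> real m" using real_arch_simple by blast
  have "\<exists>i::int. x = of_int i / fact n \<and> \<bar>i\<bar> \<le> int n * fact n" if n: "n \<ge> max b m" for n
  proof -
    have "b dvd fact n" using n ab by (intro dvd_fact) auto
    then obtain c where c: "fact n = b * c" by (auto simp: dvd_def)
    then have cr: "(fact n :: real) = real b * real c" by (metis of_nat_fact of_nat_mult)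
    have "c \<noteq> 0" using c by (metis fact_nonzero mult_0_right)
    then have x: "x = of_int (a * int c) / fact n"
      using ab by (simp add: cr) 
    have "\<bar>of_int (a * int c)\<bar> = \<bar>x\<bar> * (fact n :: real)" using x by (simp add: abs_mult)
    also have "\<dots> \<le> real n * fact n" using m n by (intro mult_right_mono) auto
    finally have "real_of_int \<bar>a * int c\<bar> \<le> real_of_int (int n * fact n)" by simp
    then have "\<bar>a * int c\<bar> \<le> int n * fact n" by linarith
    then show ?thesis using x by blast
  qed
  then show thesis using that by blast
qed

lemma E_basis_grid: assumes "I \<in> E_basis" shows "\<exists>n. I \<in> E_grid n"
proof (cases "I = UNIV")
  case False
  then obtain p q where pq: "I = {p..q}" "p \<in> \<rat>" "q \<in> \<rat>" "p \<le> q"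
    using assms by (auto simp: E_basis_def)
  obtain m where m: "\<And>n. n \<ge> m \<Longrightarrow> \<exists>i::int. p = of_int i / fact n \<and> \<bar>i\<bar> \<le> int n * fact n"
    using rat_grid[OF pq(2)] by blast
  obtain k where k: "\<And>n. n \<ge> k \<Longrightarrow> \<exists>i::int. q = of_int i / fact n \<and> \<bar>i\<bar> \<le> int n * fact n"
    using rat_grid[OF pq(3)] by blast
  obtain i j where ij: "p = of_int i / fact (max m k)" "\<bar>i\<bar> \<le> int (max m k) * fact (max m k)"
     "q = of_int j / fact (max m k)" "\<bar>j\<bar> \<le> int (max m k) * fact (max m k)"
    using m[of "max m k"] k[of "max m k"] by auto
  have "i \<le> j" using pq(4) unfolding ij by (simp add: divide_le_cancel)
  then have "I \<in> E_grid (max m k)" unfolding E_grid_def pq(1) using ij by blast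
  then show ?thesis ..
qed auto

definition E_pr :: "nat \<Rightarrow> real set set \<Rightarrow> real set set" where
  "E_pr n \<alpha> = {J\<in>E_basis. \<exists>I\<in>\<alpha> \<inter> E_grid n. I \<subseteq> J}"

lemma E_idealI:
  assumes "\<alpha> \<subseteq> E_basis" "UNIV \<in> \<alpha>" "\<And>I J. I \<in> \<alpha> \<Longrightarrow> J \<in> E_basis \<Longrightarrow> I \<subseteq> J \<Longrightarrow> J \<in> \<alpha>"
    "\<And>I J. I \<in> \<alpha> \<Longrightarrow> J \<in> \<alpha> \<Longrightarrow> I \<inter> J \<in> \<alpha>"
  shows "\<alpha> \<in> E_ideals"
proof -
  have "\<exists>K\<in>\<alpha>. K \<subseteq> I \<and> K \<subseteq> J" if "I \<in> \<alpha>" "J \<in> \<alpha>" for I J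
    using assms(4)[OF that] by (meson inf_le1 inf_le2)
  moreover have "\<alpha> \<noteq> {}" using assms(2) by auto
  ultimately show ?thesis using assms(1,3) unfolding E_ideals_def by simp
qed

lemma E_idealD:
  assumes "\<alpha> \<in> E_ideals"
  shows "\<alpha> \<subseteq> E_basis" "UNIV \<in> \<alpha>" "\<And>I J. I \<in> \<alpha> \<Longrightarrow> J \<in> E_basis \<Longrightarrow> I \<subseteq> J \<Longrightarrow> J \<in> \<alpha>"
    "\<And>I J. I \<in> \<alpha> \<Longrightarrow> J \<in> \<alpha> \<Longrightarrow> I \<inter> J \<in> \<alpha>"
proof -
  have id: "\<alpha> \<subseteq> E_basis" "\<alpha> \<noteq> {}" "\<forall>I\<in>\<alpha>. \<forall>J\<in>E_basis. I \<subseteq> J \<longrightarrow> J \<in> \<alpha>"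
    "\<forall>I\<in>\<alpha>. \<forall>J\<in>\<alpha>. \<exists>K\<in>\<alpha>. K \<subseteq> I \<and> K \<subseteq> J"
    using assms by (simp_all add: E_ideals_def)
  show sub: "\<alpha> \<subseteq> E_basis" by fact
  show up: "J \<in> \<alpha>" if "I \<in> \<alpha>" "J \<in> E_basis" "I \<subseteq> J" for I J using id(3) that by simp
  show "UNIV \<in> \<alpha>" using id(2) up[of _ UNIV] by auto
  fix I J assume IJ: "I \<in> \<alpha>" "J \<in> \<alpha>"
  obtain K where K: "K \<in> \<alpha>" "K \<subseteq> I \<inter> J" using id(4) IJ by (metis Int_greatest)
  then have "I \<inter> J \<noteq> {}" using sub E_basis_nonempty by blast
  then have "I \<inter> J \<in> E_basis" using E_basis_Int IJ sub by blast
  then show "I \<inter> J \<in> \<alpha>" using up[OF K(1) _ K(2)] by simp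
qed

lemma E_pr_ideal: assumes "\<alpha> \<in> E_ideals" shows "E_pr n \<alpha> \<in> E_ideals"
proof (rule E_idealI)
  show "UNIV \<in> E_pr n \<alpha>" using E_idealD(2)[OF assms] by (auto simp: E_pr_def)
  fix I J assume "I \<in> E_pr n \<alpha>" "J \<in> E_pr n \<alpha>"
  then obtain K M where K: "K \<in> \<alpha> \<inter> E_grid n" "K \<subseteq> I" "M \<in> \<alpha> \<inter> E_grid n" "M \<subseteq> J" "I \<in> E_basis" "J \<in> E_basis"
    by (auto simp: E_pr_def)
  have KM: "K \<inter> M \<in> \<alpha>" using E_idealD(4)[OF assms] K by auto
  then have ne: "K \<inter> M \<noteq> {}" using E_idealD(1)[OF assms] E_basis_nonempty by blast
  then have "I \<inter> J \<noteq> {}" using K by blast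
  then have "I \<inter> J \<in> E_basis" using K E_basis_Int by blast
  moreover have "K \<inter> M \<in> \<alpha> \<inter> E_grid n" using KM E_grid_Int[OF _ _ ne] K by auto
  ultimately show "I \<inter> J \<in> E_pr n \<alpha>" using K unfolding E_pr_def by blast
qed (auto simp: E_pr_def)

lemma E_pr_le: "\<alpha> \<in> E_ideals \<Longrightarrow> E_pr n \<alpha> \<subseteq> \<alpha>"
  using E_idealD(3) unfolding E_pr_def by blast

lemma E_pr_grid: "I \<in> \<alpha> \<Longrightarrow> I \<in> E_grid n \<Longrightarrow> I \<in> E_pr n \<alpha>"
  using E_grid_basis by (auto simp: E_pr_def)

lemma E_pr_subsetI:
  assumes "\<beta> \<in> E_ideals" "\<alpha> \<inter> E_grid n \<subseteq> \<beta>" shows "E_pr n \<alpha> \<subseteq> \<beta>"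
  using E_idealD(3)[OF assms(1)] assms(2) unfolding E_pr_def by blast

lemma E_directed_Union:
  assumes "directed_in (\<subseteq>) E_ideals D" shows "\<Union>D \<in> E_ideals" "lub_in (\<subseteq>) E_ideals D (\<Union>D)"
proof -
  have D: "D \<subseteq> E_ideals" "D \<noteq> {}" using assms by (auto simp: directed_in_def)
  show "\<Union>D \<in> E_ideals"
  proof (rule E_idealI)
    show "\<Union>D \<subseteq> E_basis" "UNIV \<in> \<Union>D" using D E_idealD(1,2) by blast+
    show "J \<in> \<Union>D" if "I \<in> \<Union>D" "J \<in> E_basis" "I \<subseteq> J" for I J
      using that D E_idealD(3) by blast
    fix I J assume "I \<in> \<Union>D" "J \<in> \<Union>D"
    then obtain \<alpha> \<beta> \<gamma> where "I \<in> \<alpha>" "J \<in> \<beta>" "\<gamma> \<in> D" "\<alpha> \<subseteq> \<gamma>" "\<beta> \<subseteq> \<gamma>"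
      using assms unfolding directed_in_def by blast
    then show "I \<inter> J \<in> \<Union>D" using D E_idealD(4)[of \<gamma> I J] by blast
  qed
  then show "lub_in (\<subseteq>) E_ideals D (\<Union>D)" by (auto simp: lub_in_def)
qed

lemma pdom_E: "pdom E_ideals (\<subseteq>) E_pr"
proof
  have "E_basis \<inter> {UNIV} \<in> E_ideals" by (rule E_idealI) auto
  then show "E_ideals \<noteq> {}" by auto
  show "E_pr n x \<in> E_ideals" "E_pr n x \<subseteq> x" if "x \<in> E_ideals" for x n
    using that by (auto intro: E_pr_ideal dest: E_pr_le)
  show "E_pr n (E_pr n x) = E_pr n x" if "x \<in> E_ideals" for x n
    using E_pr_le[OF E_pr_ideal[OF that]] E_pr_subsetI[OF E_pr_ideal[OF E_pr_ideal[OF that]], of x n n n]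
      E_pr_grid by blast
  show "E_pr m x \<subseteq> E_pr n x" if "m \<le> n" for x m n
    using E_grid_mono[OF that] unfolding E_pr_def by blast
  show "finite (E_pr n ` E_ideals)" for n
  proof -
    have "E_pr n \<alpha> \<in> (\<lambda>A. {J\<in>E_basis. \<exists>I\<in>A. I \<subseteq> J}) ` Pow (E_grid n)" for \<alpha>
      unfolding E_pr_def by (rule image_eqI[of _ _ "\<alpha> \<inter> E_grid n"]) auto
    then have "E_pr n ` E_ideals \<subseteq> (\<lambda>A. {J\<in>E_basis. \<exists>I\<in>A. I \<subseteq> J}) ` Pow (E_grid n)" by auto
    then show ?thesis by (rule finite_subset) (use finite_E_grid in auto)
  qed
  show "x \<subseteq> u" if xu: "x \<in> E_ideals" "\<And>n. E_pr n x \<subseteq> u" for x u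
  proof
    fix I assume I: "I \<in> x"
    then obtain n where "I \<in> E_grid n" using E_basis_grid E_idealD(1)[OF xu(1)] by blast
    then show "I \<in> u" using xu(2)[of n] E_pr_grid[OF I] by blast
  qed
  show "\<exists>s. lub_in (\<subseteq>) E_ideals D s" if "directed_in (\<subseteq>) E_ideals D" for D
    using E_directed_Union(2)[OF that] ..
  show "\<exists>d\<in>D. E_pr n s \<subseteq> d" if D: "directed_in (\<subseteq>) E_ideals D" and s: "lub_in (\<subseteq>) E_ideals D s" for D s n
  proof -
    have "\<forall>u\<in>E_ideals. (\<forall>x\<in>D. x \<subseteq> u) \<longrightarrow> s \<subseteq> u" using s by (simp add: lub_in_def)
    then have sD: "s \<subseteq> \<Union>D" using E_directed_Union(1)[OF D] by (metis Union_upper)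
    have dir: "\<exists>z\<in>D. x \<subseteq> z \<and> y \<subseteq> z" if "x \<in> D" "y \<in> D" for x y
      using D that by (simp add: directed_in_def)
    have "\<exists>d\<in>D. G \<subseteq> d" if "finite G" "G \<subseteq> s" for G
      using that
    proof (induction G rule: finite_induct)
      case empty then show ?case using D by (auto simp: directed_in_def)
    next
      case (insert I G)
      obtain d where d: "d \<in> D" "G \<subseteq> d" using insert.IH insert.prems by auto
      obtain e where e: "e \<in> D" "I \<in> e" using insert.prems sD by auto
      obtain f where f: "f \<in> D" "d \<subseteq> f" "e \<subseteq> f" using dir[OF d(1) e(1)] by (elim bexE conjE)
      have "insert I G \<subseteq> f" using d(2) e(2) f(2,3) by (meson insert_subset subset_trans subsetD)
      then show ?case using f(1) by (rule bexI)
    qed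
    then obtain d where d: "d \<in> D" "s \<inter> E_grid n \<subseteq> d" using finite_E_grid by (meson finite_Int inf_le1)
    then have "E_pr n s \<subseteq> d" using D by (intro E_pr_subsetI) (auto simp: directed_in_def)
    then show ?thesis using d by blast
  qed
qed (auto simp: E_pr_def)

lemma E_val_eq: "\<Inter>\<alpha> = {x} \<Longrightarrow> E_val \<alpha> = x"
  by (auto simp: E_val_def)

lemma E_eq_self: "E_eq \<alpha> \<alpha> \<longleftrightarrow> \<Inter>\<alpha> = {E_val \<alpha>}"
  using E_val_eq by (auto simp: E_eq_def)

lemma E_eq_iff: "E_eq \<alpha> \<beta> \<longleftrightarrow> E_eq \<alpha> \<alpha> \<and> E_eq \<beta> \<beta> \<and> E_val \<alpha> = E_val \<beta>"
  using E_val_eq by (auto simp: E_eq_def)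

lemma E_small:
  assumes "\<alpha> \<in> E_ideals" "\<Inter>\<alpha> = {x}" "e > 0"
  obtains I where "I \<in> \<alpha>" "I \<subseteq> {x - e <..< x + e}"
proof -
  \<comment> \<open>One member of the ideal omits x - e and another omits x + e. Their intersection
    is an interval around x that omits both.\<close>
  have "x - e \<notin> \<Inter>\<alpha>" "x + e \<notin> \<Inter>\<alpha>" using assms by auto
  then obtain I J where IJ: "I \<in> \<alpha>" "x - e \<notin> I" "J \<in> \<alpha>" "x + e \<notin> J" by auto
  let ?K = "I \<inter> J"
  have K: "?K \<in> \<alpha>" using E_idealD(4) assms IJ by blast
  then have "x \<in> ?K" using assms(2) by blast
  have "is_interval ?K"
    using K E_idealD(1)[OF assms(1)] E_basis_convex is_interval_convex_1 by blast
  then have "?K \<subseteq> {x - e <..< x + e}"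
    using \<open>x \<in> ?K\<close> IJ assms(3) unfolding is_interval_1
    by (smt (verit, best) Int_iff greaterThanLessThan_iff subsetI)
  then show thesis using that K by blast
qed

lemma E_totalI:
  fixes x :: real
  assumes "\<And>I. I \<in> \<alpha> \<Longrightarrow> x \<in> I" "\<And>e. e > 0 \<Longrightarrow> \<exists>I\<in>\<alpha>. I \<subseteq> {x - e <..< x + e}"
  shows "\<Inter>\<alpha> = {x}"
proof -
  have "y = x" if y: "y \<in> \<Inter>\<alpha>" for y
  proof (rule ccontr)
    assume "y \<noteq> x"
    then obtain I where "I \<in> \<alpha>" "I \<subseteq> {x - \<bar>y - x\<bar> <..< x + \<bar>y - x\<bar>}"
      using assms(2)[of "\<bar>y - x\<bar>"] by auto
    then show False using y by (auto simp: abs_if split: if_splits)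
  qed
  then show ?thesis using assms(1) by blast
qed

interpretation E: thier E_ideals "(\<subseteq>)" E_pr "\<lambda>_ _. True" E_dom E_eq E_val
proof (intro thier.intro hier.intro hier_axioms.intro thier_axioms.intro pdom_E E_eq_iff)
  show "(\<lambda>i. E_val (b i)) \<longlonglongrightarrow> E_val a"
    if a: "a \<in> E_ideals" "E_eq a a" and b: "\<And>i. b i \<in> E_ideals" "\<And>i. E_eq (b i) (b i)"
      and c: "\<And>n. \<forall>\<^sub>F i in sequentially. E_pr n a \<subseteq> b i" for a and b :: "nat \<Rightarrow> _"
  proof (rule tendstoI)
    fix e :: real assume "e > 0"
    then obtain I where I: "I \<in> a" "I \<subseteq> {E_val a - e <..< E_val a + e}"
      using E_small a E_eq_self by blast
    obtain n where "I \<in> E_grid n" using E_basis_grid I E_idealD(1)[OF a(1)] by blast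
    then have n: "I \<in> E_pr n a" using E_pr_grid I by blast
    show "\<forall>\<^sub>F i in sequentially. dist (E_val (b i)) (E_val a) < e"
      using c[of n]
    proof eventually_elim
      case (elim i)
      then have "E_val (b i) \<in> I" using b(2)[of i] n unfolding E_eq_self by blast
      then show ?case using I(2) by (auto simp: dist_real_def abs_if)
    qed
  qed
  show "\<exists>b\<in>E_ideals. True" using pdom.nonempty[OF pdom_E] by auto
qed (auto simp: E_dom_def dom_hier_Suc simp del: dom_hier.simps(2))

section \<open>Admissibility in the extensional hierarchy\<close>

lemma E_adm_0: "E.adm 0"
proof (rule E.adm_0)
  fix t :: "nat \<Rightarrow> real" and t0 assume t: "t \<longlonglongrightarrow> t0"
  \<comment> \<open>Requiring x in the interior makes membership of an interval an open condition on
    x, so convergent reals get convergent ideals, even when the limit is an endpoint of a basic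
    interval.\<close>
  define \<alpha> where "\<alpha> x = {J\<in>E_basis. x \<in> interior J}" for x :: real
  have id: "\<alpha> x \<in> E_ideals" for x
  proof (rule E_idealI)
    show "J \<in> \<alpha> x" if "I \<in> \<alpha> x" "J \<in> E_basis" "I \<subseteq> J" for I J
      using that interior_mono unfolding \<alpha>_def by blast
    show "I \<inter> J \<in> \<alpha> x" if "I \<in> \<alpha> x" "J \<in> \<alpha> x" for I J
    proof -
      have "x \<in> interior (I \<inter> J)" using that by (auto simp: \<alpha>_def)
      then have "I \<inter> J \<noteq> {}" using interior_subset by blast
      then show ?thesis using that \<open>x \<in> interior (I \<inter> J)\<close> E_basis_Int by (auto simp: \<alpha>_def)
    qed
  qed (auto simp: \<alpha>_def)
  have tot: "\<Inter>(\<alpha> x) = {x}" for x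
  proof (rule E_totalI)
    show "x \<in> I" if "I \<in> \<alpha> x" for I using that interior_subset by (auto simp: \<alpha>_def)
    fix e :: real assume "e > 0"
    then obtain J where "J \<in> E_basis" "x \<in> interior J" "J \<subseteq> {x - e <..< x + e}"
      using E_basis_nbhd by metis
    then show "\<exists>I\<in>\<alpha> x. I \<subseteq> {x - e<..<x + e}" by (auto simp: \<alpha>_def)
  qed
  have "\<forall>\<^sub>F i in sequentially. E_pr n (\<alpha> t0) \<subseteq> \<alpha> (t i)" for n
  proof -
    have "\<forall>\<^sub>F i in sequentially. t i \<in> interior I" if "I \<in> \<alpha> t0 \<inter> E_grid n" for I
      using that by (intro topological_tendstoD[OF t]) (auto simp: \<alpha>_def)
    then have "\<forall>\<^sub>F i in sequentially. \<forall>I\<in>\<alpha> t0 \<inter> E_grid n. t i \<in> interior I"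
      using finite_E_grid by (intro eventually_ball_finite) auto
    then show ?thesis
      by eventually_elim (rule E_pr_subsetI[OF id], auto simp: \<alpha>_def)
  qed
  then show "\<exists>b a. (\<forall>i. b i \<in> E_ideals \<and> E_eq (b i) (b i) \<and> E_val (b i) = t i) \<and>
     a \<in> E_ideals \<and> E_eq a a \<and> E_val a = t0 \<and> (\<forall>n. \<forall>\<^sub>F i in sequentially. E_pr n a \<subseteq> b i)"
    using id tot E_val_eq
    by (intro exI[of _ "\<lambda>i. \<alpha> (t i)"] exI[of _ "\<alpha> t0"]) (auto simp: E_eq_self)
qed

text \<open>On a partial object \<open>E_ext\<close> quantifies over the total objects above a
  projection. Density keeps this from being vacuous: a total y yields a value lying in any two
  selected intervals, so they meet and the result is an ideal.\<close>

definition E_dense :: "nat \<Rightarrow> bool" where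
  "E_dense k \<longleftrightarrow> (\<forall>x\<in>E_dom k. \<forall>p. \<exists>y\<in>E.T k. E.leX (E.\<pi> k p x) y)"

text \<open>In contrast to the ideal used in \<open>E_adm_0\<close>, endpoints count. The ideal thus
  lies above every finite piece of information consistent with t.\<close>

definition E_point :: "real \<Rightarrow> real set set" where
  "E_point t = {J\<in>E_basis. t \<in> J}"

lemma E_point_ideal: "E_point t \<in> E_ideals"
  by (rule E_idealI) (auto simp: E_point_def intro!: E_basis_Int)

lemma E_point_total: "\<Inter>(E_point t) = {t}"
proof (rule E_totalI)
  fix e :: real assume "e > 0"
  then obtain J where J: "J \<in> E_basis" "t \<in> interior J" "J \<subseteq> {t - e <..< t + e}"
    using E_basis_nbhd by metis
  then have "J \<in> E_point t" using interior_subset by (auto simp: E_point_def)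
  then show "\<exists>I\<in>E_point t. I \<subseteq> {t - e<..<t + e}" using J(3) by blast
qed (auto simp: E_point_def)

lemma E_grid_least:
  assumes "\<alpha> \<in> E_ideals"
  obtains I where "I \<in> \<alpha>" "I = \<Inter>(\<alpha> \<inter> E_grid p)" "I \<noteq> {}"
proof -
  have "\<Inter>G \<in> \<alpha>" if "finite G" "G \<subseteq> \<alpha>" for G
    using that by (induction G rule: finite_induct) (use E_idealD[OF assms] in auto)
  then have m: "\<Inter>(\<alpha> \<inter> E_grid p) \<in> \<alpha>" using finite_E_grid by auto
  then have "\<Inter>(\<alpha> \<inter> E_grid p) \<noteq> {}"
    using E_basis_nonempty E_idealD(1)[OF assms] by (meson subsetD)
  then show thesis by (rule that[OF m HOL.refl])
qed

lemma E_dense_0: "E_dense 0"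
  unfolding E_dense_def
proof (intro ballI allI)
  fix x p assume "x \<in> E_dom 0"
  then obtain \<alpha> where \<alpha>: "x = Base \<alpha>" "\<alpha> \<in> E_ideals" by (auto simp: E.X_0)
  then obtain t where "t \<in> \<Inter>(\<alpha> \<inter> E_grid p)" using E_grid_least by (metis ex_in_conv)
  then have "E_pr p \<alpha> \<subseteq> E_point t"
    using E_idealD(1)[OF \<alpha>(2)] by (intro E_pr_subsetI[OF E_point_ideal]) (auto simp: E_point_def)
  then show "\<exists>y\<in>E.T 0. E.leX (E.\<pi> 0 p x) y"
    using \<alpha> E_point_ideal E_point_total E_val_eq
    by (intro bexI[of _ "Base (E_point t)"]) (auto simp: total_def E.X_0 E_eq_self)
qed

text \<open>A continuous selection through the values of \<open>\<pi> 1 p x\<close>, which are locally constant off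
  the grid, is a total functional above \<open>\<pi> 1 p x\<close>.\<close>

lemma E_dense_1: "E_dense (Suc 0)"
  unfolding E_dense_def
proof (intro ballI allI)
  fix x p assume x: "x \<in> E_dom (Suc 0)"
  define N :: real where "N = fact p"
  have N: "N > 0" by (simp add: N_def)
  have xB: "app x (Base \<alpha>) \<in> E_ideals" if "\<alpha> \<in> E_ideals" for \<alpha>
    using E.app_in x that by (auto simp: E.X_0)
  have xm: "app x (Base \<alpha>) \<subseteq> app x (Base \<beta>)" if "\<alpha> \<in> E_ideals" "\<beta> \<in> E_ideals" "\<alpha> \<subseteq> \<beta>" for \<alpha> \<beta>
    using E.app_mono[OF x] that by (auto simp: E.X_0)
  \<comment> \<open>The most precise grid information on the value at t that the p-th projection of
    x gives.\<close>
  define J where "J t = \<Inter>(app x (Base (E_pr p (E_point t))) \<inter> E_grid p)" for t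
  have Jne: "J t \<noteq> {}" for t
    unfolding J_def using E_grid_least xB E_pr_ideal E_point_ideal by metis
  have Jmono: "J s \<subseteq> J t" if "\<And>I. I \<in> E_grid p \<Longrightarrow> t \<in> I \<Longrightarrow> s \<in> I" for s t
  proof -
    have "E_pr p (E_point t) \<subseteq> E_pr p (E_point s)"
      using that E_grid_basis unfolding E_pr_def E_point_def by blast
    then have "app x (Base (E_pr p (E_point t))) \<subseteq> app x (Base (E_pr p (E_point s)))"
      using xm E_pr_ideal E_point_ideal by blast
    then show ?thesis unfolding J_def by blast
  qed
  obtain f where f: "continuous_on UNIV f" "\<And>t. f t \<in> J t"
  proof (rule interpolate[OF N, of J])
    show "convex (J t)" for t
      unfolding J_def by (rule convex_Inter) (use E_basis_convex E_grid_basis in blast)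
    show "J (of_int i / N) \<noteq> {}" for i :: int using Jne .
    show "J (of_int i / N) \<subseteq> J t \<and> J ((of_int i + 1) / N) \<subseteq> J t"
      if t: "of_int i / N < t" "t < (of_int i + 1) / N" for i :: int and t
    proof -
      \<comment> \<open>Grid intervals have multiples of 1/N as endpoints, so one that contains an
        inner point of a cell contains the whole cell.\<close>
      have "of_int i / N \<in> I \<and> (of_int i + 1) / N \<in> I" if I: "I \<in> E_grid p" "t \<in> I" for I
      proof (cases "I = UNIV")
        case False
        then obtain a b where ab: "I = {of_int a / N .. of_int b / N}"
          using I unfolding E_grid_def N_def by auto
        then have "real_of_int a / N < (of_int i + 1) / N" "of_int i / N < of_int b / N"
          using I(2) t by auto
        then have "a \<le> i" "i + 1 \<le> b" using N by (simp_all add: divide_less_cancel)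
        then have "real_of_int a \<le> of_int i" "real_of_int i + 1 \<le> of_int b" by linarith+
        then show ?thesis unfolding ab using N by (auto simp: divide_le_cancel)
      qed auto
      then show ?thesis using Jmono by blast
    qed
  qed blast
  \<comment> \<open>The interval extension of f: an output interval is granted once some input
    interval is mapped into it.\<close>
  define Y where "Y \<alpha> = {J\<in>E_basis. \<exists>I\<in>\<alpha>. f ` I \<subseteq> J}" for \<alpha> :: "real set set"
  have Yid: "Y \<alpha> \<in> E_ideals" if \<alpha>: "\<alpha> \<in> E_ideals" for \<alpha>
  proof (rule E_idealI)
    show "UNIV \<in> Y \<alpha>" using E_idealD(2)[OF \<alpha>] by (auto simp: Y_def)
    fix I J assume "I \<in> Y \<alpha>" "J \<in> Y \<alpha>"
    then obtain K M where K: "K \<in> \<alpha>" "f ` K \<subseteq> I" "M \<in> \<alpha>" "f ` M \<subseteq> J" "I \<in> E_basis" "J \<in> E_basis"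
      by (auto simp: Y_def)
    have "K \<inter> M \<in> \<alpha>" using E_idealD(4)[OF \<alpha>] K by auto
    moreover then have "K \<inter> M \<noteq> {}" using E_idealD(1)[OF \<alpha>] E_basis_nonempty by blast
    moreover have "f ` (K \<inter> M) \<subseteq> I \<inter> J" using K by blast
    ultimately show "I \<inter> J \<in> Y \<alpha>" using K E_basis_Int[of I J] unfolding Y_def by blast
  qed (auto simp: Y_def)
  define y where "y = lam (E_dom 0) (\<lambda>z. Y (base z))"
  have y: "y \<in> E_dom (Suc 0)"
    unfolding y_def
  proof (rule E.lam_in_X)
    show "Y (base x) \<in> E_ideals" if "x \<in> E_dom 0" for x using that Yid by (auto simp: E.X_0)
    have Ym: "Y \<alpha> \<subseteq> Y \<beta>" if "\<alpha> \<subseteq> \<beta>" for \<alpha> \<beta> using that unfolding Y_def by blast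
    show "Y (base x) \<subseteq> Y (base y)" if "x \<in> E_dom 0" "y \<in> E_dom 0" "E.leX x y" for x y
      by (rule Ym) (use that in \<open>auto simp: E.X_0\<close>)
    show "\<exists>m. E_pr n (Y (base z)) \<subseteq> Y (base (E.\<pi> 0 m z))" if z: "z \<in> E_dom 0" for z n
    proof -
      obtain \<alpha> where \<alpha>: "z = Base \<alpha>" "\<alpha> \<in> E_ideals" using z by (auto simp: E.X_0)
      have "\<Inter>(Y \<alpha> \<inter> E_grid n) \<in> Y \<alpha>" using E_grid_least[OF Yid[OF \<alpha>(2)]] by metis
      then obtain I where I: "I \<in> \<alpha>" "f ` I \<subseteq> \<Inter>(Y \<alpha> \<inter> E_grid n)" unfolding Y_def by blast
      obtain m where "I \<in> E_grid m" using E_basis_grid E_idealD(1)[OF \<alpha>(2)] I by blast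
      then have "I \<in> E_pr m \<alpha>" using E_pr_grid I by blast
      then have "Y \<alpha> \<inter> E_grid n \<subseteq> Y (E_pr m \<alpha>)" using I(2) unfolding Y_def by blast
      then have "E_pr n (Y \<alpha>) \<subseteq> Y (E_pr m \<alpha>)" by (intro E_pr_subsetI Yid E_pr_ideal \<alpha>)
      then show ?thesis using \<alpha> by auto
    qed
  qed auto
  have app_y: "app y (Base \<alpha>) = Y \<alpha>" if "\<alpha> \<in> E_ideals" for \<alpha>
  proof -
    have "Base \<alpha> \<in> E_dom 0" using that by (simp add: E.X_0)
    then show ?thesis by (simp add: y_def)
  qed
  have Ytot: "\<Inter>(Y \<alpha>) = {f t}" if \<alpha>: "\<alpha> \<in> E_ideals" "\<Inter>\<alpha> = {t}" for \<alpha> t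
  proof (rule E_totalI)
    show "f t \<in> I" if "I \<in> Y \<alpha>" for I using that \<alpha>(2) by (auto simp: Y_def)
    fix e :: real assume "e > 0"
    then obtain K where K: "K \<in> E_basis" "f t \<in> interior K" "K \<subseteq> {f t - e <..< f t + e}"
      using E_basis_nbhd by metis
    have "open (f -` interior K)" using f(1) by (intro open_vimage) auto
    then obtain d where d: "d > 0" "ball t d \<subseteq> f -` interior K"
      using K(2) by (meson open_contains_ball vimageI2 vimage_def mem_Collect_eq)
    obtain I where I: "I \<in> \<alpha>" "I \<subseteq> {t - d <..< t + d}" using E_small \<alpha> d by metis
    then have "f ` I \<subseteq> interior K" using d(2) by (auto simp: ball_def dist_real_def subset_iff abs_if)
    then have "K \<in> Y \<alpha>" using K(1) I interior_subset unfolding Y_def by blast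
    then show "\<exists>I\<in>Y \<alpha>. I \<subseteq> {f t - e <..< f t + e}" using K by blast
  qed
  have "y \<in> E.T (Suc 0)"
  proof -
    have "E_eq (app y a) (app y b)" if ab: "per E_eq E_dom 0 a b" for a b
    proof -
      obtain \<alpha> \<beta> t where "a = Base \<alpha>" "b = Base \<beta>" "\<alpha> \<in> E_ideals" "\<beta> \<in> E_ideals" "\<Inter>\<alpha> = {t}" "\<Inter>\<beta> = {t}"
        using ab by (auto simp: E.X_0 E_eq_def)
      then show ?thesis using Ytot app_y by (auto simp: E_eq_def)
    qed
    then show ?thesis using y by (auto simp: total_def)
  qed
  moreover have "E.leX (E.\<pi> (Suc 0) p x) y"
    unfolding E.leX_iff[OF E.L.pr_in[OF x] y]
  proof
    fix z assume z: "z \<in> E_dom 0"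
    then obtain \<beta> where \<beta>: "z = Base \<beta>" "\<beta> \<in> E_ideals" by (auto simp: E.X_0)
    obtain I0 where I0: "I0 \<in> \<beta>" "I0 = \<Inter>(\<beta> \<inter> E_grid p)" "I0 \<noteq> {}"
      using E_grid_least[OF \<beta>(2)] by blast
    have "app x (Base (E_pr p \<beta>)) \<inter> E_grid p \<subseteq> Y \<beta>"
    proof
      fix K assume K: "K \<in> app x (Base (E_pr p \<beta>)) \<inter> E_grid p"
      \<comment> \<open>All of \<open>E_pr p \<beta>\<close> is true of every t in the least grid
        interval \<open>I0\<close>. So K is among the constraints at each such t, and f maps
        \<open>I0\<close> into K.\<close>
      have "f t \<in> K" if t: "t \<in> I0" for t
      proof -
        have "E_pr p \<beta> \<subseteq> E_pr p (E_point t)"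
          using t I0(2) E_grid_basis unfolding E_pr_def E_point_def by blast
        then have "app x (Base (E_pr p \<beta>)) \<subseteq> app x (Base (E_pr p (E_point t)))"
          using xm E_pr_ideal E_point_ideal \<beta>(2) by blast
        then show ?thesis using f(2)[of t] K unfolding J_def by blast
      qed
      then show "K \<in> Y \<beta>" using I0(1) K E_grid_basis unfolding Y_def by blast
    qed
    then have "E_pr p (app x (Base (E_pr p \<beta>))) \<subseteq> Y \<beta>"
      by (intro E_pr_subsetI Yid \<beta>)
    then show "app (E.\<pi> (Suc 0) p x) z \<subseteq> app y z"
      unfolding E.proj_app[OF z] using app_y \<beta> by simp
  qed
  ultimately show "\<exists>y\<in>E.T (Suc 0). E.leX (E.\<pi> (Suc 0) p x) y" by blast
qed

text \<open>\<open>V p u\<close> is the set of values at u that stage p has to respect. Letting it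
  depend on p makes one construction serve both for a single functional and for the limit of a
  sequence; interiors fit the convergence condition on V, which is about open sets.\<close>

definition E_ext :: "nat \<Rightarrow> (nat \<Rightarrow> real fnl \<Rightarrow> real set) \<Rightarrow> real set set fnl \<Rightarrow> real set set" where
  "E_ext k V x = {J\<in>E_basis. J = UNIV \<or>
     (\<exists>p. \<forall>y\<in>E.T k. E.leX (E.\<pi> k p x) y \<longrightarrow> V p (E.\<rho> k y) \<subseteq> interior J)}"

lemma E_extI:
  assumes "J \<in> E_basis" "\<And>y. y \<in> E.T k \<Longrightarrow> E.leX (E.\<pi> k p x) y \<Longrightarrow> V p (E.\<rho> k y) \<subseteq> interior J"
  shows "J \<in> E_ext k V x"
  unfolding E_ext_def by (intro CollectI conjI disjI2 exI[of _ p]) (use assms in auto)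

lemma E_extD:
  assumes "J \<in> E_ext k V x" "J \<noteq> UNIV"
  shows "\<exists>p. \<forall>y\<in>E.T k. E.leX (E.\<pi> k p x) y \<longrightarrow> V p (E.\<rho> k y) \<subseteq> interior J"
  using assms by (simp add: E_ext_def)

lemma E_ext_basis: "J \<in> E_ext k V x \<Longrightarrow> J \<in> E_basis"
  by (simp add: E_ext_def)

lemma E_ext_UNIV: "UNIV \<in> E_ext k V x"
  by (simp add: E_ext_def)

lemma E_ext_total:
  assumes adm: "E.adm k" and dense: "E_dense k"
    and V_mono: "\<And>p q u. p \<le> q \<Longrightarrow> V q u \<subseteq> V p u"
    and V_c: "\<And>p u. u \<in> L k \<Longrightarrow> c u \<in> V p u"
    and V_conv: "\<And>us u S. Lconv k us u \<Longrightarrow> open S \<Longrightarrow> c u \<in> S \<Longrightarrow> \<forall>\<^sub>F p in sequentially. V p (us p) \<subseteq> S"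
  shows "lam (E_dom k) (E_ext k V) \<in> E.T (Suc k)"
    and "\<And>x. x \<in> E_dom k \<Longrightarrow> E_ext k V x \<in> E_ideals"
    and "\<And>x. x \<in> E.T k \<Longrightarrow> E_val (E_ext k V x) = c (E.\<rho> k x)"
proof -
  let ?F = "E_ext k V"
  have rhoL: "E.\<rho> k y \<in> L k" if "y \<in> E.T k" for y using E.adm_L[OF adm] that by auto
  have below_trans: "E.leX (E.\<pi> k p x) y" if "x \<in> E_dom k" "y \<in> E_dom k" "p \<le> q" "E.leX (E.\<pi> k q x) y" for p q x y
    using E.L.trans[OF _ _ _ E.L.pr_incr[OF that(1,3)] that(4)] E.L.pr_in that by blast
  show id: "?F x \<in> E_ideals" if x: "x \<in> E_dom k" for x
  proof (rule E_idealI)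
    show "?F x \<subseteq> E_basis" "UNIV \<in> ?F x" using E_ext_basis E_ext_UNIV by auto
    show "J \<in> ?F x" if IJ: "I \<in> ?F x" "J \<in> E_basis" "I \<subseteq> J" for I J
    proof (cases "I = UNIV")
      case True
      then have "J = UNIV" using IJ(3) by auto
      then show ?thesis using E_ext_UNIV by simp
    next
      case False
      then obtain p where p: "\<forall>y\<in>E.T k. E.leX (E.\<pi> k p x) y \<longrightarrow> V p (E.\<rho> k y) \<subseteq> interior I"
        using E_extD[OF IJ(1)] by auto
      show ?thesis by (rule E_extI[OF IJ(2), of _ p]) (use p interior_mono[OF IJ(3)] in force)
    qed
    fix I J assume IJ: "I \<in> ?F x" "J \<in> ?F x"
    consider "I = UNIV" | "J = UNIV" | "I \<noteq> UNIV" "J \<noteq> UNIV" by auto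
    then show "I \<inter> J \<in> ?F x"
    proof cases
      case 1 then show ?thesis using IJ(2) by simp
    next
      case 2 then show ?thesis using IJ(1) by simp
    next
      case 3
      obtain p where p: "\<forall>y\<in>E.T k. E.leX (E.\<pi> k p x) y \<longrightarrow> V p (E.\<rho> k y) \<subseteq> interior I"
        using E_extD[OF IJ(1) 3(1)] by auto
      obtain q where q: "\<forall>y\<in>E.T k. E.leX (E.\<pi> k q x) y \<longrightarrow> V q (E.\<rho> k y) \<subseteq> interior J"
        using E_extD[OF IJ(2) 3(2)] by auto
      have m: "V (max p q) (E.\<rho> k y) \<subseteq> interior (I \<inter> J)"
        if y: "y \<in> E.T k" "E.leX (E.\<pi> k (max p q) x) y" for y
      proof -
        have "E.leX (E.\<pi> k p x) y" "E.leX (E.\<pi> k q x) y"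
          using below_trans[OF x E.T_in[OF y(1)] _ y(2)] by auto
        then have "V p (E.\<rho> k y) \<subseteq> interior I" "V q (E.\<rho> k y) \<subseteq> interior J"
          using p q y(1) by simp_all
        moreover have "V (max p q) (E.\<rho> k y) \<subseteq> V p (E.\<rho> k y)" "V (max p q) (E.\<rho> k y) \<subseteq> V q (E.\<rho> k y)"
          by (rule V_mono; simp)+
        ultimately show ?thesis by auto
      qed
      obtain y where y: "y \<in> E.T k" "E.leX (E.\<pi> k (max p q) x) y"
        using dense x by (auto simp: E_dense_def)
      have "c (E.\<rho> k y) \<in> I \<inter> J"
        using subsetD[OF m[OF y] V_c[OF rhoL[OF y(1)]]] interior_subset by auto
      then have "I \<inter> J \<in> E_basis" using E_basis_Int E_ext_basis IJ by (metis empty_iff)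
      then show ?thesis by (rule E_extI) (rule m)
    qed
  qed
  have inX: "lam (E_dom k) ?F \<in> E_dom (Suc k)"
  proof (rule E.lam_in_X)
    show "?F x \<subseteq> ?F x'" if "x \<in> E_dom k" "x' \<in> E_dom k" "E.leX x x'" for x x'
    proof -
      have "E.leX (E.\<pi> k p x) y" if "y \<in> E.T k" "E.leX (E.\<pi> k p x') y" for p y
        using E.L.trans[OF _ _ _ E.L.pr_mono[OF \<open>x \<in> E_dom k\<close> \<open>x' \<in> E_dom k\<close> \<open>E.leX x x'\<close>] that(2)]
          E.L.pr_in E.T_in that \<open>x \<in> E_dom k\<close> \<open>x' \<in> E_dom k\<close> by blast
      note * = this
      show ?thesis
      proof
        fix J assume J: "J \<in> ?F x"
        show "J \<in> ?F x'"
        proof (cases "J = UNIV")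
          case True then show ?thesis by (simp add: E_ext_UNIV)
        next
          case False
          then obtain p where "\<forall>y\<in>E.T k. E.leX (E.\<pi> k p x) y \<longrightarrow> V p (E.\<rho> k y) \<subseteq> interior J"
            using E_extD[OF J] by auto
          then show ?thesis using * by (intro E_extI[OF E_ext_basis[OF J], of _ p]) auto
        qed
      qed
    qed
    show "\<exists>m. E_pr n (?F x) \<subseteq> ?F (E.\<pi> k m x)" if x: "x \<in> E_dom k" for x n
    proof -
      have "\<forall>\<^sub>F m in sequentially. I \<in> ?F (E.\<pi> k m x)" if I: "I \<in> ?F x" for I
      proof (cases "I = UNIV")
        case True then show ?thesis by (simp add: E_ext_def)
      next
        case False
        then obtain p where p: "\<forall>y\<in>E.T k. E.leX (E.\<pi> k p x) y \<longrightarrow> V p (E.\<rho> k y) \<subseteq> interior I"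
          using E_extD[OF I] by auto
        have "I \<in> ?F (E.\<pi> k m x)" if m: "p \<le> m" for m
        proof -
          have "V m (E.\<rho> k y) \<subseteq> interior I" if y: "y \<in> E.T k" "E.leX (E.\<pi> k m (E.\<pi> k m x)) y" for y
          proof -
            have "E.leX (E.\<pi> k p x) y"
              using below_trans[OF x E.T_in[OF y(1)] m] y(2) E.L.pr_idem[OF x] by simp
            then have "V p (E.\<rho> k y) \<subseteq> interior I" using p y(1) by simp
            then show ?thesis using V_mono[OF m] by (rule order_trans[rotated])
          qed
          then show ?thesis by (rule E_extI[OF E_ext_basis[OF I]])
        qed
        then show ?thesis unfolding eventually_sequentially by blast
      qed
      then have "\<forall>\<^sub>F m in sequentially. \<forall>I\<in>?F x \<inter> E_grid n. I \<in> ?F (E.\<pi> k m x)"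
        using finite_E_grid by (intro eventually_ball_finite) auto
      then obtain m where "?F x \<inter> E_grid n \<subseteq> ?F (E.\<pi> k m x)"
        by (auto simp: eventually_sequentially)
      then show ?thesis using E_pr_subsetI id E.L.pr_in x by blast
    qed
  qed (use id in auto)
  have tot: "\<Inter>(?F x) = {c (E.\<rho> k x)}" if x: "x \<in> E.T k" for x
  proof (rule E_totalI)
    show "c (E.\<rho> k x) \<in> I" if I: "I \<in> ?F x" for I
    proof -
      have "E.leX (E.\<pi> k p x) x" for p using E.L.pr_le E.T_in x by blast
      note * = this
      show ?thesis
      proof (cases "I = UNIV")
        case False
        then obtain p where "V p (E.\<rho> k x) \<subseteq> interior I" using E_extD[OF I] x * by metis
        then show ?thesis using V_c[OF rhoL[OF x]] interior_subset by (metis subsetD)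
      qed simp
    qed
    fix e :: real assume "e > 0"
    then obtain K where K: "K \<in> E_basis" "c (E.\<rho> k x) \<in> interior K"
      "K \<subseteq> {c (E.\<rho> k x) - e <..< c (E.\<rho> k x) + e}"
      using E_basis_nbhd by metis
    \<comment> \<open>Otherwise counterexamples exist above every projection of x. They converge to
      x, and the convergence condition on V contradicts them.\<close>
    have "K \<in> ?F x"
    proof (rule ccontr)
      assume "K \<notin> ?F x"
      then have "\<forall>p. \<exists>y. y \<in> E.T k \<and> E.leX (E.\<pi> k p x) y \<and> \<not> V p (E.\<rho> k y) \<subseteq> interior K"
        using E_extI[OF K(1)] by metis
      then obtain ys where ys: "\<And>p. ys p \<in> E.T k" "\<And>p. E.leX (E.\<pi> k p x) (ys p)"
        "\<And>p. \<not> V p (E.\<rho> k (ys p)) \<subseteq> interior K" by metis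
      have "E.conv k ys x" using E.conv_above ys E.T_in x by blast
      then have "Lconv k (\<lambda>p. E.\<rho> k (ys p)) (E.\<rho> k x)" using E.admD(1)[OF adm] ys x by blast
      then have "\<forall>\<^sub>F p in sequentially. V p (E.\<rho> k (ys p)) \<subseteq> interior K"
        using V_conv K(2) by blast
      then show False using ys(3) by (auto simp: eventually_sequentially)
    qed
    then show "\<exists>I\<in>?F x. I \<subseteq> {c (E.\<rho> k x) - e <..< c (E.\<rho> k x) + e}" using K by blast
  qed
  show "E_val (?F x) = c (E.\<rho> k x)" if "x \<in> E.T k" for x using tot[OF that] E_val_eq by blast
  have "E_eq (app (lam (E_dom k) ?F) x) (app (lam (E_dom k) ?F) y)" if xy: "per E_eq E_dom k x y" for x y
    using tot per_total[OF E.symp_eq E.transp_eq xy] E.per_rho[OF xy] per_in[OF xy] by (auto simp: E_eq_def)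
  then show "lam (E_dom k) ?F \<in> E.T (Suc k)" using inX by (auto simp: total_def)
qed

lemma E_adm_Suc: assumes adm: "E.adm k" and dense: "E_dense k" shows "E.adm (Suc k)"
proof (rule E.adm_Suc[OF adm])
  fix Us U assume UU: "Lconv (Suc k) Us U"
  \<comment> \<open>Stage p leaves room for the whole tail of the sequence, which contains the
    singleton \<open>Vs m p u\<close> as soon as \<open>m \<ge> p\<close>; intervals selected for
    the limit are then also selected for \<open>Us m\<close>.\<close>
  define V where "V p u = insert (app U u) {app (Us j) u | j. j \<ge> p}" for p u
  define Vs where "Vs m p u = {app (Us m) u}" for m and p :: nat and u
  note UL = Lconv_in[OF UU]
  have V_mono: "V q u \<subseteq> V p u" if "p \<le> q" for p q u using that by (auto simp: V_def)
  have V_c: "app U u \<in> V p u" for p u by (simp add: V_def)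
  have V_conv: "\<forall>\<^sub>F p in sequentially. V p (us p) \<subseteq> S" if us: "Lconv k us u" and S: "open S" "app U u \<in> S" for us u S
  proof -
    \<comment> \<open>If some index from p on gives a value outside S, such an index is chosen.
      Convergence along g then shows that from some stage on there is none.\<close>
    define g where "g p = (if \<exists>j\<ge>p. app (Us j) (us p) \<notin> S then SOME j. j \<ge> p \<and> app (Us j) (us p) \<notin> S else p)" for p
    have g: "g p \<ge> p \<and> ((\<exists>j\<ge>p. app (Us j) (us p) \<notin> S) \<longrightarrow> app (Us (g p)) (us p) \<notin> S)" for p
      unfolding g_def using someI_ex[of "\<lambda>j. j \<ge> p \<and> app (Us j) (us p) \<notin> S"] by auto
    have "filterlim g at_top sequentially"
      by (rule filterlim_at_top_mono[OF filterlim_ident]) (use g in auto)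
    then have "(\<lambda>p. app (Us (g p)) (us p)) \<longlonglongrightarrow> app U u" using UU us by simp
    then have "\<forall>\<^sub>F p in sequentially. app (Us (g p)) (us p) \<in> S" by (rule topological_tendstoD) (use S in auto)
    moreover have "\<forall>\<^sub>F p in sequentially. app U (us p) \<in> S"
      by (rule topological_tendstoD[OF E.LSuc_cont[OF adm UL(2) us]]) (use S in auto)
    ultimately show ?thesis by eventually_elim (use g in \<open>auto simp: V_def\<close>)
  qed
  have F: "lam (E_dom k) (E_ext k V) \<in> E.T (Suc k)"
      "x \<in> E_dom k \<Longrightarrow> E_ext k V x \<in> E_ideals"
      "x \<in> E.T k \<Longrightarrow> E_val (E_ext k V x) = app U (E.\<rho> k x)" for x
    by (rule E_ext_total[OF adm dense, of V "app U"]; (rule V_mono V_c V_conv; assumption)?; assumption)+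
  have Vs_conv: "\<forall>\<^sub>F p in sequentially. Vs m p (us p) \<subseteq> S" if us: "Lconv k us u" and S: "open S" "app (Us m) u \<in> S" for us u S m
    using topological_tendstoD[OF E.LSuc_cont[OF adm UL(1) us] S] by (simp add: Vs_def)
  have Fs: "lam (E_dom k) (E_ext k (Vs m)) \<in> E.T (Suc k)"
      "x \<in> E_dom k \<Longrightarrow> E_ext k (Vs m) x \<in> E_ideals"
      "x \<in> E.T k \<Longrightarrow> E_val (E_ext k (Vs m) x) = app (Us m) (E.\<rho> k x)" for m x
    by (rule E_ext_total[OF adm dense, of "Vs m" "app (Us m)"]; use Vs_conv in \<open>auto simp: Vs_def\<close>)+
  let ?F = "lam (E_dom k) (E_ext k V)" and ?Fs = "\<lambda>m. lam (E_dom k) (E_ext k (Vs m))"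
  have "E.conv (Suc k) ?Fs ?F"
    unfolding E.conv_def
  proof
    fix n
    have 1: "\<forall>\<^sub>F m in sequentially. J \<in> E_ext k (Vs m) c" if J: "J \<in> E_ext k V c" for J c
    proof (cases "J = UNIV")
      case True then show ?thesis by (simp add: E_ext_def)
    next
      case False
      then obtain p where p: "\<forall>y\<in>E.T k. E.leX (E.\<pi> k p c) y \<longrightarrow> V p (E.\<rho> k y) \<subseteq> interior J"
        using E_extD[OF J] by auto
      have "J \<in> E_ext k (Vs m) c" if "m \<ge> p" for m
      proof -
        have "Vs m p u \<subseteq> V p u" for u using that by (auto simp: V_def Vs_def)
        then show ?thesis using p by (intro E_extI[OF E_ext_basis[OF J], of _ p]) (meson order_trans)
      qed
      then show ?thesis unfolding eventually_sequentially by blast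
    qed
    have 2: "\<forall>\<^sub>F m in sequentially. \<forall>J\<in>E_ext k V c \<inter> E_grid n. J \<in> E_ext k (Vs m) c" for c
      using 1 finite_E_grid by (intro eventually_ball_finite) auto
    \<comment> \<open>The n-th projection involves finitely many arguments and finitely many grid
      intervals, so one m works for all of them.\<close>
    have "\<forall>\<^sub>F m in sequentially. \<forall>c\<in>E.\<pi> k n ` E_dom k. \<forall>J\<in>E_ext k V c \<inter> E_grid n. J \<in> E_ext k (Vs m) c"
      using 2 E.L.finite_pr by (intro eventually_ball_finite) auto
    then show "\<forall>\<^sub>F m in sequentially. E.leX (E.\<pi> (Suc k) n ?F) (?Fs m)"
    proof eventually_elim
      case (elim m)
      show ?case
        unfolding E.leX_iff[OF E.L.pr_in[OF E.T_in[OF F(1)]] E.T_in[OF Fs(1)]]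
      proof
        fix x assume x: "x \<in> E_dom k"
        have px: "E.\<pi> k n x \<in> E_dom k" using E.L.pr_in x by blast
        have "E_pr n (E_ext k V (E.\<pi> k n x)) \<subseteq> E_ext k (Vs m) (E.\<pi> k n x)"
          by (rule E_pr_subsetI) (use Fs px elim x in auto)
        also have "\<dots> = app (?Fs m) (E.\<pi> k n x)" using px by simp
        also have "\<dots> \<subseteq> app (?Fs m) x"
          by (rule E.app_mono[OF E.T_in[OF Fs(1)] px x E.L.pr_le[OF x]])
        finally show "app (E.\<pi> (Suc k) n ?F) x \<subseteq> app (?Fs m) x"
          unfolding E.proj_app[OF x] using px by simp
      qed
    qed
  qed
  then show "\<exists>xs x. (\<forall>i. xs i \<in> E.T (Suc k) \<and>
        (\<forall>y\<in>E.T k. E_val (app (xs i) y) = app (Us i) (E.\<rho> k y))) \<and>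
        x \<in> E.T (Suc k) \<and> (\<forall>y\<in>E.T k. E_val (app x y) = app U (E.\<rho> k y)) \<and> E.conv (Suc k) xs x"
    using F Fs E.T_in by (intro exI[of _ ?Fs] exI[of _ ?F]) auto
qed

lemma E_adm_1: "E.adm (Suc 0)" and E_adm_2: "E.adm (Suc (Suc 0))"
  using E_adm_Suc E_adm_0 E_dense_0 E_dense_1 by blast+

section \<open>Signed digit sequences\<close>

definition pv :: "digits \<Rightarrow> nat \<Rightarrow> real" where
  "pv s n = of_int (the (s 0)) + (\<Sum>i<n. of_int (the (s (Suc i))) / 2 ^ Suc i)"

text \<open>\<open>SI s\<close> is the set of values of the maximal extensions of \<open>s\<close>.\<close>

definition SI :: "digits \<Rightarrow> real set" where
  "SI s = {x. \<forall>n. s n \<noteq> None \<longrightarrow> \<bar>x - pv s n\<bar> \<le> 1 / 2 ^ n}"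

lemma pv_Suc: "pv s (Suc n) = pv s n + of_int (the (s (Suc n))) / 2 ^ Suc n"
  by (simp add: pv_def)

lemma S_seqs_down: "s \<in> S_seqs \<Longrightarrow> s n \<noteq> None \<Longrightarrow> m \<le> n \<Longrightarrow> s m \<noteq> None"
proof (induction n)
  case (Suc n)
  have "s n \<noteq> None" using Suc.prems(1,2) by (auto simp: S_seqs_def)
  then show ?case using Suc by (cases "m = Suc n") auto
qed simp

lemma S_seqs_None: "s \<in> S_seqs \<Longrightarrow> s 0 = None \<Longrightarrow> s = Map.empty"
  using S_seqs_down by (metis ext zero_le)

lemma S_seqs_digit: "s \<in> S_seqs \<Longrightarrow> s (Suc n) = Some b \<Longrightarrow> b \<in> {-1, 0, 1}"
  by (simp add: S_seqs_def)

lemma S_seqsI: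
  assumes "\<And>i. s i = None \<Longrightarrow> s (Suc i) = None" "\<And>i b. s (Suc i) = Some b \<Longrightarrow> b \<in> {-1, 0, 1}"
  shows "s \<in> S_seqs"
  using assms by (auto simp: S_seqs_def)

lemma empty_S_seqs [simp]: "Map.empty \<in> S_seqs"
  by (simp add: S_seqs_def)

lemma restrict_S_seqs [simp]: "s \<in> S_seqs \<Longrightarrow> s |` {..<n} \<in> S_seqs"
  by (auto simp: S_seqs_def restrict_map_def split: if_splits)

lemma map_leD: "s \<subseteq>\<^sub>m t \<Longrightarrow> s n \<noteq> None \<Longrightarrow> t n = s n"
  by (auto simp: map_le_def dom_def)

lemma map_leI: "(\<And>n. s n \<noteq> None \<Longrightarrow> t n = s n) \<Longrightarrow> s \<subseteq>\<^sub>m t"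
  by (auto simp: map_le_def dom_def)

lemma restrict_map_le [simp]: "s |` A \<subseteq>\<^sub>m s"
  by (rule map_leI) (auto simp: restrict_map_def split: if_splits)

lemma pv_cong: "(\<And>i. i \<le> n \<Longrightarrow> s i = t i) \<Longrightarrow> pv s n = pv t n"
  unfolding pv_def by (intro arg_cong2[of _ _ _ _ "(+)"] sum.cong) auto

lemma pv_map_le:
  assumes "s \<in> S_seqs" "s \<subseteq>\<^sub>m t" "s n \<noteq> None" shows "pv s n = pv t n"
proof (rule pv_cong)
  fix i assume "i \<le> n"
  then have "s i \<noteq> None" using S_seqs_down[OF assms(1,3)] by simp
  then show "s i = t i" using map_leD[OF assms(2)] by simp
qed

lemma SI_mono: "s \<in> S_seqs \<Longrightarrow> s \<subseteq>\<^sub>m t \<Longrightarrow> SI t \<subseteq> SI s"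
proof
  fix x assume s: "s \<in> S_seqs" "s \<subseteq>\<^sub>m t" "x \<in> SI t"
  have "\<bar>x - pv s n\<bar> \<le> 1 / 2 ^ n" if "s n \<noteq> None" for n
    using s(3) pv_map_le[OF s(1,2) that] map_leD[OF s(2) that] that by (simp add: SI_def)
  then show "x \<in> SI s" by (simp add: SI_def)
qed

lemma SI_empty [simp]: "SI Map.empty = UNIV"
  by (simp add: SI_def)

lemma SI_D: "x \<in> SI s \<Longrightarrow> s n \<noteq> None \<Longrightarrow> \<bar>x - pv s n\<bar> \<le> 1 / 2 ^ n"
  by (simp add: SI_def)

lemma SI_eq_Inter: "SI s = (\<Inter>n\<in>dom s. {pv s n - 1 / 2 ^ n .. pv s n + 1 / 2 ^ n})"
proof -
  have "\<bar>x - a\<bar> \<le> b \<longleftrightarrow> x \<in> {a - b .. a + b}" for x a b :: real by auto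
  then show ?thesis unfolding SI_def dom_def by auto
qed

lemma closed_SI: "closed (SI s)" and convex_SI: "convex (SI s)"
  unfolding SI_eq_Inter by (auto intro!: closed_INT convex_INT)

lemma compact_SI: assumes "s 0 \<noteq> None" shows "compact (SI s)"
proof -
  have "SI s \<subseteq> {pv s 0 - 1 .. pv s 0 + 1}"
    using SI_D[where s=s and n=0] assms by (fastforce simp: abs_le_iff)
  then show ?thesis using closed_SI by (meson bounded_closed_interval bounded_subset compact_eq_bounded_closed)
qed

lemma SI_not_UNIV: assumes "s n \<noteq> None" shows "SI s \<noteq> UNIV"
proof
  assume "SI s = UNIV"
  then have "pv s n + 2 \<in> SI s" by simp
  from SI_D[OF this assms] have "2 \<le> 1 / (2::real) ^ n" by simp
  moreover have "1 / (2::real) ^ n \<le> 1" by simp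
  ultimately show False by linarith
qed

lemma S_max_iff: "s \<in> S_max \<longleftrightarrow> s \<in> S_seqs \<and> (\<forall>n. s n \<noteq> None)"
proof
  assume s: "s \<in> S_max"
  then have seq: "s \<in> S_seqs" and mx: "\<And>t. t \<in> S_seqs \<Longrightarrow> s \<subseteq>\<^sub>m t \<Longrightarrow> t = s"
    by (auto simp: S_max_def)
  have "s n \<noteq> None" for n
  proof
    assume "s n = None"
    define m where "m = (LEAST m. s m = None)"
    have m: "s m = None" unfolding m_def by (rule LeastI[of "\<lambda>m. s m = None", OF \<open>s n = None\<close>])
    have lt: "s i \<noteq> None" if "i < m" for i using not_less_Least[of i "\<lambda>m. s m = None"] that by (simp add: m_def)
    have ge: "s i = None" if "i \<ge> m" for i using S_seqs_down[OF seq _ that] m by (cases "s i = None") auto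
    \<comment> \<open>The first gap is filled with 0, which is admissible both as the integer entry
      and as a later digit.\<close>
    define t where "t = s(m \<mapsto> 0)"
    have "t \<in> S_seqs"
    proof (rule S_seqsI)
      show "t (Suc i) = None" if "t i = None" for i
      proof -
        have "i > m" using that lt unfolding t_def by (metis fun_upd_apply linorder_neqE_nat option.discI)
        then show ?thesis using ge by (simp add: t_def)
      qed
      show "b \<in> {-1, 0, 1}" if "t (Suc i) = Some b" for i b
        using that S_seqs_digit[OF seq, of i b] by (auto simp: t_def split: if_splits)
    qed
    moreover have "s \<subseteq>\<^sub>m t" using m by (auto simp: t_def map_le_def)
    ultimately have "t = s" by (rule mx)
    then show False using m by (metis t_def fun_upd_same option.discI)
  qed
  then show "s \<in> S_seqs \<and> (\<forall>n. s n \<noteq> None)" using seq by simp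
next
  assume s: "s \<in> S_seqs \<and> (\<forall>n. s n \<noteq> None)"
  then have "t = s" if "s \<subseteq>\<^sub>m t" for t using that by (intro ext map_leD) auto
  then show "s \<in> S_max" using s by (simp add: S_max_def)
qed

lemma S_max_extends: "s \<in> S_max \<Longrightarrow> s \<subseteq>\<^sub>m t \<Longrightarrow> t = s"
  unfolding S_max_iff by (intro ext map_leD) auto

text \<open>Bounding by the finite geometric sum rather than by 1 / 2^n is what carries the
  induction.\<close>

lemma pv_Cauchy:
  assumes s: "s \<in> S_max" shows "\<bar>pv s (n + m) - pv s n\<bar> \<le> 1 / 2 ^ n - 1 / 2 ^ (n + m)"
proof (induction m)
  case (Suc m)
  obtain b where b: "s (Suc (n + m)) = Some b" "b \<in> {-1, 0, 1}"
    using s S_seqs_digit unfolding S_max_iff by (metis not_None_eq)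
  have "\<bar>real_of_int b\<bar> \<le> 1" using b by auto
  then have "\<bar>real_of_int b / 2 ^ Suc (n + m)\<bar> \<le> 1 / 2 ^ Suc (n + m)"
    by (simp add: divide_right_mono abs_mult)
  then have "\<bar>pv s (n + Suc m) - pv s n\<bar> \<le> 1 / 2 ^ n - 1 / 2 ^ (n + m) + 1 / 2 ^ Suc (n + m)"
  proof -
    have "pv s (n + Suc m) = pv s (n + m) + real_of_int b / 2 ^ Suc (n + m)"
      using b(1) by (simp add: pv_Suc del: power_Suc)
    then show ?thesis using Suc \<open>\<bar>real_of_int b / 2 ^ Suc (n + m)\<bar> \<le> 1 / 2 ^ Suc (n + m)\<close> by linarith
  qed
  then show ?case by simp
qed simp

lemma pv_tendsto: assumes s: "s \<in> S_max" shows "pv s \<longlonglongrightarrow> S_val s"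
proof -
  define d where "d n = real_of_int (the (s (Suc n))) / 2 ^ Suc n" for n
  have "norm (d n) \<le> (1 / 2) ^ Suc n" for n
  proof -
    obtain b where b: "s (Suc n) = Some b" "b \<in> {-1, 0, 1}"
      using s S_seqs_digit unfolding S_max_iff by (metis not_None_eq)
    then show ?thesis by (auto simp: d_def power_divide)
  qed
  note bound = this
  have "summable (\<lambda>n. (1 / 2 :: real) ^ Suc n)"
    unfolding summable_Suc_iff by (rule summable_geometric) simp
  then have "summable d" by (rule summable_comparison_test'[of _ 0 d]) (rule bound)
  then have "(\<lambda>n. of_int (the (s 0)) + (\<Sum>i<n. d i)) \<longlonglongrightarrow> of_int (the (s 0)) + suminf d"
    by (intro tendsto_intros summable_LIMSEQ)
  then show ?thesis unfolding S_val_def pv_def[abs_def] d_def .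
qed

lemma S_val_SI: assumes s: "s \<in> S_max" shows "S_val s \<in> SI s"
proof -
  have "\<bar>S_val s - pv s n\<bar> \<le> 1 / 2 ^ n" for n
  proof (rule LIMSEQ_le_const2)
    show "(\<lambda>m. \<bar>pv s (m + n) - pv s n\<bar>) \<longlonglongrightarrow> \<bar>S_val s - pv s n\<bar>"
      by (intro tendsto_intros LIMSEQ_ignore_initial_segment pv_tendsto s)
    have "\<bar>pv s (m + n) - pv s n\<bar> \<le> 1 / 2 ^ n" for m
    proof -
      have "0 \<le> 1 / (2::real) ^ (n + m)" by simp
      then show ?thesis using pv_Cauchy[OF s, of n m] unfolding add.commute[of n m] by linarith
    qed
    then show "\<exists>N. \<forall>m\<ge>N. \<bar>pv s (m + n) - pv s n\<bar> \<le> 1 / 2 ^ n" by auto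
  qed
  then show ?thesis by (simp add: SI_def)
qed

lemma half_pow_tendsto: "(\<lambda>n. 1 / (2::real) ^ n) \<longlonglongrightarrow> 0"
  using LIMSEQ_realpow_zero[of "1/2::real"] by (simp add: power_divide)

lemma SI_max: assumes "s \<in> S_max" "x \<in> SI s" shows "x = S_val s"
proof (rule LIMSEQ_unique)
  show "pv s \<longlonglongrightarrow> S_val s" using pv_tendsto assms by simp
  have "(\<lambda>n. pv s n - x) \<longlonglongrightarrow> 0"
  proof (rule Lim_null_comparison[OF _ half_pow_tendsto])
    show "\<forall>\<^sub>F n in sequentially. norm (pv s n - x) \<le> 1 / 2 ^ n"
      using SI_D[OF assms(2)] assms(1) by (simp add: S_max_iff abs_minus_commute)
  qed
  then show "pv s \<longlonglongrightarrow> x" by (simp add: LIM_zero_iff)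
qed

text \<open>Choosing the middle digit whenever the remainder is at most \<open>2/3\<close> of the radius keeps
  a bound \<open>c \<ge> 2/3\<close> on the relative remainder; the strict case \<open>c = 2/3\<close> yields
  representations of \<open>x\<close> all of whose initial segments describe neighbourhoods of \<open>x\<close>.\<close>

lemma digits_exist:
  fixes x c :: real
  assumes s: "s \<in> S_seqs" and c: "2 / 3 \<le> c" "c \<le> 1"
    and x: "\<And>n. s n \<noteq> None \<Longrightarrow> \<bar>x - pv s n\<bar> \<le> c / 2 ^ n"
  obtains d where "d \<in> S_max" "s \<subseteq>\<^sub>m d" "\<And>n. \<bar>x - pv d n\<bar> \<le> c / 2 ^ n"
proof -
  define P where "P n = (\<lambda>(b::int, v::real). \<bar>x - v\<bar> \<le> c / 2 ^ n \<and> (n = 0 \<longrightarrow> v = of_int b) \<and>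
    (s n \<noteq> None \<longrightarrow> s n = Some b \<and> v = pv s n))" for n
  define Q where "Q n = (\<lambda>(b::int, v::real) (b'::int, v'::real). b' \<in> {-1, 0, 1} \<and> v' = v + of_int b' / 2 ^ Suc n)" for n :: nat
  have "\<exists>f. \<forall>n. P n (f n) \<and> Q n (f n) (f (Suc n))"
  proof (rule dependent_nat_choice)
    show "\<exists>p. P 0 p"
    proof (cases "s 0")
      case None
      have "\<bar>x - of_int (round x)\<bar> \<le> 1 / 2" using of_int_round_abs_le[of x] by (simp add: abs_minus_commute)
      then show ?thesis using None c by (intro exI[of _ "(round x, of_int (round x))"]) (auto simp: P_def)
    next
      case (Some a)
      then show ?thesis using x[of 0] by (intro exI[of _ "(a, of_int a)"]) (auto simp: P_def pv_def)
    qed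
  next
    fix p n assume "P n p"
    then obtain b v where p: "p = (b, v)" "\<bar>x - v\<bar> \<le> c / 2 ^ n" "s n \<noteq> None \<Longrightarrow> v = pv s n"
      by (cases p) (auto simp: P_def)
    show "\<exists>q. P (Suc n) q \<and> Q n p q"
    proof (cases "s (Suc n)")
      case (Some b')
      then have "s n \<noteq> None" using S_seqs_down[OF s, of "Suc n" n] by simp
      then have "pv s (Suc n) = v + of_int b' / 2 ^ Suc n" using p(3) Some by (simp add: pv_Suc)
      then show ?thesis using Some x[of "Suc n"] S_seqs_digit[OF s Some]
        by (intro exI[of _ "(b', pv s (Suc n))"]) (auto simp: P_def Q_def p)
    next
      case None
      define h :: real where "h = 1 / 2 ^ Suc n"
      have h: "h > 0" "c / 2 ^ n = 2 * c * h" "c / 2 ^ Suc n = c * h" "\<And>b. of_int b / 2 ^ Suc n = of_int b * h"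
        by (simp_all add: h_def)
      \<comment> \<open>After the digit 1 the remainder lies between -h/3 and (2c - 1)h, and c at
        most 1 bounds the latter by ch; the digit -1 is symmetric. After 0 the remainder is at most
        2h/3, whence c at least 2/3.\<close>
      define b' :: int where "b' = (if x - v < - (2 / 3) * h then -1 else if x - v > 2 / 3 * h then 1 else 0)"
      have ch: "2 / 3 * h \<le> c * h" "c * h \<le> h" using c h by (simp_all add: mult_right_mono)
      have p2: "\<bar>x - v\<bar> \<le> 2 * (c * h)" using p(2) unfolding h(2) by simp
      have "\<bar>x - (v + of_int b' * h)\<bar> \<le> c * h"
      proof (cases "x - v < - (2 / 3) * h")
        case True
        then have "b' = -1" by (simp add: b'_def)
        then show ?thesis using True p2 ch by (simp only: of_int_minus of_int_1; linarith)
      next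
        case F: False
        show ?thesis
        proof (cases "x - v > 2 / 3 * h")
          case True
          then have "b' = 1" using F by (simp add: b'_def)
          then show ?thesis using True p2 ch by (simp only: of_int_1; linarith)
        next
          case False
          then have "b' = 0" using F by (simp add: b'_def)
          then show ?thesis using False F ch by (simp only: of_int_0; linarith)
        qed
      qed
      then show ?thesis using None
        by (intro exI[of _ "(b', v + of_int b' * h)"]) (auto simp: P_def Q_def p h b'_def simp del: power_Suc)
    qed
  qed
  then obtain f where f: "\<And>n. P n (f n)" "\<And>n. Q n (f n) (f (Suc n))" by blast
  define d where "d n = Some (fst (f n))" for n
  have pvd: "pv d n = snd (f n)" for n
  proof (induction n)
    case 0 then show ?case using f(1)[of 0] by (auto simp: pv_def d_def P_def split: prod.splits)
  next
    case (Suc n)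
    then show ?case using f(2)[of n] by (auto simp: pv_Suc d_def Q_def split: prod.splits simp del: power_Suc)
  qed
  have "d \<in> S_max"
    unfolding S_max_iff
  proof
    show "d \<in> S_seqs"
    proof (rule S_seqsI)
      show "b \<in> {-1, 0, 1}" if "d (Suc i) = Some b" for i b
        using f(2)[of i] that by (auto simp: Q_def d_def split: prod.splits)
    qed (simp add: d_def)
  qed (simp add: d_def)
  moreover have "s \<subseteq>\<^sub>m d"
  proof (rule map_leI)
    fix n assume "s n \<noteq> None"
    then show "d n = s n" using f(1)[of n] by (auto simp: P_def d_def split: prod.splits)
  qed
  moreover have "\<bar>x - pv d n\<bar> \<le> c / 2 ^ n" for n
    using f(1)[of n] unfolding pvd by (auto simp: P_def split: prod.splits)
  ultimately show thesis using that by metis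
qed

lemma SI_extend:
  assumes "s \<in> S_seqs" "x \<in> SI s"
  obtains d where "d \<in> S_max" "s \<subseteq>\<^sub>m d" "S_val d = x"
proof -
  obtain d where d: "d \<in> S_max" "s \<subseteq>\<^sub>m d" "\<And>n. \<bar>x - pv d n\<bar> \<le> 1 / 2 ^ n"
    using digits_exist[of s 1 x] assms SI_D by auto
  then have "x \<in> SI d" by (simp add: SI_def)
  then show thesis using SI_max d that by metis
qed

lemma strict_digits:
  obtains d where "d \<in> S_max" "S_val d = x" "\<And>n. \<bar>x - pv d n\<bar> < 1 / 2 ^ n"
proof -
  obtain d where d: "d \<in> S_max" "\<And>n. \<bar>x - pv d n\<bar> \<le> (2 / 3) / 2 ^ n"
    using digits_exist[of Map.empty "2/3" x] by auto
  have lt: "\<bar>x - pv d n\<bar> < 1 / 2 ^ n" for n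
  proof -
    have "(2 / 3) / 2 ^ n < 1 / (2::real) ^ n" by (intro divide_strict_right_mono) auto
    then show ?thesis using d(2)[of n] by linarith
  qed
  then have "x \<in> SI d" by (simp add: SI_def less_imp_le)
  then show thesis using SI_max d lt that by metis
qed

lemma SI_nonempty: "s \<in> S_seqs \<Longrightarrow> SI s \<noteq> {}"
proof (cases "s = Map.empty")
  case False
  assume s: "s \<in> S_seqs"
  define t where "t n = (if s n = None then Some 0 else s n)" for n
  have "t \<in> S_seqs"
  proof (rule S_seqsI)
    show "b \<in> {-1, 0, 1}" if "t (Suc i) = Some b" for i b
      using that S_seqs_digit[OF s, of i b] by (auto simp: t_def split: if_splits)
  qed (simp add: t_def split: if_splits)
  then have "t \<in> S_max" by (simp add: S_max_iff t_def)
  moreover have "s \<subseteq>\<^sub>m t" by (rule map_leI) (simp add: t_def)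
  ultimately show ?thesis using S_val_SI SI_mono[OF s] by (metis empty_iff subsetD)
qed simp

text \<open>By \<open>SI_extend\<close> every point of \<open>SI s\<close> is the value of a maximal
  extension of s. Smoothness can thus be proved by exhibiting a common real number.\<close>

lemma S_sim_iff: "s \<in> S_seqs \<Longrightarrow> t \<in> S_seqs \<Longrightarrow> S_sim s t \<longleftrightarrow> SI s \<inter> SI t \<noteq> {}"
proof
  assume st: "s \<in> S_seqs" "t \<in> S_seqs"
  show "SI s \<inter> SI t \<noteq> {}" if sim: "S_sim s t"
  proof -
    obtain s' t' where *: "s' \<in> S_max" "t' \<in> S_max" "s \<subseteq>\<^sub>m s'" "t \<subseteq>\<^sub>m t'" "S_val s' = S_val t'"
      using sim by (auto simp: S_sim_def)
    have "S_val s' \<in> SI s" using S_val_SI[OF *(1)] SI_mono[OF st(1) *(3)] by auto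
    moreover have "S_val s' \<in> SI t" using S_val_SI[OF *(2)] SI_mono[OF st(2) *(4)] *(5) by auto
    ultimately show ?thesis by auto
  qed
  show "S_sim s t" if ne: "SI s \<inter> SI t \<noteq> {}"
  proof -
    obtain x where x: "x \<in> SI s" "x \<in> SI t" using ne by auto
    obtain d where d: "d \<in> S_max" "s \<subseteq>\<^sub>m d" "S_val d = x" using SI_extend[OF st(1) x(1)] by metis
    obtain e where e: "e \<in> S_max" "t \<subseteq>\<^sub>m e" "S_val e = x" using SI_extend[OF st(2) x(2)] by metis
    show ?thesis unfolding S_sim_def using d e by metis
  qed
qed

text \<open>Truncation alone would have infinite image, since the first entry ranges over all
  integers; hence the test on its size.\<close>

definition S_pr :: "nat \<Rightarrow> digits \<Rightarrow> digits" where
  "S_pr n s = (if \<forall>a. s 0 = Some a \<longrightarrow> \<bar>a\<bar> \<le> int n then s |` {..<n} else Map.empty)"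

lemma S_pr_in [simp]: "s \<in> S_seqs \<Longrightarrow> S_pr n s \<in> S_seqs"
  by (simp add: S_pr_def)

lemma S_pr_restrict: "S_pr n s \<subseteq>\<^sub>m s |` {..<n}"
  by (simp add: S_pr_def)

lemma S_pr_le: "S_pr n s \<subseteq>\<^sub>m s"
  by (simp add: S_pr_def)

lemma S_pr_eq: "\<forall>a. s 0 = Some a \<longrightarrow> \<bar>a\<bar> \<le> int n \<Longrightarrow> S_pr n s = s |` {..<n}"
  by (simp add: S_pr_def)

lemma S_pr_eventually: "\<exists>N. \<forall>n\<ge>N. S_pr n s = s |` {..<n}"
proof (cases "s 0")
  case None then show ?thesis by (intro exI[of _ 0]) (simp add: S_pr_def)
next
  case (Some a)
  then show ?thesis by (intro exI[of _ "nat \<bar>a\<bar>"]) (auto simp: S_pr_def)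
qed

lemma S_pr_attain: "s i \<noteq> None \<Longrightarrow> \<exists>N. \<forall>n\<ge>N. S_pr n s i = s i"
proof -
  obtain N where N: "\<forall>n\<ge>N. S_pr n s = s |` {..<n}" using S_pr_eventually by auto
  then show ?thesis by (intro exI[of _ "max N (Suc i)"]) auto
qed

definition msup :: "digits set \<Rightarrow> digits" where
  "msup D i = (if \<exists>d\<in>D. d i \<noteq> None then (SOME b. b \<noteq> None \<and> (\<exists>d\<in>D. d i = b)) else None)"

lemma msup_attain: "msup D i \<noteq> None \<Longrightarrow> \<exists>d\<in>D. d i = msup D i"
proof -
  assume "msup D i \<noteq> None"
  then have ex: "\<exists>d\<in>D. d i \<noteq> None" by (auto simp: msup_def split: if_splits)
  then have "\<exists>b. b \<noteq> None \<and> (\<exists>d\<in>D. d i = b)" by auto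
  from someI_ex[OF this] show ?thesis using ex by (simp add: msup_def)
qed

lemma msup_upper:
  assumes "\<And>x y. x \<in> D \<Longrightarrow> y \<in> D \<Longrightarrow> \<exists>z\<in>D. x \<subseteq>\<^sub>m z \<and> y \<subseteq>\<^sub>m z" "d \<in> D"
  shows "d \<subseteq>\<^sub>m msup D"
proof (rule map_leI)
  fix i assume d: "d i \<noteq> None"
  then have "\<exists>b. b \<noteq> None \<and> (\<exists>d\<in>D. d i = b)" using assms(2) by auto
  from someI_ex[OF this] have s: "msup D i \<noteq> None \<and> (\<exists>d\<in>D. d i = msup D i)"
    using assms(2) d by (auto simp: msup_def)
  then obtain e where e: "e \<in> D" "e i = msup D i" by auto
  obtain z where "z \<in> D" "d \<subseteq>\<^sub>m z" "e \<subseteq>\<^sub>m z" using assms(1)[OF assms(2) e(1)] by auto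
  then show "msup D i = d i" using map_leD[of d z i] map_leD[of e z i] d e s by auto
qed

lemma msup_least: "(\<And>d. d \<in> D \<Longrightarrow> d \<subseteq>\<^sub>m u) \<Longrightarrow> msup D \<subseteq>\<^sub>m u"
proof (rule map_leI)
  fix i assume u: "\<And>d. d \<in> D \<Longrightarrow> d \<subseteq>\<^sub>m u" and m: "msup D i \<noteq> None"
  obtain d where "d \<in> D" "d i = msup D i" using msup_attain[OF m] by auto
  then show "u i = msup D i" using map_leD[OF u, of d i] m by auto
qed

lemma msup_S_seqs:
  assumes "\<And>x y. x \<in> D \<Longrightarrow> y \<in> D \<Longrightarrow> \<exists>z\<in>D. x \<subseteq>\<^sub>m z \<and> y \<subseteq>\<^sub>m z" "D \<subseteq> S_seqs"
  shows "msup D \<in> S_seqs"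
proof (rule S_seqsI)
  show "msup D (Suc i) = None" if "msup D i = None" for i
  proof (rule ccontr)
    assume n: "msup D (Suc i) \<noteq> None"
    then obtain d where d: "d \<in> D" "d (Suc i) = msup D (Suc i)" using msup_attain by metis
    then have "d i \<noteq> None" using S_seqs_down[of d "Suc i" i] assms(2) n by auto
    then show False using map_leD[OF msup_upper[OF assms(1) d(1)], of i] that by simp
  qed
  show "b \<in> {-1, 0, 1}" if "msup D (Suc i) = Some b" for i b
  proof -
    have "msup D (Suc i) \<noteq> None" using that by simp
    then obtain d where "d \<in> D" "d (Suc i) = msup D (Suc i)" using msup_attain by metis
    then show ?thesis using S_seqs_digit[of d i b] assms(2) that by auto
  qed
qed

lemma directed_msup:
  assumes "directed_in (\<subseteq>\<^sub>m) S_seqs D"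
  shows "lub_in (\<subseteq>\<^sub>m) S_seqs D (msup D)"
proof -
  have D: "\<exists>z\<in>D. x \<subseteq>\<^sub>m z \<and> y \<subseteq>\<^sub>m z" if "x \<in> D" "y \<in> D" for x y
    using assms that by (simp add: directed_in_def)
  have "D \<subseteq> S_seqs" using assms by (simp add: directed_in_def)
  then have "msup D \<in> S_seqs" using msup_S_seqs D by metis
  moreover have "d \<subseteq>\<^sub>m msup D" if "d \<in> D" for d using msup_upper[OF D that] .
  moreover have "msup D \<subseteq>\<^sub>m u" if "\<And>d. d \<in> D \<Longrightarrow> d \<subseteq>\<^sub>m u" for u using msup_least that by metis
  ultimately show ?thesis by (simp add: lub_in_def)
qed

lemma pdom_S: "pdom S_seqs (\<subseteq>\<^sub>m) S_pr"
proof
  show "S_seqs \<noteq> {}" using empty_S_seqs by blast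
  show "x \<subseteq>\<^sub>m x" for x :: digits by simp
  show "x = y" if "x \<subseteq>\<^sub>m y" "y \<subseteq>\<^sub>m x" for x y :: digits using that by (rule map_le_antisym)
  show "x \<subseteq>\<^sub>m z" if "x \<subseteq>\<^sub>m y" "y \<subseteq>\<^sub>m z" for x y z :: digits using that by (rule map_le_trans)
  show "S_pr n x \<in> S_seqs" if "x \<in> S_seqs" for x n using that by simp
  show "S_pr n x \<subseteq>\<^sub>m x" for x n by (rule S_pr_le)
  show "S_pr n x \<subseteq>\<^sub>m S_pr n y" if "x \<in> S_seqs" "x \<subseteq>\<^sub>m y" for x y n
  proof (rule map_leI)
    fix i assume i: "S_pr n x i \<noteq> None"
    then have xi: "x i \<noteq> None" "i < n" "\<forall>a. x 0 = Some a \<longrightarrow> \<bar>a\<bar> \<le> int n" "S_pr n x i = x i"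
      by (auto simp: S_pr_def restrict_map_def split: if_splits)
    have "y 0 = x 0" using S_seqs_down[OF that(1) xi(1)] map_leD[OF that(2)] by simp
    then show "S_pr n y i = S_pr n x i"
      using xi map_leD[OF that(2) xi(1)] by (simp add: S_pr_def)
  qed
  show "S_pr n (S_pr n x) = S_pr n x" for x n
    by (cases "x 0") (auto simp: S_pr_def restrict_map_def fun_eq_iff)
  show "S_pr m x \<subseteq>\<^sub>m S_pr n x" if "m \<le> n" for x m n
  proof (rule map_leI)
    fix i assume i: "S_pr m x i \<noteq> None"
    then have xi: "i < m" "\<forall>a. x 0 = Some a \<longrightarrow> \<bar>a\<bar> \<le> int m" "S_pr m x i = x i"
      by (auto simp: S_pr_def restrict_map_def split: if_splits)
    then have "\<forall>a. x 0 = Some a \<longrightarrow> \<bar>a\<bar> \<le> int n" using that by auto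
    then show "S_pr n x i = S_pr m x i" using xi that by (simp add: S_pr_def)
  qed
  show "finite (S_pr n ` S_seqs)" for n
  proof (rule finite_subset)
    let ?B = "{- (int n + 1) .. int n + 1}"
    show "S_pr n ` S_seqs \<subseteq> (\<Union>A\<in>Pow {..<n}. {m. dom m = A \<and> ran m \<subseteq> ?B})"
    proof
      fix t assume "t \<in> S_pr n ` S_seqs"
      then obtain s where s: "s \<in> S_seqs" "t = S_pr n s" by auto
      have "b \<in> ?B" if "t i = Some b" for i b
      proof (cases i)
        case 0
        then have "s 0 = Some b" "\<forall>a. s 0 = Some a \<longrightarrow> \<bar>a\<bar> \<le> int n"
          using that s by (auto simp: S_pr_def restrict_map_def split: if_splits)
        then show ?thesis by auto
      next
        case (Suc j)
        then have "s (Suc j) = Some b"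
          using that s by (auto simp: S_pr_def restrict_map_def split: if_splits)
        then show ?thesis using S_seqs_digit[OF s(1)] by fastforce
      qed
      then have "ran t \<subseteq> ?B" by (auto simp: ran_def)
      moreover have "dom t \<subseteq> {..<n}"
        using s by (auto simp: S_pr_def restrict_map_def split: if_splits)
      ultimately show "t \<in> (\<Union>A\<in>Pow {..<n}. {m. dom m = A \<and> ran m \<subseteq> ?B})" by auto
    qed
    show "finite (\<Union>A\<in>Pow {..<n}. {m :: digits. dom m = A \<and> ran m \<subseteq> ?B})"
    proof (rule finite_UN_I)
      fix A :: "nat set" assume "A \<in> Pow {..<n}"
      then have "finite A" using finite_subset by auto
      then show "finite {m :: digits. dom m = A \<and> ran m \<subseteq> ?B}" by (rule finite_set_of_finite_maps) simp
    qed simp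
  qed
  show "x \<subseteq>\<^sub>m u" if "\<And>n. S_pr n x \<subseteq>\<^sub>m u" for x u
  proof (rule map_leI)
    fix i assume i: "x i \<noteq> None"
    then obtain N where "S_pr N x i = x i" using S_pr_attain by blast
    then show "u i = x i" using map_leD[OF that[of N], of i] i by simp
  qed
  show "\<exists>s. lub_in (\<subseteq>\<^sub>m) S_seqs D s" if "directed_in (\<subseteq>\<^sub>m) S_seqs D" for D
    using directed_msup[OF that] by (rule exI[of _ "msup D"])
  show "\<exists>d\<in>D. S_pr n s \<subseteq>\<^sub>m d" if D: "directed_in (\<subseteq>\<^sub>m) S_seqs D" and s: "lub_in (\<subseteq>\<^sub>m) S_seqs D s" for D s n
  proof -
    have "s \<subseteq>\<^sub>m msup D" using s directed_msup[OF D] by (simp add: lub_in_def)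
    have dir: "\<exists>z\<in>D. x \<subseteq>\<^sub>m z \<and> y \<subseteq>\<^sub>m z" if "x \<in> D" "y \<in> D" for x y
      using D that by (simp add: directed_in_def)
    have "\<exists>d\<in>D. \<forall>i<m. s i \<noteq> None \<longrightarrow> d i = s i" for m
    proof (induction m)
      case 0 then show ?case using D by (auto simp: directed_in_def)
    next
      case (Suc m)
      then obtain d where d: "d \<in> D" "\<forall>i<m. s i \<noteq> None \<longrightarrow> d i = s i" by auto
      show ?case
      proof (cases "s m = None")
        case True
        then have "\<forall>i<Suc m. s i \<noteq> None \<longrightarrow> d i = s i" using d by (auto simp: less_Suc_eq)
        then show ?thesis using d by auto
      next
        case False
        then have m: "msup D m = s m" using map_leD[OF \<open>s \<subseteq>\<^sub>m msup D\<close>] by simp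
        then obtain e where e: "e \<in> D" "e m = s m" using msup_attain[of D m] False by auto
        obtain z where z: "z \<in> D" "d \<subseteq>\<^sub>m z" "e \<subseteq>\<^sub>m z" using dir[OF d(1) e(1)] by auto
        have "z i = s i" if "i < Suc m" "s i \<noteq> None" for i
        proof (cases "i = m")
          case True then show ?thesis using map_leD[OF z(3), of m] e(2) False by simp
        next
          case False
          then have "d i = s i" using d(2) that by simp
          then show ?thesis using map_leD[OF z(2), of i] that by simp
        qed
        then show ?thesis using z(1) by auto
      qed
    qed
    then obtain d where d: "d \<in> D" "\<forall>i<n. s i \<noteq> None \<longrightarrow> d i = s i" by blast
    have "S_pr n s \<subseteq>\<^sub>m d"
    proof (rule map_leI)
      fix i assume "S_pr n s i \<noteq> None"
      then have "i < n" "s i \<noteq> None" "S_pr n s i = s i"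
        by (auto simp: S_pr_def restrict_map_def split: if_splits)
      then show "d i = S_pr n s i" using d by simp
    qed
    then show ?thesis using d by auto
  qed
qed

lemma S_sim_down:
  assumes "S_sim s t" "s' \<subseteq>\<^sub>m s" "t' \<subseteq>\<^sub>m t" shows "S_sim s' t'"
proof -
  obtain u v where "u \<in> S_max" "v \<in> S_max" "s \<subseteq>\<^sub>m u" "t \<subseteq>\<^sub>m v" "S_val u = S_val v"
    using assms(1) by (auto simp: S_sim_def)
  moreover from this have "s' \<subseteq>\<^sub>m u" "t' \<subseteq>\<^sub>m v" using assms(2,3) map_le_trans by metis+
  ultimately show ?thesis unfolding S_sim_def by metis
qed

lemma SI_eq_pr:
  assumes "\<And>n. n \<ge> N \<Longrightarrow> x \<in> SI (S_pr n s)" shows "x \<in> SI s"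
  unfolding SI_def
proof (intro CollectI allI impI)
  fix i assume i: "s i \<noteq> None"
  obtain M where M: "\<forall>n\<ge>M. S_pr n s = s |` {..<n}" using S_pr_eventually by blast
  define n where "n = max (max M N) (Suc i)"
  have n: "S_pr n s = s |` {..<n}" "n \<ge> N" "i < n" using M by (auto simp: n_def)
  have "x \<in> SI (s |` {..<n})" using assms[OF n(2)] n(1) by simp
  moreover have "(s |` {..<n}) i \<noteq> None" using i n by simp
  moreover have "pv (s |` {..<n}) i = pv s i" by (rule pv_cong) (use n in auto)
  ultimately show "\<bar>x - pv s i\<bar> \<le> 1 / 2 ^ i" using SI_D by metis
qed

text \<open>If a first entry is missing, the sequence is empty and its set of values is the whole
  line. Otherwise, once the projections keep the first entry, the intersections are nested nonempty
  compact sets and have a common point.\<close>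

lemma S_sim_lim:
  assumes s: "s \<in> S_seqs" and t: "t \<in> S_seqs" and sim: "\<And>n. S_sim (S_pr n s) (S_pr n t)"
  shows "S_sim s t"
proof (cases "s 0 = None \<or> t 0 = None")
  case True
  then have "s = Map.empty \<or> t = Map.empty"
    using S_seqs_None[OF s] S_seqs_None[OF t] by auto
  then show ?thesis using S_sim_iff[OF s t] SI_nonempty[OF s] SI_nonempty[OF t] by auto
next
  case False
  then obtain N where N: "\<forall>n\<ge>N. S_pr n s 0 = s 0" using S_pr_attain by blast
  define F where "F n = SI (S_pr (N + n) s) \<inter> SI (S_pr (N + n) t)" for n
  have "\<Inter>(range F) \<noteq> {}"
  proof (rule compact_nest)
    show "compact (F n)" for n
      unfolding F_def using N False by (intro compact_Int_closed compact_SI closed_SI) auto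
    show "F n \<noteq> {}" for n
      unfolding F_def using sim S_sim_iff s t by simp
    show "F n \<subseteq> F m" if "m \<le> n" for m n
    proof -
      have "S_pr (N + m) u \<subseteq>\<^sub>m S_pr (N + n) u" if "u \<in> S_seqs" for u
        using pdom.pr_incr[OF pdom_S that] \<open>m \<le> n\<close> by simp
      then show ?thesis unfolding F_def
        using SI_mono[OF S_pr_in[OF s]] SI_mono[OF S_pr_in[OF t]] s t by (intro Int_mono) auto
    qed
  qed
  then obtain x where x: "\<And>n. x \<in> F n" by auto
  have "x \<in> SI (S_pr n s) \<and> x \<in> SI (S_pr n t)" if "n \<ge> N" for n
    using x[of "n - N"] that by (simp add: F_def)
  then have "x \<in> SI s" "x \<in> SI t" using SI_eq_pr by metis+
  then show ?thesis using S_sim_iff[OF s t] by auto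
qed

lemma S_sim_max: "s \<in> S_max \<Longrightarrow> t \<in> S_max \<Longrightarrow> S_sim s t \<longleftrightarrow> S_val s = S_val t"
  unfolding S_sim_def using S_max_extends by (metis map_le_refl)

lemma S_eq_iff: "S_eq s t \<longleftrightarrow> S_eq s s \<and> S_eq t t \<and> S_val s = S_val t"
  using S_sim_max by (auto simp: S_eq_def)

lemma S_eq_self: "S_eq s s \<longleftrightarrow> s \<in> S_max"
  using S_sim_max by (auto simp: S_eq_def)

lemma S_sims_eq: "S_sims k = simh S_sim S_dom k"
  by (induction k) (auto simp: fun_eq_iff)

interpretation S: thier S_seqs "(\<subseteq>\<^sub>m)" S_pr S_sim S_dom S_eq S_val
proof (intro thier.intro hier.intro hier_axioms.intro thier_axioms.intro pdom_S S_eq_iff)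
  show "S_sim x' y'" if "S_sim x y" "x' \<subseteq>\<^sub>m x" "y' \<subseteq>\<^sub>m y" for x y x' y'
    using that by (rule S_sim_down)
  show "S_sim x y" if "x \<in> S_seqs" "y \<in> S_seqs" "\<And>n. S_sim (S_pr n x) (S_pr n y)" for x y
    using that by (rule S_sim_lim)
  show "\<exists>b\<in>S_seqs. S_sim b b"
    by (rule bexI[of _ Map.empty]) (simp_all add: S_sim_iff)
  show "S_dom 0 = Base ` S_seqs" by simp
  show "S_dom (Suc k) = fspace (S_dom k) (pointwise (\<subseteq>\<^sub>m)) (simh S_sim S_dom k) S_seqs (\<subseteq>\<^sub>m) S_sim" for k
    by (simp add: fspace_def S_sims_eq)
  show "(\<lambda>i. S_val (b i)) \<longlonglongrightarrow> S_val a"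
    if a: "a \<in> S_seqs" "S_eq a a" and b: "\<And>i. b i \<in> S_seqs" "\<And>i. S_eq (b i) (b i)"
      and c: "\<And>n. \<forall>\<^sub>F i in sequentially. S_pr n a \<subseteq>\<^sub>m b i" for a and b :: "nat \<Rightarrow> _"
  proof (rule tendstoI)
    fix e :: real assume "e > 0"
    then have "\<forall>\<^sub>F n in sequentially. 1 / (2::real) ^ n < e / 2"
      by (intro order_tendstoD(2)[OF half_pow_tendsto]) simp
    then obtain n where n: "1 / (2::real) ^ n < e / 2" by (auto simp: eventually_sequentially)
    have am: "a \<in> S_max" "\<And>i. b i \<in> S_max" using a b S_eq_self by auto
    then have "a n \<noteq> None" by (simp add: S_max_iff)
    then obtain N where N: "S_pr N a n = a n" using S_pr_attain by blast
    show "\<forall>\<^sub>F i in sequentially. dist (S_val (b i)) (S_val a) < e"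
      using c[of N]
    proof eventually_elim
      case (elim i)
      have Nn: "S_pr N a n \<noteq> None" using N \<open>a n \<noteq> None\<close> by simp
      have "S_val (b i) \<in> SI (S_pr N a)" "S_val a \<in> SI (S_pr N a)"
        using S_val_SI[OF am(2)] S_val_SI[OF am(1)] SI_mono[OF S_pr_in[OF a(1)] elim]
          SI_mono[OF S_pr_in[OF a(1)] S_pr_le] by auto
      from SI_D[OF this(1) Nn] SI_D[OF this(2) Nn] n show ?case
        by (simp add: dist_real_def)
    qed
  qed
qed

lemma S_adm_0: "S.adm 0"
proof (rule S.adm_0)
  fix t :: "nat \<Rightarrow> real" and t0 assume t: "t \<longlonglongrightarrow> t0"
  obtain d where d: "d \<in> S_max" "S_val d = t0" "\<And>n. \<bar>t0 - pv d n\<bar> < 1 / 2 ^ n"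
    using strict_digits by metis
  have dS: "d \<in> S_seqs" using d by (simp add: S_max_iff)
  \<comment> \<open>\<open>N m\<close> will be the length of the longest initial segment of d
    compatible with \<open>t m\<close>; the cap at m makes the maximum exist. The strict
    inequalities for d make each fixed segment compatible for almost all m.\<close>
  define P where "P m N \<longleftrightarrow> N \<le> m \<and> (\<forall>i<N. \<bar>t m - pv d i\<bar> \<le> 1 / 2 ^ i)" for m N
  define N where "N m = (GREATEST N. P m N)" for m
  have P: "P m (N m)" for m
    unfolding N_def by (rule GreatestI_nat[of "P m" 0 m]) (auto simp: P_def)
  have "\<exists>e. e \<in> S_max \<and> d |` {..<N m} \<subseteq>\<^sub>m e \<and> S_val e = t m" for m
  proof -
    have "t m \<in> SI (d |` {..<N m})"
      unfolding SI_def
    proof (intro CollectI allI impI)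
      fix i assume "(d |` {..<N m}) i \<noteq> None"
      then have i: "i < N m" by (auto simp: restrict_map_def split: if_splits)
      have "pv (d |` {..<N m}) i = pv d i" by (rule pv_cong) (use i in auto)
      then show "\<bar>t m - pv (d |` {..<N m}) i\<bar> \<le> 1 / 2 ^ i" using P[of m] i by (simp add: P_def)
    qed
    then show ?thesis using SI_extend[OF restrict_S_seqs[OF dS]] by metis
  qed
  then obtain e where e: "\<And>m. e m \<in> S_max" "\<And>m. d |` {..<N m} \<subseteq>\<^sub>m e m" "\<And>m. S_val (e m) = t m" by metis
  have "\<forall>\<^sub>F m in sequentially. S_pr n d \<subseteq>\<^sub>m e m" for n
  proof -
    have "\<forall>\<^sub>F m in sequentially. \<bar>t m - pv d i\<bar> < 1 / 2 ^ i" for i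
      by (rule order_tendstoD(2)[OF _ d(3)]) (intro tendsto_intros t)
    then have "\<forall>\<^sub>F m in sequentially. \<forall>i\<in>{..<n}. \<bar>t m - pv d i\<bar> < 1 / 2 ^ i"
      by (intro eventually_ball_finite) auto
    then show ?thesis using eventually_ge_at_top[of n]
    proof eventually_elim
      case (elim m)
      then have "P m n" by (auto simp: P_def less_imp_le)
      then have "n \<le> N m" unfolding N_def by (rule Greatest_le_nat[of _ _ m]) (simp add: P_def)
      then have "d |` {..<n} \<subseteq>\<^sub>m d |` {..<N m}"
        by (intro map_leI) (auto simp: restrict_map_def split: if_splits)
      then show ?case using e(2)[of m] S_pr_restrict[of n d] map_le_trans by metis
    qed
  qed
  then show "\<exists>b a. (\<forall>i. b i \<in> S_seqs \<and> S_eq (b i) (b i) \<and> S_val (b i) = t i) \<and>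
     a \<in> S_seqs \<and> S_eq a a \<and> S_val a = t0 \<and> (\<forall>n. \<forall>\<^sub>F i in sequentially. S_pr n a \<subseteq>\<^sub>m b i)"
    using e d dS by (intro exI[of _ e] exI[of _ d]) (auto simp: S_eq_self S_max_iff)
qed

section \<open>Choosing digits greedily\<close>

text \<open>W is the set of values still possible. The step never excludes a value in W, may add
  several digits or none, and is a fixed function of s and W: equal histories of sets give equal
  digits.\<close>

definition extend :: "digits \<Rightarrow> real set \<Rightarrow> digits" where
  "extend s W = (if \<exists>t\<in>S_seqs. s \<subseteq>\<^sub>m t \<and> t \<noteq> s \<and> W \<subseteq> SI t
     then SOME t. t \<in> S_seqs \<and> s \<subseteq>\<^sub>m t \<and> t \<noteq> s \<and> W \<subseteq> SI t else s)"

primrec dg :: "(nat \<Rightarrow> real set) \<Rightarrow> nat \<Rightarrow> digits" where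
  "dg W 0 = extend Map.empty (W 0)"
| "dg W (Suc n) = extend (dg W n) (W (Suc n))"

lemma extend_cases:
  assumes "s \<in> S_seqs"
  obtains "extend s W = s" "\<not> (\<exists>t\<in>S_seqs. s \<subseteq>\<^sub>m t \<and> t \<noteq> s \<and> W \<subseteq> SI t)"
  | "extend s W \<in> S_seqs" "s \<subseteq>\<^sub>m extend s W" "extend s W \<noteq> s" "W \<subseteq> SI (extend s W)"
proof (cases "\<exists>t\<in>S_seqs. s \<subseteq>\<^sub>m t \<and> t \<noteq> s \<and> W \<subseteq> SI t")
  case True
  then have "\<exists>t. t \<in> S_seqs \<and> s \<subseteq>\<^sub>m t \<and> t \<noteq> s \<and> W \<subseteq> SI t" by auto
  from someI_ex[OF this] show thesis using True that(2) by (simp add: extend_def)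
next
  case False
  then show thesis using that(1) by (simp add: extend_def)
qed

lemma extend_in: "s \<in> S_seqs \<Longrightarrow> extend s W \<in> S_seqs"
  by (rule extend_cases) auto

lemma extend_upper: "s \<in> S_seqs \<Longrightarrow> s \<subseteq>\<^sub>m extend s W"
  by (rule extend_cases[of s W]) auto

lemma extend_UNIV: assumes "s \<in> S_seqs" shows "extend s UNIV = s"
proof (rule extend_cases[OF assms, of UNIV])
  assume *: "s \<subseteq>\<^sub>m extend s UNIV" "extend s UNIV \<noteq> s" "UNIV \<subseteq> SI (extend s UNIV)"
  then obtain n where "extend s UNIV n \<noteq> s n" by (auto simp: fun_eq_iff)
  then have "extend s UNIV n \<noteq> None" using map_leD[OF *(1), of n] by (cases "s n") auto
  then show ?thesis using SI_not_UNIV *(3) by auto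
qed

lemma dg_in: "dg W n \<in> S_seqs"
  by (induction n) (auto intro: extend_in)

lemma dg_mono: "m \<le> n \<Longrightarrow> dg W m \<subseteq>\<^sub>m dg W n"
proof (induction n)
  case (Suc n)
  show ?case
  proof (cases "m = Suc n")
    case False
    then have "dg W m \<subseteq>\<^sub>m dg W n" using Suc by simp
    then show ?thesis using extend_upper[OF dg_in] map_le_trans by (metis dg.simps(2))
  qed simp
qed simp

lemma dg_cong: "(\<And>i. i \<le> n \<Longrightarrow> W i = V i) \<Longrightarrow> dg W n = dg V n"
  by (induction n) auto

lemma dg_UNIV: "W (Suc n) = UNIV \<Longrightarrow> dg W (Suc n) = dg W n"
  by (simp add: extend_UNIV dg_in)

text \<open>Only the inclusions up to stage n are assumed, because for a partial argument the sets
  jump to \<open>UNIV\<close> where its information ends.\<close>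

lemma dg_SI: "(\<And>i. i < n \<Longrightarrow> W (Suc i) \<subseteq> W i) \<Longrightarrow> W n \<subseteq> SI (dg W n)"
proof (induction n)
  case 0
  show ?case by (rule extend_cases[OF empty_S_seqs, of "W 0"]) auto
next
  case (Suc n)
  have IH: "W (Suc n) \<subseteq> SI (dg W n)" using Suc.IH Suc.prems Suc.prems[of n] by auto
  show ?case by (rule extend_cases[OF dg_in, of W n "W (Suc n)"]) (use IH in auto)
qed

lemma dg_directed:
  assumes "x \<in> range (dg W)" "y \<in> range (dg W)"
  shows "\<exists>z\<in>range (dg W). x \<subseteq>\<^sub>m z \<and> y \<subseteq>\<^sub>m z"
proof -
  obtain m n where "x = dg W m" "y = dg W n" using assms by auto
  then show ?thesis using dg_mono[of m "max m n" W] dg_mono[of n "max m n" W] by auto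
qed

definition dlim :: "(nat \<Rightarrow> real set) \<Rightarrow> digits" where
  "dlim W = msup (range (dg W))"

lemma dlim_in: "dlim W \<in> S_seqs"
  unfolding dlim_def by (rule msup_S_seqs[OF dg_directed]) (auto simp: dg_in)

lemma dg_le_dlim: "dg W n \<subseteq>\<^sub>m dlim W"
  unfolding dlim_def by (rule msup_upper[OF dg_directed]) auto

lemma dlim_least: "(\<And>n. dg W n \<subseteq>\<^sub>m u) \<Longrightarrow> dlim W \<subseteq>\<^sub>m u"
  unfolding dlim_def by (rule msup_least) auto

lemma dlim_restrict: "\<exists>N. dlim W |` {..<n} \<subseteq>\<^sub>m dg W N"
proof (induction n)
  case 0 then show ?case by auto
next
  case (Suc n)
  then obtain N where N: "dlim W |` {..<n} \<subseteq>\<^sub>m dg W N" by auto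
  obtain M where M: "dlim W n \<noteq> None \<Longrightarrow> dg W M n = dlim W n"
    unfolding dlim_def using msup_attain by (metis (no_types, lifting) imageE)
  have "dlim W |` {..<Suc n} \<subseteq>\<^sub>m dg W (max N M)"
  proof (rule map_leI)
    fix i assume i: "(dlim W |` {..<Suc n}) i \<noteq> None"
    then have i': "i < Suc n" "dlim W i \<noteq> None" by (auto simp: restrict_map_def split: if_splits)
    show "dg W (max N M) i = (dlim W |` {..<Suc n}) i"
    proof (cases "i = n")
      case True
      then have "dg W M i = dlim W i" using M i' by simp
      then show ?thesis using map_leD[OF dg_mono[of M "max N M" W], of i] i' by simp
    next
      case False
      then have "i < n" using i' by simp
      then have "dg W N i = dlim W i" using map_leD[OF N, of i] i' by simp
      then show ?thesis using map_leD[OF dg_mono[of N "max N M" W], of i] i' by simp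
    qed
  qed
  then show ?case by auto
qed

text \<open>The intervals of neighbouring signed digits overlap. With h = 1 / 2^l, a set within h/4
  of one of its points therefore fits into one of the candidate intervals of radius h.\<close>

lemma digit_step:
  assumes s: "s \<in> S_seqs" "s l = None" "\<And>j. j < l \<Longrightarrow> s j \<noteq> None"
    and W: "W \<subseteq> SI s" "c \<in> W" "\<And>w. w \<in> W \<Longrightarrow> \<bar>w - c\<bar> \<le> 1 / 2 ^ (l + 2)"
  shows "\<exists>t\<in>S_seqs. s \<subseteq>\<^sub>m t \<and> t \<noteq> s \<and> W \<subseteq> SI t"
proof -
  define h :: real where "h = 1 / 2 ^ l"
  have h: "h > 0" "1 / 2 ^ (l + 2) = h / 4" by (simp_all add: h_def)
  have near: "\<bar>w - c\<bar> \<le> h / 4" if "w \<in> W" for w using W(3)[OF that] h(2) by simp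
  obtain b :: int where b: "l > 0 \<Longrightarrow> b \<in> {-1, 0, 1}"
    "\<And>w. w \<in> W \<Longrightarrow> \<bar>w - (if l = 0 then of_int b else pv s (l - 1) + of_int b * h)\<bar> \<le> h"
  proof (cases l)
    case 0
    have "\<bar>c - of_int (round c)\<bar> \<le> 1 / 2" using of_int_round_abs_le[of c] by (simp add: abs_minus_commute)
    then have "\<bar>w - of_int (round c)\<bar> \<le> h" if "w \<in> W" for w
    proof -
      have "h = 1" using 0 by (simp add: h_def)
      then show ?thesis
        using near[OF that] \<open>\<bar>c - of_int (round c)\<bar> \<le> 1 / 2\<close> by linarith
    qed
    then show thesis using that[of "round c"] 0 by simp
  next
    case (Suc j)
    define v where "v = pv s j"
    have 2: "\<bar>w - v\<bar> \<le> 2 * h" if "w \<in> W" for w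
      using SI_D[of w s j] W(1) that s(3)[of j] Suc by (auto simp: v_def h_def)
    \<comment> \<open>If |c - v| is at most h/2, all of W is within 3h/4 of v. If c - v exceeds h/2,
      then W lies between v and v + 2h, hence within h of v + h.\<close>
    consider "c - v < - h / 2" | "c - v > h / 2" | "\<bar>c - v\<bar> \<le> h / 2" by linarith
    then show thesis
    proof cases
      case 1
      have "\<bar>w - (v + of_int (-1) * h)\<bar> \<le> h" if "w \<in> W" for w
        using near[OF that] 2[OF that] 1 h(1) by (simp only: of_int_minus of_int_1; linarith)
      then show thesis using that[of "-1"] Suc by (simp add: v_def)
    next
      case 2
      have "\<bar>w - (v + of_int 1 * h)\<bar> \<le> h" if "w \<in> W" for w
        using near[OF that] \<open>\<And>w. w \<in> W \<Longrightarrow> \<bar>w - v\<bar> \<le> 2 * h\<close>[OF that] 2 h(1) by (simp only: of_int_1; linarith)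
      then show thesis using that[of 1] Suc by (simp add: v_def)
    next
      case 3
      have "\<bar>w - (v + of_int 0 * h)\<bar> \<le> h" if "w \<in> W" for w
        using near[OF that] 3 h(1) by (simp only: of_int_0; linarith)
      then show thesis using that[of 0] Suc by (simp add: v_def)
    qed
  qed
  define t where "t = s(l \<mapsto> b)"
  have ge: "s i = None" if "i \<ge> l" for i using S_seqs_down[OF s(1) _ that] s(2) by (cases "s i") auto
  have tS: "t \<in> S_seqs"
  proof (rule S_seqsI)
    show "t (Suc i) = None" if "t i = None" for i
    proof -
      have "i \<noteq> l" using that by (auto simp: t_def)
      then have "s i = None" using that by (simp add: t_def)
      then have "l < i" using s(3)[of i] \<open>i \<noteq> l\<close> by (meson linorder_neqE_nat)
      then show ?thesis using ge by (simp add: t_def)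
    qed
    show "e \<in> {-1, 0, 1}" if "t (Suc i) = Some e" for i e
      using that S_seqs_digit[OF s(1), of i e] b(1) by (auto simp: t_def split: if_splits)
  qed
  have st: "s \<subseteq>\<^sub>m t" using s(2) by (intro map_leI) (auto simp: t_def)
  have pvl: "pv t l = (if l = 0 then of_int b else pv s (l - 1) + of_int b * h)"
  proof (cases l)
    case 0 then show ?thesis by (simp add: pv_def t_def)
  next
    case (Suc j)
    have "pv t j = pv s j" by (rule pv_cong) (simp add: t_def Suc)
    then show ?thesis using Suc by (simp add: pv_Suc t_def h_def del: power_Suc)
  qed
  have "W \<subseteq> SI t"
  proof
    fix w assume w: "w \<in> W"
    have "\<bar>w - pv t n\<bar> \<le> 1 / 2 ^ n" if n: "t n \<noteq> None" for n
    proof (cases "n = l")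
      case True then show ?thesis using b(2)[OF w] pvl by (simp add: h_def)
    next
      case False
      then have sn: "s n \<noteq> None" using n by (simp add: t_def)
      then have "pv t n = pv s n" using pv_map_le[OF s(1) st] by simp
      then show ?thesis using SI_D[of w s n] W(1) w sn by auto
    qed
    then show "w \<in> SI t" by (simp add: SI_def)
  qed
  moreover have "t \<noteq> s" using s(2) by (metis t_def fun_upd_same option.discI)
  ultimately show ?thesis using tS st by auto
qed

lemma dlim_max:
  assumes dec: "\<And>n. W (Suc n) \<subseteq> W n" and c: "\<And>n. c \<in> W n"
    and small: "\<And>e. e > 0 \<Longrightarrow> \<exists>N. \<forall>n\<ge>N. \<forall>w\<in>W n. \<bar>w - c\<bar> \<le> e"
  shows "dlim W \<in> S_max" "S_val (dlim W) = c"
proof -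
  have sub: "W n \<subseteq> SI (dg W n)" for n using dg_SI dec by metis
  have def: "\<exists>n. dg W n i \<noteq> None" for i
  proof (induction i rule: less_induct)
    case (less i)
    show ?case
    proof (rule ccontr)
      assume "\<not> ?case"
      then have none: "dg W n i = None" for n by simp
      have "\<exists>n0. \<forall>j<i. dg W n0 j \<noteq> None"
      proof (cases i)
        case (Suc j)
        then obtain n0 where "dg W n0 j \<noteq> None" using less[of j] by auto
        then have "dg W n0 j' \<noteq> None" if "j' < i" for j'
          using S_seqs_down[OF dg_in] that Suc by (metis less_Suc_eq_le)
        then show ?thesis by auto
      qed simp
      then obtain n0 where n0: "\<forall>j<i. dg W n0 j \<noteq> None" by auto
      obtain N where N: "\<And>n w. n \<ge> N \<Longrightarrow> w \<in> W n \<Longrightarrow> \<bar>w - c\<bar> \<le> 1 / 2 ^ (i + 2)"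
        using small[of "1 / 2 ^ (i + 2)"] by auto
      define m where "m = max n0 N"
      have def: "dg W m j \<noteq> None" if "j < i" for j
        using n0 that map_leD[OF dg_mono[of n0 m W], of j] by (simp add: m_def)
      have "W (Suc m) \<subseteq> SI (dg W m)" using sub[of m] dec[of m] by auto
      \<comment> \<open>All positions before i are filled and W is small enough for position i, so a
        proper extension exists and the greedy step must fill i.\<close>
      then have "\<exists>t\<in>S_seqs. dg W m \<subseteq>\<^sub>m t \<and> t \<noteq> dg W m \<and> W (Suc m) \<subseteq> SI t"
        by (intro digit_step[where l=i and c=c] dg_in none def c) (use N[of "Suc m"] in \<open>auto simp: m_def\<close>)
      then have *: "dg W m \<subseteq>\<^sub>m dg W (Suc m)" "dg W (Suc m) \<noteq> dg W m"
        using extend_cases[OF dg_in, of W m "W (Suc m)"] by (simp, metis, simp, metis)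
      then obtain j where "dg W (Suc m) j \<noteq> dg W m j" by (auto simp: fun_eq_iff)
      then have j: "dg W m j = None" "dg W (Suc m) j \<noteq> None" using map_leD[OF *(1), of j] by (cases "dg W m j"; simp)+
      then have "i \<le> j" using def by (meson not_le_imp_less)
      then have "dg W (Suc m) i \<noteq> None" using S_seqs_down[OF dg_in j(2)] by blast
      then show False using none[of "Suc m"] by (rule notE)
    qed
  qed
  have "dlim W i \<noteq> None" for i
  proof -
    obtain n where "dg W n i \<noteq> None" using def[of i] by auto
    then show ?thesis using map_leD[OF dg_le_dlim, of W n i] by simp
  qed
  then show mx: "dlim W \<in> S_max" using dlim_in by (simp add: S_max_iff)
  have "c \<in> SI (dlim W)"
    unfolding SI_def
  proof (intro CollectI allI impI)
    fix i
    obtain n where n: "dg W n i \<noteq> None" using def[of i] by auto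
    then show "\<bar>c - pv (dlim W) i\<bar> \<le> 1 / 2 ^ i"
      using SI_D[of c "dg W n" i] sub[of n] c[of n] pv_map_le[OF dg_in dg_le_dlim n] by auto
  qed
  then show "S_val (dlim W) = c" using SI_max[OF mx] by simp
qed

section \<open>Smooth functionals from a tree of information\<close>

text \<open>\<open>D n x\<close> says that \<open>x\<close> contains the \<open>n\<close>-th portion of information, and \<open>C n x\<close> is the set of
  functionals compatible with it.  The portions form a tree: they do not change when \<open>x\<close> grows.
  So digits chosen along the branch of \<open>x\<close> depend monotonically on \<open>x\<close>, and choosing them so that
  all compatible values are respected makes the result smooth.\<close>

locale S_info =
  fixes k :: nat and D :: "nat \<Rightarrow> digits fnl \<Rightarrow> bool" and C :: "nat \<Rightarrow> digits fnl \<Rightarrow> real fnl set"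
  assumes adm: "S.adm k"
    and D_0: "x \<in> S_dom k \<Longrightarrow> D 0 x"
    and D_dec: "x \<in> S_dom k \<Longrightarrow> D (Suc n) x \<Longrightarrow> D n x"
    and D_mono: "x \<in> S_dom k \<Longrightarrow> y \<in> S_dom k \<Longrightarrow> S.leX x y \<Longrightarrow> D n x \<Longrightarrow> D n y"
    and C_mono: "x \<in> S_dom k \<Longrightarrow> y \<in> S_dom k \<Longrightarrow> S.leX x y \<Longrightarrow> D n x \<Longrightarrow> C n y = C n x"
    and D_open: "x \<in> S_dom k \<Longrightarrow> D n x \<Longrightarrow> \<exists>m. D n (S.\<pi> k m x)"
    and D_bound: "x \<in> S_dom k \<Longrightarrow> D n (S.\<pi> k p x) \<Longrightarrow> n \<le> p"
    and C_dec: "x \<in> S_dom k \<Longrightarrow> D (Suc n) x \<Longrightarrow> C (Suc n) x \<subseteq> C n x"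
    and D_total: "x \<in> S.T k \<Longrightarrow> D n x"
    and C_total: "x \<in> S.T k \<Longrightarrow> S.\<rho> k x \<in> C n x"
    and C_conv: "x \<in> S.T k \<Longrightarrow> (\<And>n. us n \<in> C n x) \<Longrightarrow> Lconv k us (S.\<rho> k x)"
    and C_sim: "x \<in> S_dom k \<Longrightarrow> y \<in> S_dom k \<Longrightarrow> simh S_sim S_dom k x y \<Longrightarrow> D n x \<Longrightarrow> D m y \<Longrightarrow>
      C n x \<inter> C m y \<noteq> {}"
begin

text \<open>\<open>\<Psi> n\<close> holds the functionals to be respected at stage n. A portion
  missing from x gives \<open>UNIV\<close>, at which the greedy choice adds nothing by
  \<open>extend_UNIV\<close>.\<close>

definition W :: "(nat \<Rightarrow> (real fnl \<Rightarrow> real) set) \<Rightarrow> digits fnl \<Rightarrow> nat \<Rightarrow> real set" where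
  "W \<Psi> x n = (if D n x then {\<psi> u | \<psi> u. \<psi> \<in> \<Psi> n \<and> u \<in> C n x} else UNIV)"

definition G :: "(nat \<Rightarrow> (real fnl \<Rightarrow> real) set) \<Rightarrow> digits fnl \<Rightarrow> digits" where
  "G \<Psi> x = dlim (W \<Psi> x)"

lemma D_le: "x \<in> S_dom k \<Longrightarrow> D n x \<Longrightarrow> m \<le> n \<Longrightarrow> D m x"
proof (induction n)
  case (Suc n)
  then show ?case using D_dec[of x n] by (cases "m = Suc n") auto
qed simp

lemma dg_W_attain:
  assumes "x \<in> S_dom k" shows "\<exists>m\<le>n. D m x \<and> dg (W \<Psi> x) n = dg (W \<Psi> x) m"
proof (induction n)
  case 0 then show ?case using D_0[OF assms] by auto
next
  case (Suc n)
  show ?case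
  proof (cases "D (Suc n) x")
    case False
    then have "dg (W \<Psi> x) (Suc n) = dg (W \<Psi> x) n" by (intro dg_UNIV) (simp add: W_def)
    then show ?thesis using Suc le_Suc_eq by metis
  qed auto
qed

lemma W_agree:
  assumes "x \<in> S_dom k" "y \<in> S_dom k" "S.leX x y" "D n x" "\<And>i. i \<le> n \<Longrightarrow> \<Psi> i = \<Psi>' i"
  shows "dg (W \<Psi> x) n = dg (W \<Psi>' y) n"
proof (rule dg_cong)
  fix i assume i: "i \<le> n"
  then have "D i x" using D_le assms by metis
  then show "W \<Psi> x i = W \<Psi>' y i"
    using D_mono[OF assms(1-3)] C_mono[OF assms(1-3)] assms(5)[OF i] by (simp add: W_def)
qed

lemma G_in: "G \<Psi> x \<in> S_seqs"
  unfolding G_def by (rule dlim_in)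

lemma G_mono:
  assumes "x \<in> S_dom k" "y \<in> S_dom k" "S.leX x y"
  shows "G \<Psi> x \<subseteq>\<^sub>m G \<Psi> y"
  unfolding G_def
proof (rule dlim_least)
  fix n
  obtain m where m: "D m x" "dg (W \<Psi> x) n = dg (W \<Psi> x) m" using dg_W_attain[OF assms(1)] by metis
  then have "dg (W \<Psi> x) n = dg (W \<Psi> y) m" using W_agree[OF assms m(1)] by simp
  then show "dg (W \<Psi> x) n \<subseteq>\<^sub>m dlim (W \<Psi> y)" using dg_le_dlim by metis
qed

text \<open>By \<open>D_bound\<close> the p-th projection of x contains no portion beyond p, so its
  digits depend on the families only up to stage p. This gives the convergence of the lifted
  sequence.\<close>

lemma G_proj_le:
  assumes "x \<in> S_dom k" "\<And>i. i \<le> p \<Longrightarrow> \<Psi> i = \<Psi>' i"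
  shows "G \<Psi> (S.\<pi> k p x) \<subseteq>\<^sub>m G \<Psi>' x"
  unfolding G_def
proof (rule dlim_least)
  fix n
  let ?y = "S.\<pi> k p x"
  have y: "?y \<in> S_dom k" "S.leX ?y x" using S.L.pr_in S.L.pr_le assms(1) by metis+
  obtain m where m: "D m ?y" "dg (W \<Psi> ?y) n = dg (W \<Psi> ?y) m" using dg_W_attain[OF y(1)] by metis
  have "m \<le> p" using D_bound[OF assms(1) m(1)] .
  then have "dg (W \<Psi> ?y) m = dg (W \<Psi>' x) m"
    by (intro W_agree[OF y(1) assms(1) y(2) m(1)]) (use assms(2) in auto)
  then show "dg (W \<Psi> ?y) n \<subseteq>\<^sub>m dlim (W \<Psi>' x)" using m(2) dg_le_dlim by metis
qed

lemma G_total: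
  assumes dec: "\<And>n. \<Psi> (Suc n) \<subseteq> \<Psi> n" and phi: "\<And>n. \<phi> \<in> \<Psi> n"
    and conv: "\<forall>x\<in>S.T k. \<forall>us \<psi>. (\<forall>n. us n \<in> C n x) \<longrightarrow> (\<forall>n. \<psi> n \<in> \<Psi> n) \<longrightarrow>
      (\<lambda>n. \<psi> n (us n)) \<longlonglongrightarrow> \<phi> (S.\<rho> k x)"
  shows "lam (S_dom k) (G \<Psi>) \<in> S.T (Suc k)"
    and "\<And>x. x \<in> S.T k \<Longrightarrow> S_val (G \<Psi> x) = \<phi> (S.\<rho> k x)"
proof -
  have W_dec: "W \<Psi> x (Suc n) \<subseteq> W \<Psi> x n" if "x \<in> S_dom k" "D (Suc n) x" for x n
  proof -
    have "D n x" using D_dec that by metis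
    then show ?thesis using that C_dec[OF that] dec[of n] by (auto simp: W_def)
  qed
  have inX: "lam (S_dom k) (G \<Psi>) \<in> S_dom (Suc k)"
  proof (rule S.lam_in_X)
    show "G \<Psi> x \<in> S_seqs" for x by (rule G_in)
    show "G \<Psi> x \<subseteq>\<^sub>m G \<Psi> y" if "x \<in> S_dom k" "y \<in> S_dom k" "S.leX x y" for x y
      using that by (rule G_mono)
    show "\<exists>m. S_pr n (G \<Psi> x) \<subseteq>\<^sub>m G \<Psi> (S.\<pi> k m x)" if x: "x \<in> S_dom k" for x n
    proof -
      obtain N where N: "G \<Psi> x |` {..<n} \<subseteq>\<^sub>m dg (W \<Psi> x) N" unfolding G_def using dlim_restrict by metis
      obtain M where M: "D M x" "dg (W \<Psi> x) N = dg (W \<Psi> x) M" using dg_W_attain[OF x] by metis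
      obtain m where m: "D M (S.\<pi> k m x)" using D_open[OF x M(1)] by metis
      have "dg (W \<Psi> (S.\<pi> k m x)) M = dg (W \<Psi> x) M"
        by (rule W_agree[OF S.L.pr_in[OF x] x S.L.pr_le[OF x] m]) simp
      then have "dg (W \<Psi> x) N \<subseteq>\<^sub>m G \<Psi> (S.\<pi> k m x)" unfolding G_def using M(2) dg_le_dlim by metis
      then show ?thesis using N S_pr_restrict map_le_trans by metis
    qed
    show "S_sim (G \<Psi> x) (G \<Psi> y)" if xy: "x \<in> S_dom k" "y \<in> S_dom k" "simh S_sim S_dom k x y" for x y
    proof (rule S_sim_lim[OF G_in G_in])
      fix n
      have *: "\<exists>M. D M z \<and> G \<Psi> z |` {..<n} \<subseteq>\<^sub>m dg (W \<Psi> z) M \<and> W \<Psi> z M \<subseteq> SI (dg (W \<Psi> z) M)"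
        if z: "z \<in> S_dom k" for z
      proof -
        obtain N where N: "G \<Psi> z |` {..<n} \<subseteq>\<^sub>m dg (W \<Psi> z) N" unfolding G_def using dlim_restrict by metis
        obtain M where M: "D M z" "dg (W \<Psi> z) N = dg (W \<Psi> z) M" using dg_W_attain[OF z] by metis
        have "W \<Psi> z M \<subseteq> SI (dg (W \<Psi> z) M)"
        proof (rule dg_SI)
          fix i assume "i < M"
          then have "D (Suc i) z" using D_le[OF z M(1)] by simp
          then show "W \<Psi> z (Suc i) \<subseteq> W \<Psi> z i" by (rule W_dec[OF z])
        qed
        then show ?thesis using N M by metis
      qed
      obtain M where M: "D M x" "G \<Psi> x |` {..<n} \<subseteq>\<^sub>m dg (W \<Psi> x) M" "W \<Psi> x M \<subseteq> SI (dg (W \<Psi> x) M)"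
        using *[OF xy(1)] by metis
      obtain K where K: "D K y" "G \<Psi> y |` {..<n} \<subseteq>\<^sub>m dg (W \<Psi> y) K" "W \<Psi> y K \<subseteq> SI (dg (W \<Psi> y) K)"
        using *[OF xy(2)] by metis
      \<comment> \<open>One functional compatible with both arguments: its value under
        \<open>\<phi>\<close> is among the possible values on either side, so it completes both
        digit sequences.\<close>
      obtain u where u: "u \<in> C M x" "u \<in> C K y" using C_sim[OF xy M(1) K(1)] by auto
      have "\<phi> u \<in> W \<Psi> x M" "\<phi> u \<in> W \<Psi> y K" using M(1) K(1) u phi by (auto simp: W_def)
      then have "S_sim (dg (W \<Psi> x) M) (dg (W \<Psi> y) K)"
        using S_sim_iff[OF dg_in dg_in] M(3) K(3) by auto
      then show "S_sim (S_pr n (G \<Psi> x)) (S_pr n (G \<Psi> y))"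
        by (rule S_sim_down) (use M(2) K(2) S_pr_restrict map_le_trans in metis)+
    qed
  qed
  have tot: "G \<Psi> x \<in> S_max \<and> S_val (G \<Psi> x) = \<phi> (S.\<rho> k x)" if x: "x \<in> S.T k" for x
  proof -
    let ?c = "\<phi> (S.\<rho> k x)"
    have xX: "x \<in> S_dom k" using S.T_in x by metis
    have Wn: "W \<Psi> x n = {\<psi> u | \<psi> u. \<psi> \<in> \<Psi> n \<and> u \<in> C n x}" for n
      using D_total[OF x] by (simp add: W_def)
    have small: "\<exists>N. \<forall>n\<ge>N. \<forall>w\<in>W \<Psi> x n. \<bar>w - ?c\<bar> \<le> e" if e: "e > 0" for e
    proof -
      \<comment> \<open>At every stage a value farther than e from the limit is picked if there is
        one. The picked values converge, so eventually the whole set is within e.\<close>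
      have "\<exists>\<psi> u. \<psi> \<in> \<Psi> n \<and> u \<in> C n x \<and> (\<bar>\<psi> u - ?c\<bar> \<le> e \<longrightarrow> (\<forall>w\<in>W \<Psi> x n. \<bar>w - ?c\<bar> \<le> e))" for n
      proof (cases "\<forall>w\<in>W \<Psi> x n. \<bar>w - ?c\<bar> \<le> e")
        case True then show ?thesis using phi C_total[OF x] by auto
      next
        case False
        then obtain w where "w \<in> W \<Psi> x n" "\<not> \<bar>w - ?c\<bar> \<le> e" by auto
        then show ?thesis unfolding Wn by auto
      qed
      then obtain \<psi> us where p: "\<And>n. \<psi> n \<in> \<Psi> n" "\<And>n. us n \<in> C n x"
        "\<And>n. \<bar>\<psi> n (us n) - ?c\<bar> \<le> e \<Longrightarrow> \<forall>w\<in>W \<Psi> x n. \<bar>w - ?c\<bar> \<le> e" by metis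
      have "\<forall>\<^sub>F n in sequentially. dist (\<psi> n (us n)) ?c < e"
        by (rule tendstoD[OF _ e]) (use conv x p(1,2) in simp)
      then have "\<forall>\<^sub>F n in sequentially. \<forall>w\<in>W \<Psi> x n. \<bar>w - ?c\<bar> \<le> e"
        by eventually_elim (rule p(3), simp add: dist_real_def)
      then show ?thesis by (simp add: eventually_sequentially)
    qed
    have cW: "?c \<in> W \<Psi> x n" for n unfolding Wn using phi C_total[OF x] by auto
    show ?thesis
      unfolding G_def using dlim_max[OF W_dec[OF xX D_total[OF x]] cW small] by simp
  qed
  then show "S_val (G \<Psi> x) = \<phi> (S.\<rho> k x)" if "x \<in> S.T k" for x using that by simp
  have "S_eq (app (lam (S_dom k) (G \<Psi>)) x) (app (lam (S_dom k) (G \<Psi>)) y)" if xy: "per S_eq S_dom k x y" for x y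
  proof -
    note t = per_total[OF S.symp_eq S.transp_eq xy]
    have "G \<Psi> x \<in> S_max" "G \<Psi> y \<in> S_max" "S_val (G \<Psi> x) = S_val (G \<Psi> y)"
      using tot[OF t(1)] tot[OF t(2)] S.per_rho[OF xy] by simp_all
    then have "S_eq (G \<Psi> x) (G \<Psi> y)" using S_eq_iff[of "G \<Psi> x" "G \<Psi> y"] S_eq_self by simp
    then show ?thesis using per_in[OF xy] by simp
  qed
  then show "lam (S_dom k) (G \<Psi>) \<in> S.T (Suc k)" using inX by (auto simp: total_def)
qed

theorem adm_next: "S.adm (Suc k)"
proof (rule S.adm_Suc[OF adm])
  fix Us U assume UU: "Lconv (Suc k) Us U"
  note UL = Lconv_in[OF UU]
  define \<Psi> where "\<Psi> n = insert (app U) {app (Us j) | j. j \<ge> n}" for n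
  \<comment> \<open>For \<open>n \<le> m\<close> the functional \<open>app (Us m)\<close> belongs to
    \<open>\<Psi> n\<close>, so settling on it after stage m keeps the family decreasing. Agreement
    with \<open>\<Psi>\<close> up to stage m is what \<open>G_proj_le\<close> asks for.\<close>
  define \<Psi>s where "\<Psi>s m n = (if n \<le> m then \<Psi> n else {app (Us m)})" for m n
  have 1: "lam (S_dom k) (G \<Psi>) \<in> S.T (Suc k)"
    "\<And>x. x \<in> S.T k \<Longrightarrow> S_val (G \<Psi> x) = app U (S.\<rho> k x)"
  proof -
    have conv: "\<forall>x\<in>S.T k. \<forall>us \<psi>. (\<forall>n. us n \<in> C n x) \<longrightarrow> (\<forall>n. \<psi> n \<in> \<Psi> n) \<longrightarrow>
      (\<lambda>n. \<psi> n (us n)) \<longlonglongrightarrow> app U (S.\<rho> k x)"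
    proof (intro ballI allI impI)
      fix x us \<psi> assume "x \<in> S.T k" "\<forall>n. us n \<in> C n x" "\<forall>n. \<psi> n \<in> \<Psi> n"
      then have x: "x \<in> S.T k" "\<And>n. us n \<in> C n x" "\<And>n. \<psi> n \<in> \<Psi> n" by auto
      have us: "Lconv k us (S.\<rho> k x)" using C_conv[OF x(1,2)] .
      have "\<exists>j\<ge>n. \<psi> n = app U \<or> \<psi> n = app (Us j)" for n using x(3)[of n] by (auto simp: \<Psi>_def)
      then obtain j where j: "\<And>n. j n \<ge> n" "\<And>n. \<psi> n = app U \<or> \<psi> n = app (Us (j n))" by metis
      have "filterlim j at_top sequentially"
        by (rule filterlim_at_top_mono[OF filterlim_ident]) (use j in auto)
      then have a: "(\<lambda>n. app (Us (j n)) (us n)) \<longlonglongrightarrow> app U (S.\<rho> k x)" using UU us by simp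
      have b: "(\<lambda>n. app U (us n)) \<longlonglongrightarrow> app U (S.\<rho> k x)" by (rule S.LSuc_cont[OF adm UL(2) us])
      show "(\<lambda>n. \<psi> n (us n)) \<longlonglongrightarrow> app U (S.\<rho> k x)"
      proof (rule tendstoI)
        fix e :: real assume "e > 0"
        from tendstoD[OF a this] tendstoD[OF b this]
        show "\<forall>\<^sub>F n in sequentially. dist (\<psi> n (us n)) (app U (S.\<rho> k x)) < e"
          by eventually_elim (metis j(2))
      qed
    qed
    have dec: "\<Psi> (Suc n) \<subseteq> \<Psi> n" for n by (auto simp: \<Psi>_def)
    have phi: "app U \<in> \<Psi> n" for n by (simp add: \<Psi>_def)
    show "lam (S_dom k) (G \<Psi>) \<in> S.T (Suc k)"
      "\<And>x. x \<in> S.T k \<Longrightarrow> S_val (G \<Psi> x) = app U (S.\<rho> k x)"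
      by (rule G_total[where \<phi> = "app U" and \<Psi> = \<Psi>, OF dec phi conv]; assumption)+
  qed
  have 2: "lam (S_dom k) (G (\<Psi>s m)) \<in> S.T (Suc k)"
    "\<And>x. x \<in> S.T k \<Longrightarrow> S_val (G (\<Psi>s m) x) = app (Us m) (S.\<rho> k x)" for m
  proof -
    have conv: "\<forall>x\<in>S.T k. \<forall>us \<psi>. (\<forall>n. us n \<in> C n x) \<longrightarrow> (\<forall>n. \<psi> n \<in> \<Psi>s m n) \<longrightarrow>
      (\<lambda>n. \<psi> n (us n)) \<longlonglongrightarrow> app (Us m) (S.\<rho> k x)"
    proof (intro ballI allI impI, rule Lim_transform_eventually)
      fix x us \<psi> assume "x \<in> S.T k" "\<forall>n. us n \<in> C n x" "\<forall>n. \<psi> n \<in> \<Psi>s m n"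
      then have x: "x \<in> S.T k" "\<And>n. us n \<in> C n x" "\<And>n. \<psi> n \<in> \<Psi>s m n" by auto
      show "(\<lambda>n. app (Us m) (us n)) \<longlonglongrightarrow> app (Us m) (S.\<rho> k x)"
        by (rule S.LSuc_cont[OF adm UL(1) C_conv[OF x(1,2)]])
      show "\<forall>\<^sub>F n in sequentially. app (Us m) (us n) = \<psi> n (us n)"
        using eventually_gt_at_top[of m]
      proof eventually_elim
        case (elim n) then show ?case using x(3)[of n] by (simp add: \<Psi>s_def)
      qed
    qed
    have dec: "\<Psi>s m (Suc n) \<subseteq> \<Psi>s m n" for n by (auto simp: \<Psi>_def \<Psi>s_def)
    have phi: "app (Us m) \<in> \<Psi>s m n" for n by (auto simp: \<Psi>_def \<Psi>s_def)
    show "lam (S_dom k) (G (\<Psi>s m)) \<in> S.T (Suc k)"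
      "\<And>x. x \<in> S.T k \<Longrightarrow> S_val (G (\<Psi>s m) x) = app (Us m) (S.\<rho> k x)"
      by (rule G_total[where \<phi> = "app (Us m)" and \<Psi> = "\<Psi>s m", OF dec phi conv]; assumption)+
  qed
  let ?F = "lam (S_dom k) (G \<Psi>)" and ?Fs = "\<lambda>m. lam (S_dom k) (G (\<Psi>s m))"
  have "S.leX (S.\<pi> (Suc k) p ?F) (?Fs m)" if "p \<le> m" for p m
    unfolding S.leX_iff[OF S.L.pr_in[OF S.T_in[OF 1(1)]] S.T_in[OF 2(1)]]
  proof
    fix x assume x: "x \<in> S_dom k"
    have "S_pr p (G \<Psi> (S.\<pi> k p x)) \<subseteq>\<^sub>m G (\<Psi>s m) x"
      by (rule map_le_trans[OF S_pr_le G_proj_le[OF x]]) (use that in \<open>simp add: \<Psi>s_def\<close>)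
    then show "app (S.\<pi> (Suc k) p ?F) x \<subseteq>\<^sub>m app (?Fs m) x"
      unfolding S.proj_app[OF x] using x S.L.pr_in[OF x] by simp
  qed
  then have "S.conv (Suc k) ?Fs ?F" unfolding S.conv_def eventually_sequentially by metis
  then show "\<exists>xs x. (\<forall>i. xs i \<in> S.T (Suc k) \<and>
        (\<forall>y\<in>S.T k. S_val (app (xs i) y) = app (Us i) (S.\<rho> k y))) \<and>
        x \<in> S.T (Suc k) \<and> (\<forall>y\<in>S.T k. S_val (app x y) = app U (S.\<rho> k y)) \<and> S.conv (Suc k) xs x"
    using 1 2 S.T_in by (intro exI[of _ ?Fs] exI[of _ ?F]) (simp del: S_dom.simps)
qed

end

section \<open>The smoothened hierarchy up to type two\<close>

lemma restrict_eqI: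
  assumes "s \<subseteq>\<^sub>m t" "\<forall>i<n. s i \<noteq> None" shows "s |` {..<n} = t |` {..<n}"
  using map_leD[OF assms(1)] assms(2) by (auto simp: restrict_map_def fun_eq_iff)

lemma SI_restrict_diff:
  assumes "\<forall>i<n. s i \<noteq> None" "0 < n" "x \<in> SI (s |` {..<n})" "y \<in> SI (s |` {..<n})"
  shows "\<bar>x - y\<bar> \<le> 4 / 2 ^ n"
proof -
  obtain m where m: "n = Suc m" using assms(2) by (cases n) auto
  then have "(s |` {..<n}) m \<noteq> None" using assms(1) by auto
  then have "\<bar>x - pv (s |` {..<n}) m\<bar> \<le> 1 / 2 ^ m" "\<bar>y - pv (s |` {..<n}) m\<bar> \<le> 1 / 2 ^ m"
    using SI_D assms(3,4) by metis+
  then have "\<bar>x - y\<bar> \<le> 2 * (1 / 2 ^ m)" by linarith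
  then show ?thesis by (simp add: m)
qed

lemma restrict_le: "m \<le> n \<Longrightarrow> s |` {..<m} \<subseteq>\<^sub>m (s :: digits) |` {..<n}"
  by (rule map_leI) (auto simp: restrict_map_def split: if_splits)

lemma SI_restrict_mono: "s \<in> S_seqs \<Longrightarrow> m \<le> n \<Longrightarrow> SI (s |` {..<n}) \<subseteq> SI (s |` {..<m})"
  by (rule SI_mono[OF restrict_S_seqs restrict_le])

lemma SI_restrict: "s \<in> S_seqs \<Longrightarrow> SI s \<subseteq> SI (s |` {..<m})"
  by (rule SI_mono) auto

lemma S_T_0: "x \<in> S.T 0 \<longleftrightarrow> base x \<in> S_max \<and> x = Base (base x)"
  by (auto simp: total_def S_eq_self S_max_iff)

lemma four_pow_tendsto: "(\<lambda>n. 4 / (2::real) ^ n) \<longlonglongrightarrow> 0"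
  using tendsto_mult_right[OF half_pow_tendsto, of 4] by simp

interpretation S0: S_info 0 "\<lambda>n x. \<forall>i<n. base x i \<noteq> None" "\<lambda>n x. Base ` SI (base x |` {..<n})"
proof
  show "S.adm 0" by (rule S_adm_0)
  show "\<forall>i<n. base y i \<noteq> None"
    if "x \<in> S_dom 0" "y \<in> S_dom 0" "S.leX x y" "\<forall>i<n. base x i \<noteq> None" for x y n
    using that map_leD[of "base x" "base y"] by auto
  show "Base ` SI (base y |` {..<n}) = Base ` SI (base x |` {..<n})"
    if "x \<in> S_dom 0" "y \<in> S_dom 0" "S.leX x y" "\<forall>i<n. base x i \<noteq> None" for x y n
    using that restrict_eqI[of "base x" "base y" n] by auto
  show "\<exists>m. \<forall>i<n. base (S.\<pi> 0 m x) i \<noteq> None" if "x \<in> S_dom 0" "\<forall>i<n. base x i \<noteq> None" for x n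
  proof -
    obtain N where "\<forall>m\<ge>N. S_pr m (base x) = base x |` {..<m}" using S_pr_eventually by metis
    then show ?thesis using that by (intro exI[of _ "max N n"]) simp
  qed
  show "n \<le> p" if "x \<in> S_dom 0" "\<forall>i<n. base (S.\<pi> 0 p x) i \<noteq> None" for x n p
  proof (rule ccontr)
    assume "\<not> n \<le> p"
    then have "S_pr p (base x) p \<noteq> None" using that(2) by simp
    then show False by (auto simp: S_pr_def split: if_splits)
  qed
  show "Base ` SI (base x |` {..<Suc n}) \<subseteq> Base ` SI (base x |` {..<n})" if "x \<in> S_dom 0" for x n
    by (rule image_mono, rule SI_restrict_mono) (use that in auto)
  show "\<forall>i<n. base x i \<noteq> None" if "x \<in> S.T 0" for x n
    using that unfolding S_T_0 S_max_iff by simp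
  show "S.\<rho> 0 x \<in> Base ` SI (base x |` {..<n})" if "x \<in> S.T 0" for x n
  proof -
    have mx: "base x \<in> S_max" using that S_T_0 by simp
    then have "base x \<in> S_seqs" by (simp add: S_max_iff)
    then have "S_val (base x) \<in> SI (base x |` {..<n})" using S_val_SI[OF mx] SI_restrict by auto
    then show ?thesis by simp
  qed
  show "Lconv 0 us (S.\<rho> 0 x)" if x: "x \<in> S.T 0" and us: "\<And>n. us n \<in> Base ` SI (base x |` {..<n})" for x us
  proof -
    have mx: "base x \<in> S_max" using x S_T_0 by simp
    have "\<exists>t. us n = Base t \<and> t \<in> SI (base x |` {..<n})" for n using us[of n] by auto
    then obtain t where t: "\<And>n. us n = Base (t n)" "\<And>n. t n \<in> SI (base x |` {..<n})" by metis
    have "\<bar>t n - S_val (base x)\<bar> \<le> 4 / 2 ^ n" if "n > 0" for n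
      using SI_restrict_diff[of n "base x" "t n" "S_val (base x)"] that t(2)[of n] mx
        S_val_SI[OF mx] SI_restrict[of "base x" n] by (auto simp: S_max_iff)
    then have "\<forall>\<^sub>F n in sequentially. norm (t n - S_val (base x)) \<le> 4 / 2 ^ n"
      by (intro eventually_mono[OF eventually_gt_at_top[of 0]]) simp
    then have "(\<lambda>n. t n - S_val (base x)) \<longlonglongrightarrow> 0"
      by (rule Lim_null_comparison[OF _ four_pow_tendsto])
    then have "t \<longlonglongrightarrow> S_val (base x)" by (simp add: LIM_zero_iff)
    then show ?thesis using t(1) by auto
  qed
  show "Base ` SI (base x |` {..<n}) \<inter> Base ` SI (base y |` {..<m}) \<noteq> {}"
    if xy: "x \<in> S_dom 0" "y \<in> S_dom 0" "simh S_sim S_dom 0 x y" for x y n m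
  proof -
    have "base x \<in> S_seqs" "base y \<in> S_seqs" using xy by auto
    moreover from this obtain z where "z \<in> SI (base x)" "z \<in> SI (base y)"
      using xy S_sim_iff by auto
    ultimately have "z \<in> SI (base x |` {..<n})" "z \<in> SI (base y |` {..<m})" using SI_restrict by blast+
    then show ?thesis by auto
  qed
qed auto

lemma S_adm_1: "S.adm (Suc 0)"
  by (rule S0.adm_next)

section \<open>Portions of information about type-one objects\<close>

definition D1 :: "nat \<Rightarrow> digits fnl \<Rightarrow> bool" where
  "D1 n x \<longleftrightarrow> (\<exists>q. \<forall>d\<in>S_max. \<bar>the (d 0)\<bar> \<le> int n \<longrightarrow> (\<forall>i<n. app x (Base (d |` {..<q})) i \<noteq> None))"

text \<open>The bound on the first entry confines the arguments to a compact set, where a single q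
  as in \<open>D1\<close> serves all of them; every argument is reached as n grows. Given
  \<open>D1 n x\<close>, the first n output entries on these arguments are fixed, so the set is
  unchanged when x grows.\<close>

definition C1 :: "nat \<Rightarrow> digits fnl \<Rightarrow> real fnl set" where
  "C1 n x = {f\<in>L (Suc 0). \<forall>d\<in>S_max. \<bar>the (d 0)\<bar> \<le> int n \<longrightarrow>
     app f (Base (S_val d)) \<in> SI (app x (Base d) |` {..<n})}"

lemma Base_in_S: "d \<in> S_seqs \<Longrightarrow> Base d \<in> S_dom 0" by simp

lemma Base_max_in_S: "d \<in> S_max \<Longrightarrow> Base d \<in> S_dom 0" by (simp add: S_max_iff)

lemma Base_restrict_in_S: "d \<in> S_max \<Longrightarrow> Base (d |` {..<q}) \<in> S_dom 0" by (simp add: S_max_iff)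

lemma app_S_in: "x \<in> S_dom (Suc 0) \<Longrightarrow> d \<in> S_seqs \<Longrightarrow> app x (Base d) \<in> S_seqs"
  by (rule S.app_in[OF _ Base_in_S])

lemma app_S_mono: "x \<in> S_dom (Suc 0) \<Longrightarrow> d \<in> S_seqs \<Longrightarrow> e \<in> S_seqs \<Longrightarrow> d \<subseteq>\<^sub>m e \<Longrightarrow>
    app x (Base d) \<subseteq>\<^sub>m app x (Base e)"
  by (rule S.app_mono[OF _ Base_in_S Base_in_S]) auto

lemma D1_defined:
  assumes "x \<in> S_dom (Suc 0)" "D1 n x" "d \<in> S_max" "\<bar>the (d 0)\<bar> \<le> int n" "i < n"
  shows "app x (Base d) i \<noteq> None"
proof -
  obtain q where "app x (Base (d |` {..<q})) i \<noteq> None" using assms(2-) unfolding D1_def by metis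
  moreover have "app x (Base (d |` {..<q})) \<subseteq>\<^sub>m app x (Base d)"
    using assms(1,3) by (intro app_S_mono) (auto simp: S_max_iff)
  ultimately show ?thesis using map_leD by metis
qed

lemma zero_digits: "(\<lambda>_. Some 0) \<in> S_max"
  by (auto simp: S_max_iff intro: S_seqsI)

text \<open>Koenig's lemma on the finitely branching tree of digit sequences with bounded first entry.\<close>

lemma D1_total:
  assumes x: "x \<in> S.T (Suc 0)" shows "D1 n x"
proof (rule ccontr)
  have xX: "x \<in> S_dom (Suc 0)" using S.T_in x by metis
  assume "\<not> D1 n x"
  then have "\<forall>q. \<exists>d. d \<in> S_max \<and> \<bar>the (d 0)\<bar> \<le> int n \<and> (\<exists>i<n. app x (Base (d |` {..<q})) i = None)"
    unfolding D1_def by metis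
  then obtain d where d: "\<And>q. d q \<in> S_max" "\<And>q. \<bar>the (d q 0)\<bar> \<le> int n"
    "\<And>q. \<exists>i<n. app x (Base (d q |` {..<q})) i = None" by metis
  have ran: "d q l \<in> Some ` {- (int n + 1) .. int n + 1}" for q l
  proof -
    obtain b where b: "d q l = Some b" using d(1)[of q] by (auto simp: S_max_iff)
    have "\<bar>b\<bar> \<le> int n + 1"
    proof (cases l)
      case 0 then show ?thesis using d(2)[of q] b by simp
    next
      case (Suc j)
      then show ?thesis using S_seqs_digit[of "d q" j b] d(1)[of q] b by (auto simp: S_max_iff)
    qed
    then show ?thesis using b by (auto simp: abs_le_iff)
  qed
  have "\<exists>f. \<forall>l. infinite {q. \<forall>i<l. d q i = f l i} \<and> (\<forall>i<l. f (Suc l) i = f l i)"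
  proof (rule dependent_nat_choice)
    show "\<exists>s. infinite {q. \<forall>i<0. d q i = s i}" by simp
    fix s :: digits and l assume inf: "infinite {q. \<forall>i<l. d q i = s i}"
    have "finite ((\<lambda>q. d q l) ` {q. \<forall>i<l. d q i = s i})"
      by (rule finite_subset[of _ "Some ` {- (int n + 1) .. int n + 1}"]) (use ran in auto)
    then obtain q0 where q0: "infinite {q \<in> {q. \<forall>i<l. d q i = s i}. d q l = d q0 l}"
      using pigeonhole_infinite[OF inf] by auto
    have "{q \<in> {q. \<forall>i<l. d q i = s i}. d q l = d q0 l} \<subseteq> {q. \<forall>i<Suc l. d q i = (s(l := d q0 l)) i}"
      by (auto simp: less_Suc_eq)
    then have "infinite {q. \<forall>i<Suc l. d q i = (s(l := d q0 l)) i}" using q0 by (rule infinite_super)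
    then show "\<exists>t. infinite {q. \<forall>i<Suc l. d q i = t i} \<and> (\<forall>i<l. t i = s i)"
      by (intro exI[of _ "s(l := d q0 l)"]) simp
  qed
  then obtain f where "\<forall>l. infinite {q. \<forall>i<l. d q i = f l i} \<and> (\<forall>i<l. f (Suc l) i = f l i)"
    by (elim exE)
  then have f: "\<And>l. infinite {q. \<forall>i<l. d q i = f l i}" "\<And>l i. i < l \<Longrightarrow> f (Suc l) i = f l i"
    by simp_all
  define e where "e i = f (Suc i) i" for i
  have fe: "i < l \<Longrightarrow> f l i = e i" for l i
  proof (induction l)
    case (Suc l)
    then show ?case using f(2)[of i l] by (cases "i = l") (auto simp: e_def)
  qed simp
  have agree: "\<exists>q\<ge>m. \<forall>i<l. d q i = e i" for l m
  proof -
    have "infinite ({q. \<forall>i<l. d q i = f l i} - {..<m})" using f(1) by (simp add: Diff_infinite_finite)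
    then obtain q where "q \<in> {q. \<forall>i<l. d q i = f l i} - {..<m}" by (metis finite.emptyI ex_in_conv)
    then show ?thesis using fe by (intro exI[of _ q]) auto
  qed
  have eS: "e \<in> S_max"
    unfolding S_max_iff
  proof
    show "e \<in> S_seqs"
    proof (rule S_seqsI)
      fix i
      obtain q where q: "\<forall>j<Suc (Suc i). d q j = e j" using agree by metis
      then have qi: "d q i = e i" "d q (Suc i) = e (Suc i)" by auto
      have "d q i \<noteq> None" using d(1)[of q] unfolding S_max_iff by blast
      then show "e (Suc i) = None" if "e i = None" using qi that by simp
      show "b \<in> {-1, 0, 1}" if "e (Suc i) = Some b" for b
        using S_seqs_digit[of "d q" i b] d(1)[of q] qi that by (auto simp: S_max_iff)
    qed
    show "\<forall>i. e i \<noteq> None"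
    proof
      fix i
      obtain q where "\<forall>j<Suc i. d q j = e j" using agree by metis
      moreover have "d q i \<noteq> None" using d(1)[of q] unfolding S_max_iff by blast
      ultimately show "e i \<noteq> None" by simp
    qed
  qed
  have "Base e \<in> S.T 0" using eS S_T_0 by simp
  then have "S_eq (app x (Base e)) (app x (Base e))" using x total_app by metis
  then have xe: "app x (Base e) \<in> S_max" using S_eq_self by simp
  obtain N where N: "\<forall>m\<ge>N. S_pr m (app x (Base e)) = app x (Base e) |` {..<m}" using S_pr_eventually by metis
  obtain m where m: "S_pr (max N n) (app x (Base e)) \<subseteq>\<^sub>m app x (S.\<pi> 0 m (Base e))"
    using S.app_approx[OF xX Base_max_in_S[OF eS]] by metis
  \<comment> \<open>With \<open>q \<ge> m\<close>, truncating to q entries keeps the m agreeing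
    entries that already produce the first n output entries.\<close>
  obtain q where q: "q \<ge> m" "\<forall>i<m. d q i = e i" using agree by metis
  have "S_pr m e \<subseteq>\<^sub>m d q |` {..<q}"
  proof (rule map_leI)
    fix i assume "S_pr m e i \<noteq> None"
    then have "i < m" "S_pr m e i = e i" by (auto simp: S_pr_def restrict_map_def split: if_splits)
    then show "(d q |` {..<q}) i = S_pr m e i" using q by simp
  qed
  then have "app x (Base (S_pr m e)) \<subseteq>\<^sub>m app x (Base (d q |` {..<q}))"
    using eS d(1)[of q] by (intro app_S_mono[OF xX]) (auto simp: S_max_iff)
  then have *: "S_pr (max N n) (app x (Base e)) \<subseteq>\<^sub>m app x (Base (d q |` {..<q}))"
    using m map_le_trans by (metis proj.simps(1) fnl.sel)
  obtain i where i: "i < n" "app x (Base (d q |` {..<q})) i = None" using d(3)[of q] by metis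
  have "S_pr (max N n) (app x (Base e)) i \<noteq> None" using N i(1) xe by (simp add: S_max_iff)
  then show False using map_leD[OF *, of i] i(2) by simp
qed

lemma app_lam_L0: "app (lam (L 0) f) (Base t) = f (Base t)"
  by (rule app_lam[OF S.adm_L_lepoll[OF S_adm_0]]) simp

lemma lam_in_L1:
  assumes "continuous_on UNIV f" shows "lam (L 0) (\<lambda>u. f (base u)) \<in> L (Suc 0)"
proof -
  have "(\<lambda>i. f (base (us i))) \<longlonglongrightarrow> f (base u)" if "Lconv 0 us u" for us u
    by (rule continuous_on_tendsto_compose[OF assms]) (use that in auto)
  then show ?thesis by auto
qed

lemma pv_dyadic: "\<exists>z::int. pv s j = of_int z / 2 ^ j"
proof (induction j)
  case 0 then show ?case by (simp add: pv_def)
next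
  case (Suc j)
  then obtain z where z: "pv s j = of_int z / 2 ^ j" by auto
  have "pv s (Suc j) = of_int (2 * z + the (s (Suc j))) / 2 ^ Suc j"
    by (simp add: pv_Suc z add_divide_distrib)
  then show ?case by blast
qed

text \<open>\<open>SI s\<close> is an intersection of intervals whose endpoints are multiples of 1 /
  2^Q, so meeting an open cell forces it to contain the closed cell. This yields the inclusions
  required by \<open>interpolate\<close>.\<close>

lemma SI_grid:
  fixes i :: int
  assumes s: "\<And>j. s j \<noteq> None \<Longrightarrow> j \<le> Q"
    and t: "of_int i / 2 ^ Q < t" "t < (of_int i + 1) / 2 ^ Q" "t \<in> SI s"
  shows "of_int i / 2 ^ Q \<in> SI s \<and> (of_int i + 1) / 2 ^ Q \<in> SI s"
proof -
  have "\<bar>of_int i / 2 ^ Q - pv s j\<bar> \<le> 1 / 2 ^ j \<and> \<bar>(of_int i + 1) / 2 ^ Q - pv s j\<bar> \<le> 1 / 2 ^ j"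
    if j: "s j \<noteq> None" for j
  proof -
    obtain z where z: "pv s j = of_int z / 2 ^ j" using pv_dyadic by metis
    define N :: real where "N = 2 ^ Q"
    obtain c where c: "Q = j + c" using s[OF j] le_Suc_ex by metis
    have N: "N > 0" "N = 2 ^ j * 2 ^ c" by (simp_all add: N_def c power_add)
    define a b where "a = (z - 1) * 2 ^ c" and "b = (z + 1) * 2 ^ c"
    have ab: "pv s j - 1 / 2 ^ j = of_int a / N" "pv s j + 1 / 2 ^ j = of_int b / N"
      unfolding z N(2) a_def b_def by (simp_all add: field_simps)
    have "\<bar>t - pv s j\<bar> \<le> 1 / 2 ^ j" using SI_D t(3) j by metis
    then have "of_int a / N \<le> t" "t \<le> of_int b / N" unfolding ab[symmetric] by linarith+
    then have "real_of_int a / N < (of_int i + 1) / N" "of_int i / N < of_int b / N"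
      using t(1,2) unfolding N_def[symmetric] by linarith+
    then have "real_of_int a < of_int i + 1" "real_of_int i < of_int b"
      using N(1) by (simp_all add: divide_less_cancel)
    then have "a \<le> i" "i + 1 \<le> b" by linarith+
    then have "real_of_int a \<le> of_int i" "real_of_int i + 1 \<le> of_int b" by linarith+
    then have "of_int a / N \<le> of_int i / N" "(of_int i + 1) / N \<le> of_int b / N"
      "of_int i / N \<le> (of_int i + 1) / N"
      using N(1) by (simp_all add: divide_right_mono)
    then show ?thesis unfolding ab[symmetric] N_def[symmetric] by linarith
  qed
  then show ?thesis by (simp add: SI_def)
qed

lemma helly_real:
  fixes F :: "real set set"
  assumes "finite F" "\<And>I. I \<in> F \<Longrightarrow> convex I" "\<And>I J. I \<in> F \<Longrightarrow> J \<in> F \<Longrightarrow> I \<inter> J \<noteq> {}"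
  shows "\<Inter>F \<noteq> {}"
proof (cases "card F \<ge> 2")
  case True
  show ?thesis
  proof (rule Helly)
    show "DIM(real) + 1 \<le> card F" using True by simp
    show "\<forall>s\<in>F. convex s" using assms(2) by simp
    show "\<Inter>G \<noteq> {}" if "G \<subseteq> F" "card G = DIM(real) + 1" for G
    proof -
      have "card G = 2" using that(2) by simp
      then obtain I J where "G = {I, J}" by (auto simp: card_2_iff)
      then show ?thesis using assms(3)[of I J] that(1) by simp
    qed
  qed
next
  case False
  then consider "F = {}" | I where "F = {I}"
    using assms(1) by (metis One_nat_def card_0_eq card_1_singletonE less_2_cases not_le)
  then show ?thesis using assms(3) by cases auto
qed

text \<open>Smoothness makes the intervals prescribed at a point \<open>t\<close> by the compatible functionals \<open>x\<close>
  and \<open>y\<close> meet pairwise, hence they have a common point by Helly's theorem.\<close>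

lemma C1_sim:
  assumes xy: "x \<in> S_dom (Suc 0)" "y \<in> S_dom (Suc 0)" "simh S_sim S_dom (Suc 0) x y"
    and D: "D1 n x" "D1 m y"
  shows "C1 n x \<inter> C1 m y \<noteq> {}"
proof -
  obtain q where q: "\<And>d i. d \<in> S_max \<Longrightarrow> \<bar>the (d 0)\<bar> \<le> int n \<Longrightarrow> i < n \<Longrightarrow> app x (Base (d |` {..<q})) i \<noteq> None"
    using D(1) by (auto simp: D1_def)
  obtain r where r: "\<And>d i. d \<in> S_max \<Longrightarrow> \<bar>the (d 0)\<bar> \<le> int m \<Longrightarrow> i < m \<Longrightarrow> app y (Base (d |` {..<r})) i \<noteq> None"
    using D(2) by (auto simp: D1_def)
  define Q where "Q = max q r"
  \<comment> \<open>Arguments may be cut to Q entries, as Q is at least both moduli. With a bounded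
    first entry only finitely many truncations remain, so Helly's theorem for finite families
    applies.\<close>
  define ST where "ST n = {d |` {..<Q} | d. d \<in> S_max \<and> \<bar>the (d 0)\<bar> \<le> int n}" for n
  have ST_in: "s \<in> S_seqs" if "s \<in> ST n" for s n using that by (auto simp: ST_def S_max_iff)
  have fin: "finite (ST n)" for n
  proof (rule finite_subset[OF _ pdom.finite_pr[OF pdom_S, of "max Q n"]])
    show "ST n \<subseteq> S_pr (max Q n) ` S_seqs"
    proof
      fix s assume "s \<in> ST n"
      then obtain d where d: "s = d |` {..<Q}" "d \<in> S_max" "\<bar>the (d 0)\<bar> \<le> int n" by (auto simp: ST_def)
      have "S_pr (max Q n) s = s |` {..<max Q n}"
        by (rule S_pr_eq) (use d in \<open>auto simp: restrict_map_def split: if_splits\<close>)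
      moreover have "s |` {..<max Q n} = s"
        using d(1) by (auto simp: restrict_map_def fun_eq_iff)
      ultimately have "s = S_pr (max Q n) s" by simp
      then show "s \<in> S_pr (max Q n) ` S_seqs" using d by (auto simp: S_max_iff)
    qed
  qed
  define FX where "FX t = {SI (app x (Base s) |` {..<n}) | s. s \<in> ST n \<and> t \<in> SI s}" for t
  define FY where "FY t = {SI (app y (Base s) |` {..<m}) | s. s \<in> ST m \<and> t \<in> SI s}" for t
  \<comment> \<open>The constraints on the value at t, one for each truncated argument that can
    still denote t.\<close>
  define J where "J t = \<Inter>(FX t \<union> FY t)" for t
  have meet: "SI (app u (Base s) |` {..<a}) \<inter> SI (app v (Base s') |` {..<b}) \<noteq> {}"
    if uv: "u \<in> S_dom (Suc 0)" "v \<in> S_dom (Suc 0)" "simh S_sim S_dom (Suc 0) u v"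
      and s: "s \<in> S_seqs" "s' \<in> S_seqs" "t \<in> SI s" "t \<in> SI s'" for u v s s' t a b
  proof -
    have "S_sim s s'" using S_sim_iff[OF s(1,2)] s(3,4) by auto
    then have "S_sim (app u (Base s)) (app v (Base s'))" using uv(3) s by simp
    then have "SI (app u (Base s)) \<inter> SI (app v (Base s')) \<noteq> {}"
      using S_sim_iff app_S_in uv s by metis
    then show ?thesis
      using SI_restrict[OF app_S_in[OF uv(1) s(1)], of a] SI_restrict[OF app_S_in[OF uv(2) s(2)], of b] by auto
  qed
  have self: "simh S_sim S_dom (Suc 0) u u" if "u \<in> S_dom (Suc 0)" for u
    using S.app_sim[OF that] by (subst simh.simps) auto
  have J_ne: "J t \<noteq> {}" for t
    unfolding J_def
  proof (rule helly_real)
    show "finite (FX t \<union> FY t)"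
    proof -
      have "FX t \<subseteq> (\<lambda>s. SI (app x (Base s) |` {..<n})) ` ST n"
        "FY t \<subseteq> (\<lambda>s. SI (app y (Base s) |` {..<m})) ` ST m"
        by (auto simp: FX_def FY_def)
      then have "finite (FX t)" "finite (FY t)" by (simp_all add: finite_subset[OF _ finite_imageI[OF fin]])
      then show ?thesis by simp
    qed
    show "convex I" if "I \<in> FX t \<union> FY t" for I using that convex_SI by (auto simp: FX_def FY_def)
    show "I \<inter> K \<noteq> {}" if IK: "I \<in> FX t \<union> FY t" "K \<in> FX t \<union> FY t" for I K
    proof -
      have "simh S_sim S_dom (Suc 0) y x"
      proof -
        have "S_sim (app y a) (app x b)" if "a \<in> S_dom 0" "b \<in> S_dom 0" "S_sim (base a) (base b)" for a b
        proof -
          have "S_sim (base b) (base a)" using that(3) unfolding S_sim_def by metis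
          then have "S_sim (app x b) (app y a)" using xy(3) that(1,2) by auto
          then show ?thesis unfolding S_sim_def by metis
        qed
        then show ?thesis by simp
      qed
      note sims = this xy(3) self[OF xy(1)] self[OF xy(2)]
      consider "I \<in> FX t" "K \<in> FX t" | "I \<in> FX t" "K \<in> FY t" | "I \<in> FY t" "K \<in> FX t" | "I \<in> FY t" "K \<in> FY t"
        using IK by auto
      then show ?thesis
      proof cases
        case 1 then show ?thesis unfolding FX_def using meet[OF xy(1,1) sims(3)] ST_in by auto
      next
        case 2 then show ?thesis unfolding FX_def FY_def using meet[OF xy(1,2) sims(2)] ST_in by auto
      next
        case 3 then show ?thesis unfolding FX_def FY_def using meet[OF xy(2,1) sims(1)] ST_in by auto
      next
        case 4 then show ?thesis unfolding FY_def using meet[OF xy(2,2) sims(4)] ST_in by auto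
      qed
    qed
  qed
  have J_mono: "J t' \<subseteq> J t" if "\<And>s k. s \<in> ST k \<Longrightarrow> t \<in> SI s \<Longrightarrow> t' \<in> SI s" for t t'
  proof -
    have "FX t \<subseteq> FX t'" "FY t \<subseteq> FY t'" using that unfolding FX_def FY_def by auto
    then show ?thesis unfolding J_def by auto
  qed
  obtain f where f: "continuous_on UNIV f" "\<And>t. f t \<in> J t"
  proof (rule interpolate[of "2 ^ Q" J])
    show "convex (J t)" for t
      unfolding J_def by (rule convex_Inter) (auto simp: FX_def FY_def convex_SI)
    show "J (real_of_int i / 2 ^ Q) \<noteq> {}" for i using J_ne .
    show "J (real_of_int i / 2 ^ Q) \<subseteq> J t \<and> J ((real_of_int i + 1) / 2 ^ Q) \<subseteq> J t"
      if t: "real_of_int i / 2 ^ Q < t" "t < (real_of_int i + 1) / 2 ^ Q" for i t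
    proof -
      have "real_of_int i / 2 ^ Q \<in> SI s \<and> (real_of_int i + 1) / 2 ^ Q \<in> SI s"
        if "s \<in> ST k" "t \<in> SI s" for s k
        by (rule SI_grid[OF _ t that(2)]) (use that(1) in \<open>auto simp: ST_def restrict_map_def split: if_splits\<close>)
      then show ?thesis using J_mono[of t] by simp
    qed
  qed (simp, blast)
  define g where "g = lam (L 0) (\<lambda>u. f (base u))"
  have app_g: "app g (Base t) = f t" for t unfolding g_def app_lam_L0 by simp
  have in_C1: "g \<in> C1 a u"
    if u: "u \<in> S_dom (Suc 0)" "p \<le> Q"
      and p: "\<And>d i. d \<in> S_max \<Longrightarrow> \<bar>the (d 0)\<bar> \<le> int a \<Longrightarrow> i < a \<Longrightarrow> app u (Base (d |` {..<p})) i \<noteq> None"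
      and sel: "\<And>s t. s \<in> ST a \<Longrightarrow> t \<in> SI s \<Longrightarrow> f t \<in> SI (app u (Base s) |` {..<a})" for u a p
    unfolding C1_def
  proof (intro CollectI conjI ballI impI)
    show "g \<in> L (Suc 0)" unfolding g_def using lam_in_L1[OF f(1)] .
    fix d assume d: "d \<in> S_max" "\<bar>the (d 0)\<bar> \<le> int a"
    have dS: "d \<in> S_seqs" using d by (simp add: S_max_iff)
    have "d |` {..<Q} \<in> ST a" "S_val d \<in> SI (d |` {..<Q})"
      using d S_val_SI[OF d(1)] SI_restrict[OF dS] by (auto simp: ST_def)
    then have "f (S_val d) \<in> SI (app u (Base (d |` {..<Q})) |` {..<a})" by (rule sel)
    \<comment> \<open>Since \<open>p \<le> Q\<close>, the truncated argument already decides the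
      first a output entries, so its constraint is the one for d.\<close>
    moreover have "app u (Base (d |` {..<Q})) |` {..<a} = app u (Base d) |` {..<a}"
    proof (rule restrict_eqI)
      show "app u (Base (d |` {..<Q})) \<subseteq>\<^sub>m app u (Base d)" using dS by (intro app_S_mono[OF u(1)]) auto
      have "app u (Base (d |` {..<p})) \<subseteq>\<^sub>m app u (Base (d |` {..<Q}))"
        using dS u(2) by (intro app_S_mono[OF u(1)] restrict_le) auto
      then show "\<forall>i<a. app u (Base (d |` {..<Q})) i \<noteq> None" using p[OF d] map_leD by metis
    qed
    ultimately show "app g (Base (S_val d)) \<in> SI (app u (Base d) |` {..<a})" by (simp add: app_g)
  qed
  have "g \<in> C1 n x"
    by (rule in_C1[OF xy(1) _ q]) (use f(2) in \<open>auto simp: Q_def J_def FX_def\<close>)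
  moreover have "g \<in> C1 m y"
    by (rule in_C1[OF xy(2) _ r]) (use f(2) in \<open>auto simp: Q_def J_def FY_def\<close>)
  ultimately show ?thesis by auto
qed

lemma C1_total: assumes "x \<in> S.T (Suc 0)" shows "S.\<rho> (Suc 0) x \<in> C1 n x"
  unfolding C1_def
proof (intro CollectI conjI ballI impI)
  show "S.\<rho> (Suc 0) x \<in> L (Suc 0)" by (rule S.rho_Suc_in_L[OF S_adm_0 assms])
  fix d assume d: "d \<in> S_max"
  have dT: "Base d \<in> S.T 0" using d S_T_0 by simp
  have "S_eq (app x (Base d)) (app x (Base d))" using total_app[OF assms dT] .
  then have "app x (Base d) \<in> S_max" using S_eq_self by simp
  then have "S_val (app x (Base d)) \<in> SI (app x (Base d) |` {..<n})"
    using S_val_SI SI_restrict by (auto simp: S_max_iff)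
  then show "app (S.\<rho> (Suc 0) x) (Base (S_val d)) \<in> SI (app x (Base d) |` {..<n})"
    using S.app_rho[OF S_adm_0 assms dT] by simp
qed

lemma C1_conv:
  assumes x: "x \<in> S.T (Suc 0)" and us: "\<And>n. us n \<in> C1 n x"
  shows "Lconv (Suc 0) us (S.\<rho> (Suc 0) x)"
proof -
  have xX: "x \<in> S_dom (Suc 0)" using S.T_in x by metis
  let ?F = "S.\<rho> (Suc 0) x"
  have FL: "?F \<in> L (Suc 0)" by (rule S.rho_Suc_in_L[OF S_adm_0 x])
  have "(\<lambda>i. app (us (g i)) (vs i)) \<longlonglongrightarrow> app ?F v"
    if vs: "Lconv 0 vs v" and g: "filterlim g at_top sequentially" for vs v g
  proof -
    have F: "(\<lambda>i. app ?F (vs i)) \<longlonglongrightarrow> app ?F v" by (rule S.LSuc_cont[OF S_adm_0 FL vs])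
    define t where "t i = base (vs i)" for i
    have vt: "vs i = Base (t i)" for i using Lconv_in(1)[OF vs, of i] by (auto simp: t_def)
    have "t \<longlonglongrightarrow> base v" using vs by (simp add: t_def[abs_def])
    then have "Bseq t" using convergent_imp_Bseq convergent_def by metis
    then obtain K where K: "\<And>i. norm (t i) \<le> K" by (auto simp: Bseq_def)
    \<comment> \<open>Both values lie in the interval given by the same n output entries. A digit
      sequence for s has first entry at most |s| + 1 in absolute value, so \<open>D1 n x\<close>
      applies to it.\<close>
    have near: "\<bar>app (us n) (Base s) - app ?F (Base s)\<bar> \<le> 4 / 2 ^ n"
      if n: "0 < n" "\<bar>s\<bar> + 1 \<le> real n" for n s
    proof -
      obtain d where d: "d \<in> S_max" "S_val d = s" using strict_digits by metis
      have "\<bar>s - of_int (the (d 0))\<bar> \<le> 1"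
        using SI_D[OF S_val_SI[OF d(1)], of 0] d by (auto simp: S_max_iff pv_def)
      then have "real_of_int \<bar>the (d 0)\<bar> \<le> real_of_int (int n)" using n(2) by simp
      then have a: "\<bar>the (d 0)\<bar> \<le> int n" by linarith
      show ?thesis
      proof (rule SI_restrict_diff[OF _ n(1)])
        show "\<forall>i<n. app x (Base d) i \<noteq> None" using D1_defined[OF xX D1_total[OF x] d(1) a] by simp
        show "app (us n) (Base s) \<in> SI (app x (Base d) |` {..<n})" using us[of n] d a by (auto simp: C1_def)
        show "app ?F (Base s) \<in> SI (app x (Base d) |` {..<n})"
          using C1_total[OF x, of n] d a by (auto simp: C1_def simp del: rho.simps)
      qed
    qed
    \<comment> \<open>K bounds the convergent arguments, so the estimate holds at all of them once
      \<open>g i\<close> is large; the last + 1 gives \<open>0 < g i\<close>.\<close>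
    have "\<forall>\<^sub>F i in sequentially. norm (app (us (g i)) (vs i) - app ?F (vs i)) \<le> 4 / 2 ^ g i"
      using filterlim_comp_conv[OF g eventually_ge_at_top[of "nat \<lceil>K + 1\<rceil> + 1"]]
    proof eventually_elim
      case (elim i)
      have "K + 1 \<le> real (nat \<lceil>K + 1\<rceil>)" by (rule real_nat_ceiling_ge)
      moreover have "real (nat \<lceil>K + 1\<rceil> + 1) \<le> real (g i)" using elim by (rule of_nat_mono)
      ultimately have "\<bar>t i\<bar> + 1 \<le> real (g i)" using K[of i] unfolding of_nat_add real_norm_def by linarith
      then show ?case using near[of "g i" "t i"] elim vt by simp
    qed
    moreover have "(\<lambda>i. 4 / (2::real) ^ g i) \<longlonglongrightarrow> 0" by (rule filterlim_compose[OF four_pow_tendsto g])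
    ultimately have "(\<lambda>i. app (us (g i)) (vs i) - app ?F (vs i)) \<longlonglongrightarrow> 0" by (rule Lim_null_comparison)
    from tendsto_add[OF this F] show ?thesis by simp
  qed
  moreover have "range us \<subseteq> L (Suc 0)" using us by (auto simp: C1_def)
  ultimately show ?thesis using FL by (simp del: L.simps rho.simps)
qed

interpretation S1: S_info "Suc 0" D1 C1
proof
  show "S.adm (Suc 0)" by (rule S_adm_1)
  show "D1 0 x" for x by (simp add: D1_def)
  show "D1 n x" if D: "D1 (Suc n) x" for x n
  proof -
    obtain q where q: "\<And>d i. d \<in> S_max \<Longrightarrow> \<bar>the (d 0)\<bar> \<le> int (Suc n) \<Longrightarrow> i < Suc n \<Longrightarrow>
      app x (Base (d |` {..<q})) i \<noteq> None"
      using D by (auto simp: D1_def)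
    then show ?thesis unfolding D1_def by (intro exI[of _ q] ballI impI allI) (rule q, auto)
  qed
  show "D1 n y" if xy: "x \<in> S_dom (Suc 0)" "y \<in> S_dom (Suc 0)" "S.leX x y" "D1 n x" for x y n
  proof -
    obtain q where q: "\<And>d i. d \<in> S_max \<Longrightarrow> \<bar>the (d 0)\<bar> \<le> int n \<Longrightarrow> i < n \<Longrightarrow>
      app x (Base (d |` {..<q})) i \<noteq> None"
      using xy(4) by (auto simp: D1_def)
    have le: "app x z \<subseteq>\<^sub>m app y z" if "z \<in> S_dom 0" for z
      using S.leX_iff[OF xy(1,2)] xy(3) that by blast
    show ?thesis unfolding D1_def
    proof (intro exI[of _ q] ballI impI allI)
      fix d i assume d: "d \<in> S_max" "\<bar>the (d 0)\<bar> \<le> int n" "i < n"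
      show "app y (Base (d |` {..<q})) i \<noteq> None"
        using map_leD[OF le[OF Base_restrict_in_S[OF d(1)]] q[OF d]] q[OF d] by simp
    qed
  qed
  show "C1 n y = C1 n x" if xy: "x \<in> S_dom (Suc 0)" "y \<in> S_dom (Suc 0)" "S.leX x y" "D1 n x" for x y n
  proof -
    have "app x (Base d) |` {..<n} = app y (Base d) |` {..<n}" if d: "d \<in> S_max" "\<bar>the (d 0)\<bar> \<le> int n" for d
    proof (rule restrict_eqI)
      show "app x (Base d) \<subseteq>\<^sub>m app y (Base d)"
        using S.leX_iff[OF xy(1,2)] xy(3) Base_max_in_S[OF d(1)] by blast
      show "\<forall>i<n. app x (Base d) i \<noteq> None" using D1_defined[OF xy(1,4) d] by simp
    qed
    then show ?thesis by (auto simp: C1_def simp del: L.simps)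
  qed
  show "\<exists>m. D1 n (S.\<pi> (Suc 0) m x)" if x: "x \<in> S_dom (Suc 0)" "D1 n x" for x n
  proof -
    obtain q where q: "\<And>d i. d \<in> S_max \<Longrightarrow> \<bar>the (d 0)\<bar> \<le> int n \<Longrightarrow> i < n \<Longrightarrow>
      app x (Base (d |` {..<q})) i \<noteq> None"
      using x(2) by (auto simp: D1_def)
    \<comment> \<open>The image of \<open>S_pr M\<close> is a finite set containing the truncations
      to q entries of all arguments in question, so one m serves for all of them.\<close>
    define M where "M = max q n"
    have "\<forall>\<^sub>F m in sequentially. S_pr m (app x (Base s)) = app x (Base s) |` {..<m}" for s
      using S_pr_eventually unfolding eventually_sequentially by metis
    then have "\<forall>\<^sub>F m in sequentially. \<forall>s\<in>S_pr M ` S_seqs. S_pr m (app x (Base s)) = app x (Base s) |` {..<m}"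
      by (intro eventually_ball_finite pdom.finite_pr[OF pdom_S]) simp
    then obtain K where K: "\<And>m s. m \<ge> K \<Longrightarrow> s \<in> S_pr M ` S_seqs \<Longrightarrow> S_pr m (app x (Base s)) = app x (Base s) |` {..<m}"
      unfolding eventually_sequentially by metis
    define m where "m = max K M"
    have "D1 n (S.\<pi> (Suc 0) m x)"
      unfolding D1_def
    proof (intro exI[of _ q] ballI impI allI)
      fix d i assume d: "d \<in> S_max" "\<bar>the (d 0)\<bar> \<le> int n" "i < n"
      let ?s = "d |` {..<q}"
      have pr: "S_pr j ?s = ?s" if "j \<ge> M" for j
      proof -
        have "S_pr j ?s = ?s |` {..<j}"
          by (rule S_pr_eq) (use d(2) that in \<open>auto simp: M_def restrict_map_def split: if_splits\<close>)
        also have "\<dots> = ?s" using that by (auto simp: M_def restrict_map_def fun_eq_iff)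
        finally show ?thesis .
      qed
      have "?s \<in> S_seqs" using d(1) by (simp add: S_max_iff)
      then have "?s \<in> S_pr M ` S_seqs" using pr[of M] by (intro image_eqI[of _ _ ?s]) auto
      then have "S_pr m (app x (Base ?s)) = app x (Base ?s) |` {..<m}" using K by (simp add: m_def)
      moreover have "app (S.\<pi> (Suc 0) m x) (Base ?s) = S_pr m (app x (Base ?s))"
        unfolding S.proj_app[OF Base_restrict_in_S[OF d(1)]] using pr[of m] by (simp add: m_def)
      ultimately show "app (S.\<pi> (Suc 0) m x) (Base ?s) i \<noteq> None"
        using q[OF d] d(3) by (simp add: m_def M_def)
    qed
    then show ?thesis by blast
  qed
  show "n \<le> p" if x: "x \<in> S_dom (Suc 0)" "D1 n (S.\<pi> (Suc 0) p x)" for x n p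
  proof (rule ccontr)
    assume "\<not> n \<le> p"
    then have "p < n" by simp
    obtain q where "\<forall>d\<in>S_max. \<bar>the (d 0)\<bar> \<le> int n \<longrightarrow>
        (\<forall>i<n. app (S.\<pi> (Suc 0) p x) (Base (d |` {..<q})) i \<noteq> None)"
      using x(2) unfolding D1_def by (elim exE)
    \<comment> \<open>A single sample argument suffices: since p < n, entry p of the value would
      have to be defined, but \<open>S_pr p\<close> keeps only the entries below p.\<close>
    from bspec[OF this zero_digits] \<open>p < n\<close>
    have "app (S.\<pi> (Suc 0) p x) (Base ((\<lambda>_. Some 0) |` {..<q})) p \<noteq> None" by simp
    then have "S_pr p (app x (S.\<pi> 0 p (Base ((\<lambda>_. Some 0) |` {..<q})))) p \<noteq> None"
      unfolding S.proj_app[OF Base_restrict_in_S[OF zero_digits]] .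
    moreover have "S_pr p s p = None" for s by (simp add: S_pr_def)
    ultimately show False by simp
  qed
  show "C1 (Suc n) x \<subseteq> C1 n x" if x: "x \<in> S_dom (Suc 0)" for x n
  proof
    fix f assume f: "f \<in> C1 (Suc n) x"
    have "app f (Base (S_val d)) \<in> SI (app x (Base d) |` {..<n})" if d: "d \<in> S_max" "\<bar>the (d 0)\<bar> \<le> int n" for d
    proof -
      have "app f (Base (S_val d)) \<in> SI (app x (Base d) |` {..<Suc n})" using f d by (auto simp: C1_def)
      moreover have "app x (Base d) \<in> S_seqs" using app_S_in[OF x] d by (simp add: S_max_iff)
      ultimately show ?thesis using SI_restrict_mono[of "app x (Base d)" n "Suc n"] by auto
    qed
    then show "f \<in> C1 n x" using f by (simp add: C1_def del: L.simps)
  qed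
  show "D1 n x" if "x \<in> S.T (Suc 0)" for x n using that by (rule D1_total)
  show "S.\<rho> (Suc 0) x \<in> C1 n x" if "x \<in> S.T (Suc 0)" for x n using that by (rule C1_total)
  show "Lconv (Suc 0) us (S.\<rho> (Suc 0) x)" if "x \<in> S.T (Suc 0)" "\<And>n. us n \<in> C1 n x" for x us
    using that by (rule C1_conv)
  show "C1 n x \<inter> C1 m y \<noteq> {}"
    if "x \<in> S_dom (Suc 0)" "y \<in> S_dom (Suc 0)" "simh S_sim S_dom (Suc 0) x y" "D1 n x" "D1 m y" for x y n m
    using that by (rule C1_sim)
qed

lemma S_adm_2: "S.adm (Suc (Suc 0))"
  by (rule S1.adm_next)

section \<open>Comparison of the two hierarchies\<close>

lemma Ct_eq:
  assumes "S.adm k" "E.adm k" shows "Ct_S_set k = Ct_E_set k \<and> Ct_S k = Ct_E k"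
  unfolding Ct_S_set_def Ct_E_set_def Ct_S_def Ct_E_def
  using adm_topology_eq[OF S.thier_axioms E.thier_axioms assms] by simp

theorem theorem4p17:
  fixes n :: nat
  assumes "zero_dimensional (Ct_N n)"
  shows "Ct_S_set (n + 1) = Ct_E_set (n + 1) \<and> Ct_S (n + 1) = Ct_E (n + 1)"
proof -
  consider "n = 0" | "n = 1" | k where "n = Suc (Suc k)" by (metis One_nat_def not0_implies_Suc)
  then show ?thesis
  proof cases
    case 1 then show ?thesis using Ct_eq[OF S_adm_1 E_adm_1] by simp
  next
    case 2 then show ?thesis using Ct_eq[OF S_adm_2 E_adm_2] by simp
  next
    case 3 then show ?thesis using assms not_zero_dimensional_Ct_N by simp
  qed
qed

end
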